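(* Let $A_1,\dots,A_k$ be finite-dimensional complex vector spaces, $k\ge 2$, let $V=A_1\otimes\cdots\otimes A_k$ and $X=Seg(\mathbb P A_1\times\cdots\times\mathbb P A_k)\subset\mathbb P V$. Then, as a $GL(A_1)\times\cdots\times GL(A_k)$-module, the space of cubics vanishing on the secant variety $\sigma_2(X)$ is $$I_3(\sigma_2(X))\;\cong\;\bigoplus_{\substack{|I|+|J|+|L|=k\\ |J|>1,\ |L|>0}}\Big(\tfrac{2^{j-1}-(-1)^{j-1}}{3}\Big)\,S_3A_I^*\otimes S_{21}A_J^*\otimes S_{111}A_L^*\;\oplus\;\bigoplus_{\substack{|I|+|J|=k\\ |J|>1}}\Big(\tfrac{2^{j-1}-(-1)^{j-1}}{3}-1\Big)\,S_3A_I^*\otimes S_{21}A_J^*\;\oplus\;\bigoplus_{\substack{|I|+|L|=k\\ |L|>0\text{ even}}}S_3A_I^*\otimes S_{111}A_L^*,$$ where $j=|J|$, the sums run over all decompositions of $\{1,\dots,k\}$ into disjoint (possibly empty) subsets $I,J,L$ (respectively $I,J$; respectively $I,L$) satisfying the indicated conditions, and a numerical coefficient in front of a module denotes its multiplicity.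
   Context: Work over $\mathbb C$. $Seg(\mathbb P A_1\times\cdots\times\mathbb P A_k)\subset\mathbb P(A_1\otimes\cdots\otimes A_k)$ is the Segre variety of (classes of) decomposable tensors $a_1\otimes\cdots\otimes a_k$. For a projective variety $X\subset\mathbb P V$, $\sigma_r(X)$ is the Zariski closure of the union of the linear spans of $r$-tuples of points of $X$. $I_d(Z)\subset S^dV^*$ is the space of degree $d$ homogeneous polynomials vanishing on $Z\subset\mathbb P V$. For a partition $\pi$, $S_\pi$ denotes the Schur functor, with $S_3=S^3$ the symmetric power and $S_{111}=\Lambda^3$ the exterior power (so $S_\pi A=0$ if $\pi$ has more than $\dim A$ parts). For a subset $I\subset\{1,\dots,k\}$, $S_\pi A_I^*=\bigotimes_{i\in I}S_\pi A_i^*$. *)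

theory Defs
  imports
    Complex_Main
    "HOL-Library.Function_Algebras"
    "HOL-Library.Product_Plus"
    "HOL-Combinatorics.Permutations"
    "HOL-Algebra.Bij"
    "HOL-Algebra.Product_Groups"
begin

section \<open>Complex vector spaces\<close>

text \<open>
  A vector space is a linear subspace (a set) of a type of class \<open>complex_vector\<close>. Any finite
  family of complex vector spaces can be realised inside one such type, e.g. inside its direct sum.
\<close>

class complex_vector = ab_group_add +
  fixes scaleC :: "complex \<Rightarrow> 'a \<Rightarrow> 'a"  (infixr "*\<^sub>C" 75)
  assumes scaleC_add_right: "a *\<^sub>C (x + y) = a *\<^sub>C x + a *\<^sub>C y"
    and scaleC_add_left: "(a + b) *\<^sub>C x = a *\<^sub>C x + b *\<^sub>C x"
    and scaleC_scaleC: "a *\<^sub>C b *\<^sub>C x = (a * b) *\<^sub>C x"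
    and scaleC_one: "1 *\<^sub>C x = x"

global_interpretation cvs: vector_space "scaleC :: complex \<Rightarrow> 'a \<Rightarrow> 'a::complex_vector"
  by unfold_locales (rule scaleC_add_right scaleC_add_left scaleC_scaleC scaleC_one)+

instantiation complex :: complex_vector
begin
definition scaleC_complex_def: "a *\<^sub>C (x::complex) = a * x"
instance by standard (simp_all add: scaleC_complex_def algebra_simps)
end

instantiation "fun" :: (type, complex_vector) complex_vector
begin
definition scaleC_fun_def: "a *\<^sub>C f = (\<lambda>x. a *\<^sub>C f x)"
instance
  by standard (simp_all add: scaleC_fun_def fun_eq_iff scaleC_add_right scaleC_add_left
      scaleC_scaleC scaleC_one)
end

instantiation prod :: (complex_vector, complex_vector) complex_vector
begin
definition scaleC_prod_def: "a *\<^sub>C p = (a *\<^sub>C fst p, a *\<^sub>C snd p)"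
instance
  by standard (simp_all add: scaleC_prod_def prod_eq_iff scaleC_add_right scaleC_add_left
      scaleC_scaleC scaleC_one)
end

definition lin_on :: "'a::complex_vector set \<Rightarrow> ('a \<Rightarrow> 'b::complex_vector) \<Rightarrow> bool" where
  "lin_on W f \<longleftrightarrow>
     (\<forall>x\<in>W. \<forall>y\<in>W. f (x + y) = f x + f y) \<and> (\<forall>c. \<forall>x\<in>W. f (c *\<^sub>C x) = c *\<^sub>C f x)"

text \<open>
  Functions on a set \<open>X\<close> with values in \<open>\<complex>\<close> are represented by total functions vanishing outside
  \<open>X\<close>, so that spaces of such functions are linear subspaces of a function type.
\<close>

definition on_set :: "'x set \<Rightarrow> ('x \<Rightarrow> complex) \<Rightarrow> 'x \<Rightarrow> complex" where
  "on_set X f = (\<lambda>x. if x \<in> X then f x else 0)"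

definition dual :: "'a::complex_vector set \<Rightarrow> ('a \<Rightarrow> complex) set" where
  "dual W = {\<phi>. lin_on W \<phi> \<and> (\<forall>x. x \<notin> W \<longrightarrow> \<phi> x = 0)}"

text \<open>
  For finite \<open>K\<close> and finite-dimensional \<open>W i\<close>, the tensor product of the \<open>W i\<close> is the space of
  multilinear functions on the product of the dual spaces.
\<close>

definition tensor :: "'i set \<Rightarrow> ('i \<Rightarrow> 'a::complex_vector set) \<Rightarrow> (('i \<Rightarrow> 'a \<Rightarrow> complex) \<Rightarrow> complex) set"
  where
  "tensor K W = {T.
     (\<forall>\<psi>\<in>(\<Pi>\<^sub>E i\<in>K. dual (W i)). \<forall>i\<in>K. lin_on (dual (W i)) (\<lambda>\<phi>. T (\<psi>(i := \<phi>)))) \<and>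
     (\<forall>\<psi>. \<psi> \<notin> (\<Pi>\<^sub>E i\<in>K. dual (W i)) \<longrightarrow> T \<psi> = 0)}"

definition pure_tensor ::
  "'i set \<Rightarrow> ('i \<Rightarrow> 'a::complex_vector set) \<Rightarrow> ('i \<Rightarrow> 'a) \<Rightarrow> ('i \<Rightarrow> 'a \<Rightarrow> complex) \<Rightarrow> complex" where
  "pure_tensor K W w = on_set (\<Pi>\<^sub>E i\<in>K. dual (W i)) (\<lambda>\<psi>. \<Prod>i\<in>K. \<psi> i (w i))"

text \<open>The tensor product of endomorphisms \<open>f i\<close> of \<open>W i\<close>; it maps \<open>\<Otimes> w i\<close> to \<open>\<Otimes> f i (w i)\<close>.\<close>

definition tensor_map ::
  "'i set \<Rightarrow> ('i \<Rightarrow> 'a::complex_vector set) \<Rightarrow> ('i \<Rightarrow> 'a \<Rightarrow> 'a) \<Rightarrow>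
   (('i \<Rightarrow> 'a \<Rightarrow> complex) \<Rightarrow> complex) \<Rightarrow> ('i \<Rightarrow> 'a \<Rightarrow> complex) \<Rightarrow> complex" where
  "tensor_map K W f T =
     on_set (\<Pi>\<^sub>E i\<in>K. dual (W i)) (\<lambda>\<psi>. T (\<lambda>i\<in>K. on_set (W i) (\<lambda>x. \<psi> i (f i x))))"


section \<open>Schur functors\<close>

text \<open>
  A partition is the list of its parts. The factors of \<open>W\<^bsup>\<otimes>d\<^esup>\<close> are indexed by the boxes
  \<open>(row, column)\<close> of the Young diagram, so the row (column) group consists of the permutations
  of the boxes that preserve the first (second) coordinate.
\<close>

definition boxes :: "nat list \<Rightarrow> (nat \<times> nat) set" where
  "boxes \<pi> = {(r, c). r < length \<pi> \<and> c < \<pi> ! r}"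

definition row_group :: "nat list \<Rightarrow> (nat \<times> nat \<Rightarrow> nat \<times> nat) set" where
  "row_group \<pi> = {p. p permutes boxes \<pi> \<and> (\<forall>b. fst (p b) = fst b)}"

definition col_group :: "nat list \<Rightarrow> (nat \<times> nat \<Rightarrow> nat \<times> nat) set" where
  "col_group \<pi> = {q. q permutes boxes \<pi> \<and> (\<forall>b. snd (q b) = snd b)}"

definition young_symmetrizer ::
  "nat list \<Rightarrow> ((nat \<times> nat \<Rightarrow> 'b) \<Rightarrow> complex) \<Rightarrow> (nat \<times> nat \<Rightarrow> 'b) \<Rightarrow> complex" where
  "young_symmetrizer \<pi> T =
     (\<lambda>\<psi>. \<Sum>p\<in>row_group \<pi>. \<Sum>q\<in>col_group \<pi>. of_int (sign q) * T (\<psi> \<circ> p \<circ> q))"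

text \<open>
  The image of the Young symmetrizer on \<open>W\<^bsup>\<otimes>d\<^esup>\<close>. For \<open>[3]\<close> and \<open>[1, 1, 1]\<close> this is the space of
  symmetric, respectively skew-symmetric, tensors of order three.
\<close>

definition schur ::
  "nat list \<Rightarrow> 'a::complex_vector set \<Rightarrow> ((nat \<times> nat \<Rightarrow> 'a \<Rightarrow> complex) \<Rightarrow> complex) set" where
  "schur \<pi> W = young_symmetrizer \<pi> ` tensor (boxes \<pi>) (\<lambda>_. W)"


section \<open>Linear representations\<close>

definition GL :: "'a::complex_vector set \<Rightarrow> ('a \<Rightarrow> 'a) monoid" where
  "GL W = BijGroup W \<lparr>carrier := {g \<in> Bij W. lin_on W g}\<rparr>"

record ('g, 'm) linrep =
  vspace :: "'m set"
  act :: "'g \<Rightarrow> 'm \<Rightarrow> 'm"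

definition is_rep :: "'g monoid \<Rightarrow> ('g, 'm::complex_vector) linrep \<Rightarrow> bool" where
  "is_rep G R \<longleftrightarrow> cvs.subspace (vspace R) \<and> group_hom G (GL (vspace R)) (act R)"

definition rep_iso ::
  "'g monoid \<Rightarrow> ('g, 'm::complex_vector) linrep \<Rightarrow> ('g, 'n::complex_vector) linrep \<Rightarrow> bool" where
  "rep_iso G R S \<longleftrightarrow> is_rep G R \<and> is_rep G S \<and>
     (\<exists>\<Phi>. lin_on (vspace R) \<Phi> \<and> bij_betw \<Phi> (vspace R) (vspace S) \<and>
          (\<forall>g\<in>carrier G. \<forall>m\<in>vspace R. \<Phi> (act R g m) = act S g (\<Phi> m)))"

text \<open>The representation of \<open>\<Prod>i. GL (A i)\<close> on the single factor \<open>A i\<close>.\<close>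

definition std_rep :: "('i \<Rightarrow> 'a set) \<Rightarrow> 'i \<Rightarrow> ('i \<Rightarrow> 'a \<Rightarrow> 'a, 'a) linrep" where
  "std_rep A i = \<lparr>vspace = A i, act = (\<lambda>g. g i)\<rparr>"

text \<open>The contragredient action on functions, \<open>(g f) x = f (g\<inverse> x)\<close>.\<close>

definition contra_act ::
  "('g, 'm) linrep \<Rightarrow> 'g \<Rightarrow> ('m \<Rightarrow> complex) \<Rightarrow> 'm \<Rightarrow> complex" where
  "contra_act R g f = on_set (vspace R) (\<lambda>x. f (inv_into (vspace R) (act R g) x))"

definition dual_rep :: "('g, 'm::complex_vector) linrep \<Rightarrow> ('g, 'm \<Rightarrow> complex) linrep" where
  "dual_rep R =
     \<lparr>vspace = dual (vspace R), act = (\<lambda>g. restrict (contra_act R g) (dual (vspace R)))\<rparr>"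

definition tensor_rep ::
  "'i set \<Rightarrow> ('i \<Rightarrow> ('g, 'm::complex_vector) linrep) \<Rightarrow>
   ('g, ('i \<Rightarrow> 'm \<Rightarrow> complex) \<Rightarrow> complex) linrep" where
  "tensor_rep K R =
     \<lparr>vspace = tensor K (\<lambda>i. vspace (R i)),
      act = (\<lambda>g. restrict (tensor_map K (\<lambda>i. vspace (R i)) (\<lambda>i. act (R i) g))
                   (tensor K (\<lambda>i. vspace (R i))))\<rparr>"

definition schur_rep ::
  "nat list \<Rightarrow> ('g, 'm::complex_vector) linrep \<Rightarrow>
   ('g, (nat \<times> nat \<Rightarrow> 'm \<Rightarrow> complex) \<Rightarrow> complex) linrep" where
  "schur_rep \<pi> R =
     \<lparr>vspace = schur \<pi> (vspace R),
      act = (\<lambda>g. restrict (tensor_map (boxes \<pi>) (\<lambda>_. vspace R) (\<lambda>_. act R g))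
                   (schur \<pi> (vspace R)))\<rparr>"

text \<open>The direct sum of a family, for a finite index set \<open>X\<close>.\<close>

definition dsum_rep ::
  "'x set \<Rightarrow> ('x \<Rightarrow> ('g, 'm::complex_vector) linrep) \<Rightarrow> ('g, 'x \<Rightarrow> 'm) linrep" where
  "dsum_rep X R =
     (let W = {F. (\<forall>x\<in>X. F x \<in> vspace (R x)) \<and> (\<forall>x. x \<notin> X \<longrightarrow> F x = 0)} in
      \<lparr>vspace = W,
       act = (\<lambda>g. restrict (\<lambda>F x. if x \<in> X then act (R x) g (F x) else 0) W)\<rparr>)"

definition multiple_rep ::
  "nat \<Rightarrow> ('g, 'm::complex_vector) linrep \<Rightarrow> ('g, nat \<Rightarrow> 'm) linrep" where
  "multiple_rep m R = dsum_rep {..<m} (\<lambda>_. R)"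

definition plus_rep :: "('g, 'm) linrep \<Rightarrow> ('g, 'n) linrep \<Rightarrow> ('g, 'm \<times> 'n) linrep" where
  "plus_rep R S =
     \<lparr>vspace = vspace R \<times> vspace S,
      act = (\<lambda>g. restrict (map_prod (act R g) (act S g)) (vspace R \<times> vspace S))\<rparr>"


section \<open>Projective varieties\<close>

text \<open>Points of projective space are lines through the origin.\<close>

definition proj_space :: "'a::complex_vector set \<Rightarrow> 'a set set" where
  "proj_space V = {cvs.span {v} |v. v \<in> V \<and> v \<noteq> 0}"

text \<open>
  \<open>S\<^sup>d V\<^sup>*\<close> as the space of homogeneous polynomial functions of degree \<open>d\<close> on the
  finite-dimensional space \<open>V\<close>: linear combinations of products of \<open>d\<close> linear forms.
\<close>

definition hom_polys :: "nat \<Rightarrow> 'a::complex_vector set \<Rightarrow> ('a \<Rightarrow> complex) set" where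
  "hom_polys d V =
     cvs.span {on_set V (\<lambda>v. \<Prod>s<d. \<phi> s v) |\<phi> :: nat \<Rightarrow> 'a \<Rightarrow> complex. \<forall>s<d. \<phi> s \<in> dual V}"

definition zariski_closed :: "'a::complex_vector set \<Rightarrow> 'a set set \<Rightarrow> bool" where
  "zariski_closed V Z \<longleftrightarrow>
     (\<exists>F \<subseteq> (\<Union>d. hom_polys d V). Z = {l \<in> proj_space V. \<forall>P\<in>F. \<forall>v\<in>l - {0}. P v = 0})"

definition zariski_closure :: "'a::complex_vector set \<Rightarrow> 'a set set \<Rightarrow> 'a set set" where
  "zariski_closure V S = \<Inter>{Z. zariski_closed V Z \<and> S \<subseteq> Z}"

text \<open>\<open>\<sigma>\<^sub>r(X)\<close>; a point of \<open>\<P>V\<close> lies on the span of points \<open>x s\<close> iff it is contained in their sum.\<close>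

definition secant_variety :: "'a::complex_vector set \<Rightarrow> nat \<Rightarrow> 'a set set \<Rightarrow> 'a set set" where
  "secant_variety V r X =
     zariski_closure V
       (\<Union>x\<in>{..<r} \<rightarrow> X. {l \<in> proj_space V. l \<subseteq> cvs.span (\<Union>s<r. x s)})"

definition segre ::
  "'i set \<Rightarrow> ('i \<Rightarrow> 'a::complex_vector set) \<Rightarrow> (('i \<Rightarrow> 'a \<Rightarrow> complex) \<Rightarrow> complex) set set" where
  "segre K A = {cvs.span {pure_tensor K A a} |a. \<forall>i\<in>K. a i \<in> A i \<and> a i \<noteq> 0}"

text \<open>\<open>I\<^sub>d(Z)\<close>\<close>

definition ideal_part ::
  "nat \<Rightarrow> 'a::complex_vector set \<Rightarrow> 'a set set \<Rightarrow> ('a \<Rightarrow> complex) set" where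
  "ideal_part d V Z = {P \<in> hom_polys d V. \<forall>l\<in>Z. \<forall>v\<in>l - {0}. P v = 0}"

definition ideal_rep ::
  "nat \<Rightarrow> ('g, 'm::complex_vector) linrep \<Rightarrow> 'm set set \<Rightarrow> ('g, 'm \<Rightarrow> complex) linrep" where
  "ideal_rep d R Z =
     \<lparr>vspace = ideal_part d (vspace R) Z,
      act = (\<lambda>g. restrict (contra_act R g) (ideal_part d (vspace R) Z))\<rparr>"


section \<open>The modules in the decomposition\<close>

text \<open>
  \<open>S\<^sub>3 A\<^sub>I\<^sup>* \<otimes> S\<^sub>2\<^sub>1 A\<^sub>J\<^sup>* \<otimes> S\<^sub>1\<^sub>1\<^sub>1 A\<^sub>L\<^sup>*\<close> for disjoint \<open>I\<close>, \<open>J\<close>, \<open>L\<close>, written as one tensor product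
  over \<open>I \<union> J \<union> L\<close>.
\<close>

definition schur_term ::
  "('i \<Rightarrow> 'a::complex_vector set) \<Rightarrow> 'i set \<Rightarrow> 'i set \<Rightarrow> 'i set \<Rightarrow>
   ('i \<Rightarrow> 'a \<Rightarrow> 'a,
    ('i \<Rightarrow> ((nat \<times> nat \<Rightarrow> ('a \<Rightarrow> complex) \<Rightarrow> complex) \<Rightarrow> complex) \<Rightarrow> complex) \<Rightarrow> complex) linrep" where
  "schur_term A I J L =
     tensor_rep (I \<union> J \<union> L)
       (\<lambda>i. schur_rep (if i \<in> I then [3] else if i \<in> J then [2, 1] else [1, 1, 1])
              (dual_rep (std_rep A i)))"

definition cubic_mult :: "nat \<Rightarrow> int" where
  "cubic_mult j = (2 ^ (j - 1) - (-1) ^ (j - 1)) div 3"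

lemma three_mult_cubic_mult: "3 * cubic_mult j = 2 ^ (j - 1) - (-1) ^ (j - 1)"
proof -
  have "(3::int) dvd 2 ^ n - (-1) ^ n" for n
  proof (induction n)
    case (Suc n)
    have "(2::int) ^ Suc n - (-1) ^ Suc n = 2 * (2 ^ n - (-1) ^ n) + 3 * (-1) ^ n"
      by simp
    then show ?case using Suc by (metis dvd_add dvd_mult dvd_triv_left)
  qed simp
  then show ?thesis by (simp add: cubic_mult_def)
qed

end

theory Submission
  imports Defs
begin

text \<open>
  A cubic form vanishing on the secant variety is a symmetric trilinear form; restricted to decomposable
  tensors \<open>x, y, z\<close> it becomes a function that is trilinear in \<open>(x i, y i, z i)\<close> for every factor \<open>i\<close>,
  invariant under the simultaneous action of the symmetric group \<open>S\<^sub>3\<close>, and zero at \<open>(x, x, y)\<close>. In every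
  factor such a function splits into a symmetric part, an alternating part and two eigenspaces of the
  rotation of the three arguments, with eigenvalues the primitive cube roots of unity; each eigenspace is
  a copy of \<open>S\<^sub>2\<^sub>1\<close>, and a transposition exchanges the two. Hence for fixed \<open>I\<close>, \<open>J\<close>, \<open>L\<close> the components are
  indexed by the subsets \<open>M\<close> of \<open>J\<close>. Invariance under the rotation leaves those with \<open>3\<close> dividing
  \<open>|J| + |M|\<close>; a transposition identifies, up to the sign \<open>(-1)\<^bsup>|L|\<^esup>\<close>, the components of \<open>M\<close> and \<open>J - M\<close>;
  and vanishing at \<open>(x, x, y)\<close> says exactly that the components for \<open>L = {}\<close> sum to zero. Counting the
  remaining subsets gives the multiplicities.
\<close>

text \<open>Pure tensors span \<open>V\<close>, so a trilinear form on \<open>V\<close> is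
  determined by its values on triples of pure tensors, and every function trilinear in each factor
  extends to such a form. Tensors and Schur modules thus become spaces of functions on one domain,
  where the general linear groups substitute in the arguments and one copy of the group algebra of
  S_3 acts for each factor; the two actions commute.

  The obstacle is that the conditions on a cubic involve the diagonal S_3, whereas Schur modules are
  cut out factor by factor. The maps \<open>proj\<close> and \<open>emb\<close> are normalised so
  that, in each factor, the rotation becomes a scalar and a transposition becomes a sign times a
  relabelling; products over the factors can then be read off.

  In the multiplicity, 2^(j-1) counts the subsets of J up to complement, and the term (-1)^(j-1)
  with the division by 3 is what filtering by divisibility by 3 leaves. The lost copy for L = {} is
  the one relation that the components satisfy. With J = {} there is a single component: the sign
  kills it for odd |L|, the relation kills it for L = {}. With |J| = 1 no subset survives.\<close>

section \<open>Linear maps on subspaces, and dual spaces\<close>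

lemma sum_fun_apply: "(\<Sum>i\<in>A. f i) x = (\<Sum>i\<in>A. f i x :: complex)"
  by (induction A rule: infinite_finite_induct) (simp_all add: plus_fun_def zero_fun_def)

lemma scaleC_fun_apply: "(a *\<^sub>C f) x = a * (f x :: complex)"
  by (simp add: scaleC_fun_def scaleC_complex_def)

lemma lin_on_add: "lin_on W f \<Longrightarrow> x \<in> W \<Longrightarrow> y \<in> W \<Longrightarrow> f (x + y) = f x + f y"
  by (simp add: lin_on_def)

lemma lin_on_scale: "lin_on W f \<Longrightarrow> x \<in> W \<Longrightarrow> f (c *\<^sub>C x) = c *\<^sub>C f x"
  by (simp add: lin_on_def)

lemma lin_on_zero: "cvs.subspace W \<Longrightarrow> lin_on W f \<Longrightarrow> f 0 = 0"
  using lin_on_scale[of W f 0 0] by (simp add: cvs.subspace_0)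

lemma lin_on_sum:
  assumes "cvs.subspace W" "lin_on W f" "\<And>n. n \<in> N \<Longrightarrow> g n \<in> W"
  shows "f (\<Sum>n\<in>N. g n) = (\<Sum>n\<in>N. f (g n))"
  using assms(3)
  by (induction N rule: infinite_finite_induct)
    (simp_all add: lin_on_zero[OF assms(1,2)] lin_on_add[OF assms(2)] cvs.subspace_sum[OF assms(1)])

lemma lin_on_sum_scale:
  assumes "cvs.subspace W" "lin_on W f" "\<And>n. n \<in> N \<Longrightarrow> g n \<in> W"
  shows "f (\<Sum>n\<in>N. c n *\<^sub>C g n) = (\<Sum>n\<in>N. c n *\<^sub>C f (g n))"
  using lin_on_sum[OF assms(1,2), of N "\<lambda>n. c n *\<^sub>C g n"] assms
  by (simp add: cvs.subspace_scale lin_on_scale)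

lemma lin_on_inv_into:
  assumes "cvs.subspace W" "lin_on W f" "bij_betw f W S"
  shows "lin_on S (inv_into W f)"
proof -
  have b: "inv_into W f x \<in> W" "f (inv_into W f x) = x" if "x \<in> S" for x
    using assms(3) that bij_betw_inv_into_right[OF assms(3) that]
    by (auto simp: bij_betw_def inv_into_into)
  have l: "inv_into W f (f x) = x" if "x \<in> W" for x
    using bij_betw_inv_into_left[OF assms(3) that] .
  show ?thesis
    unfolding lin_on_def
  proof (intro conjI ballI allI)
    fix x y assume xy: "x \<in> S" "y \<in> S"
    have "inv_into W f (x + y) = inv_into W f (f (inv_into W f x + inv_into W f y))"
      using xy b by (simp add: lin_on_add[OF assms(2)])
    also have "\<dots> = inv_into W f x + inv_into W f y"
      using xy b by (intro l cvs.subspace_add[OF assms(1)])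
    finally show "inv_into W f (x + y) = inv_into W f x + inv_into W f y" .
  next
    fix c x assume x: "x \<in> S"
    have "inv_into W f (c *\<^sub>C x) = inv_into W f (f (c *\<^sub>C inv_into W f x))"
      using x b by (simp add: lin_on_scale[OF assms(2)])
    also have "\<dots> = c *\<^sub>C inv_into W f x"
      using x b by (intro l cvs.subspace_scale[OF assms(1)])
    finally show "inv_into W f (c *\<^sub>C x) = c *\<^sub>C inv_into W f x" .
  qed
qed

lemma lin_on_image_subspace:
  assumes "cvs.subspace W" "lin_on W f"
  shows "cvs.subspace (f ` W)"
  unfolding cvs.subspace_def
proof (intro conjI ballI allI)
  show "0 \<in> f ` W" using lin_on_zero[OF assms] cvs.subspace_0[OF assms(1)] by force
  fix x y assume "x \<in> f ` W" "y \<in> f ` W"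
  then obtain u v where "u \<in> W" "v \<in> W" "x = f u" "y = f v" by blast
  then have "u + v \<in> W" "x + y = f (u + v)"
    by (simp_all add: lin_on_add[OF assms(2)] cvs.subspace_add[OF assms(1)])
  then show "x + y \<in> f ` W" by (rule rev_image_eqI)
next
  fix c x assume "x \<in> f ` W"
  then obtain u where "u \<in> W" "x = f u" by blast
  then have "c *\<^sub>C u \<in> W" "c *\<^sub>C x = f (c *\<^sub>C u)"
    by (simp_all add: lin_on_scale[OF assms(2)] cvs.subspace_scale[OF assms(1)])
  then show "c *\<^sub>C x \<in> f ` W" by (rule rev_image_eqI)
qed

lemma subspace_dual: "cvs.subspace W \<Longrightarrow> cvs.subspace (dual W)"
  unfolding cvs.subspace_def dual_def lin_on_def
  by (auto simp: scaleC_fun_apply plus_fun_def zero_fun_def algebra_simps scaleC_complex_def)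

lemma dual_lin: "\<phi> \<in> dual W \<Longrightarrow> lin_on W \<phi>"
  by (simp add: dual_def)

lemma dual_outside: "\<phi> \<in> dual W \<Longrightarrow> x \<notin> W \<Longrightarrow> \<phi> x = 0"
  by (simp add: dual_def)

lemma on_set_in: "x \<in> X \<Longrightarrow> on_set X f x = f x"
  by (simp add: on_set_def)

lemma on_set_dual:
  assumes "cvs.subspace W" "lin_on W f"
  shows "on_set W f \<in> dual W"
  using assms unfolding dual_def lin_on_def on_set_def
  by (auto simp: cvs.subspace_add cvs.subspace_scale)


section \<open>Separately constrained functions\<close>

text \<open>The common form of the spaces of functions of several variables that occur below:
  \<open>S i = dual (dual (W i))\<close> gives a tensor product, \<open>S i = tri (A i)\<close> the
  trilinear functions, and fixed spaces of idempotents their isotypic parts.\<close>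

definition sep :: "'i set \<Rightarrow> ('i \<Rightarrow> 'p set) \<Rightarrow> ('i \<Rightarrow> ('p \<Rightarrow> complex) set) \<Rightarrow> (('i \<Rightarrow> 'p) \<Rightarrow> complex) set" where
  "sep K P S = {T. (\<forall>X\<in>Pi\<^sub>E K P. \<forall>i\<in>K. (\<lambda>x. T (X(i := x))) \<in> S i) \<and> (\<forall>X. X \<notin> Pi\<^sub>E K P \<longrightarrow> T X = 0)}"

definition interp :: "'p set \<Rightarrow> ('p \<Rightarrow> complex) set \<Rightarrow> 'n set \<Rightarrow> ('n \<Rightarrow> 'p) \<Rightarrow> ('n \<Rightarrow> 'p \<Rightarrow> complex) \<Rightarrow> bool" where
  "interp P S N p b \<longleftrightarrow> cvs.subspace S \<and> (\<forall>f\<in>S. \<forall>x. x \<notin> P \<longrightarrow> f x = 0) \<and> finite N \<and>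
     (\<forall>n\<in>N. p n \<in> P) \<and> (\<forall>n\<in>N. b n \<in> S) \<and> (\<forall>f\<in>S. \<forall>x. f x = (\<Sum>n\<in>N. f (p n) * b n x))"

lemma sepD: "T \<in> sep K P S \<Longrightarrow> X \<in> Pi\<^sub>E K P \<Longrightarrow> i \<in> K \<Longrightarrow> (\<lambda>x. T (X(i := x))) \<in> S i"
  by (simp add: sep_def)

lemma sep_outside: "T \<in> sep K P S \<Longrightarrow> X \<notin> Pi\<^sub>E K P \<Longrightarrow> T X = 0"
  by (simp add: sep_def)

lemma sep_cong: "(\<And>i. i \<in> K \<Longrightarrow> P i = Q i) \<Longrightarrow> (\<And>i. i \<in> K \<Longrightarrow> S i = R i) \<Longrightarrow> sep K P S = sep K Q R"
  unfolding sep_def by (simp cong: PiE_cong)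

lemma subspace_sep:
  assumes "\<And>i. i \<in> K \<Longrightarrow> cvs.subspace (S i)"
  shows "cvs.subspace (sep K P S)"
proof -
  have e: "(\<lambda>x. (f + g) (X(i := x))) = (\<lambda>x. f (X(i := x))) + (\<lambda>x. g (X(i := x)))"
    "(\<lambda>x. (c *\<^sub>C f) (X(i := x))) = c *\<^sub>C (\<lambda>x. f (X(i := x)))"
    "(\<lambda>x. (0::_\<Rightarrow>complex) (X(i := x))) = 0"
    for f g :: "('a \<Rightarrow> 'b) \<Rightarrow> complex" and X i c
    by (auto simp: fun_eq_iff scaleC_fun_apply zero_fun_def plus_fun_def)
  show ?thesis
    unfolding cvs.subspace_def sep_def mem_Collect_eq e
    using assms by (simp add: cvs.subspace_def scaleC_fun_apply zero_fun_def plus_fun_def)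
qed

text \<open>Vanishing outside the product of the dual spaces passes to every slice, and this is all
  that separates linearity of a slice from membership in the double dual.\<close>

lemma tensor_eq_sep: "tensor K W = sep K (\<lambda>i. dual (W i)) (\<lambda>i. dual (dual (W i)))"
proof -
  have "(\<lambda>x. T (\<psi>(i := x))) \<in> dual (dual (W i)) \<longleftrightarrow> lin_on (dual (W i)) (\<lambda>x. T (\<psi>(i := x)))" 
    if T: "\<forall>\<psi>. \<psi> \<notin> (\<Pi>\<^sub>E i\<in>K. dual (W i)) \<longrightarrow> T \<psi> = 0" and i: "i \<in> K" for T :: "('a \<Rightarrow> 'b \<Rightarrow> complex) \<Rightarrow> complex" and \<psi> i
  proof -
    have "T (\<psi>(i := x)) = 0" if x: "x \<notin> dual (W i)" for x
      using T i x by (metis PiE_mem fun_upd_same)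
    then show ?thesis by (simp add: dual_def[of "dual (W i)"])
  qed
  then show ?thesis
    unfolding tensor_def sep_def by blast
qed

lemma sum_PiE_insert:
  assumes "i \<notin> F"
  shows "(\<Sum>n\<in>Pi\<^sub>E (insert i F) N. g n) = (\<Sum>n\<in>Pi\<^sub>E F N. \<Sum>m\<in>N i. (g (n(i := m)) :: 'c::comm_monoid_add))"
proof -
  have "(\<Sum>n\<in>Pi\<^sub>E (insert i F) N. g n) = (\<Sum>(m, n)\<in>N i \<times> Pi\<^sub>E F N. g (n(i := m)))"
    unfolding PiE_insert_eq sum.reindex[OF inj_combinator[OF assms]]
    by (simp add: case_prod_unfold comp_def)
  also have "\<dots> = (\<Sum>m\<in>N i. \<Sum>n\<in>Pi\<^sub>E F N. g (n(i := m)))"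
    by (rule sum.cartesian_product[symmetric])
  also have "\<dots> = (\<Sum>n\<in>Pi\<^sub>E F N. \<Sum>m\<in>N i. g (n(i := m)))"
    by (rule sum.swap)
  finally show ?thesis .
qed

lemma PiE_updD: "X \<in> Pi\<^sub>E K P \<Longrightarrow> i \<in> K \<Longrightarrow> x \<in> P i \<Longrightarrow> X(i := x) \<in> Pi\<^sub>E K P"
  by (auto simp: PiE_iff extensional_def)

text \<open>
  Values at the points \<open>p n\<close> determine the members of \<open>S\<close>, with the coefficient functions \<open>b n\<close> in \<open>S\<close>
  itself: a form of finite-dimensionality that passes to invariant subspaces, because the \<open>b n\<close> need
  not be linearly independent.
\<close>

lemma interpD:
  assumes "interp P S N p b"
  shows "cvs.subspace S" "\<And>f x. f \<in> S \<Longrightarrow> x \<notin> P \<Longrightarrow> f x = 0" "finite N" "\<And>n. n \<in> N \<Longrightarrow> p n \<in> P"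
    "\<And>n. n \<in> N \<Longrightarrow> b n \<in> S" "\<And>f x. f \<in> S \<Longrightarrow> f x = (\<Sum>n\<in>N. f (p n) * b n x)"
  using assms unfolding interp_def by blast+

text \<open>The interpolation formula is applied to one variable after another.\<close>

lemma sep_expand:
  assumes K: "finite K" and T: "T \<in> sep K P S" and X: "X \<in> Pi\<^sub>E K P"
    and ip: "\<And>i. i \<in> K \<Longrightarrow> interp (P i) (S i) (N i) (p i) (b i)"
  shows "T X = (\<Sum>n\<in>Pi\<^sub>E K N. T (\<lambda>i\<in>K. p i (n i)) * (\<Prod>i\<in>K. b i (n i) (X i)))"
proof -
  \<comment> \<open>The variables in \<open>F\<close> have already been replaced by grid points; the
    others still carry the values of \<open>X\<close>.\<close>
  have "T X = (\<Sum>n\<in>Pi\<^sub>E F N. T (\<lambda>i. if i \<in> F then p i (n i) else X i) * (\<Prod>i\<in>F. b i (n i) (X i)))"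
    if "F \<subseteq> K" for F
    using finite_subset[OF that K] that
  proof (induction F rule: finite_induct)
    case empty
    show ?case by simp
  next
    case (insert i F)
    have "T (\<lambda>j. if j \<in> F then p j (n j) else X j) * (\<Prod>j\<in>F. b j (n j) (X j)) =
      (\<Sum>m\<in>N i. T (\<lambda>j. if j \<in> insert i F then p j ((n(i := m)) j) else X j) *
         (\<Prod>j\<in>insert i F. b j ((n(i := m)) j) (X j)))" (is "T ?Y * _ = _") if n: "n \<in> Pi\<^sub>E F N" for n
    proof -
      have Y: "?Y \<in> Pi\<^sub>E K P"
        using n insert.prems X interpD(4)[OF ip] by (fastforce simp: PiE_iff extensional_def)
      have i: "i \<in> K" using insert.prems by simp
      have "T (?Y(i := X i)) = (\<Sum>m\<in>N i. T (?Y(i := p i m)) * b i m (X i))"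
        using interpD(6)[OF ip[OF i] sepD[OF T Y i], of "X i"] .
      moreover have "?Y(i := X i) = ?Y" using insert.hyps by auto
      moreover have "?Y(i := p i m) = (\<lambda>j. if j \<in> insert i F then p j ((n(i := m)) j) else X j)" for m
        using insert.hyps by auto
      moreover have "(\<Prod>j\<in>insert i F. b j ((n(i := m)) j) (X j)) = b i m (X i) * (\<Prod>j\<in>F. b j (n j) (X j))" for m
        using insert.hyps by (auto intro!: prod.cong)
      ultimately show ?thesis by (simp add: sum_distrib_right mult.assoc)
    qed
    then show ?case
      using insert by (simp add: sum_PiE_insert)
  qed
  from this[of K] have "T X = (\<Sum>n\<in>Pi\<^sub>E K N. T (\<lambda>i. if i \<in> K then p i (n i) else X i) * (\<Prod>i\<in>K. b i (n i) (X i)))"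
    by simp
  moreover have "(\<lambda>i. if i \<in> K then p i (n i) else X i) = (\<lambda>i\<in>K. p i (n i))" for n
    using X by (auto simp: restrict_def PiE_iff extensional_def)
  ultimately show ?thesis by simp
qed

lemma sep_product:
  assumes K: "finite K" and b: "\<And>i. i \<in> K \<Longrightarrow> b i \<in> S i" and S: "\<And>i. i \<in> K \<Longrightarrow> cvs.subspace (S i)"
    and out: "\<And>i f x. i \<in> K \<Longrightarrow> f \<in> S i \<Longrightarrow> x \<notin> P i \<Longrightarrow> f x = 0"
  shows "on_set (Pi\<^sub>E K P) (\<lambda>X. \<Prod>i\<in>K. b i (X i)) \<in> sep K P S"
  unfolding sep_def
proof (intro CollectI conjI ballI allI impI)
  fix X i assume X: "X \<in> Pi\<^sub>E K P" and i: "i \<in> K"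
  have "on_set (Pi\<^sub>E K P) (\<lambda>X. \<Prod>i\<in>K. b i (X i)) (X(i := x)) = (\<Prod>j\<in>K - {i}. b j (X j)) * b i x" for x
  proof (cases "x \<in> P i")
    case True
    have "(\<Prod>j\<in>K - {i}. b j ((X(i := x)) j)) = (\<Prod>j\<in>K - {i}. b j (X j))"
      by (rule prod.cong) auto
    then show ?thesis
      using PiE_updD[OF X i True] prod.remove[OF K i, of "\<lambda>j. b j ((X(i := x)) j)"]
      by (simp add: on_set_def mult.commute)
  next
    case False
    then have "X(i := x) \<notin> Pi\<^sub>E K P" using i by (metis PiE_mem fun_upd_same)
    then show ?thesis using out[OF i b[OF i] False] by (simp add: on_set_def)
  qed
  then have "(\<lambda>x. on_set (Pi\<^sub>E K P) (\<lambda>X. \<Prod>i\<in>K. b i (X i)) (X(i := x))) = (\<Prod>j\<in>K - {i}. b j (X j)) *\<^sub>C b i"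
    by (simp add: fun_eq_iff scaleC_fun_apply)
  then show "(\<lambda>x. on_set (Pi\<^sub>E K P) (\<lambda>X. \<Prod>i\<in>K. b i (X i)) (X(i := x))) \<in> S i"
    using cvs.subspace_scale[OF S[OF i] b[OF i]] by simp
qed (simp add: on_set_def)

lemma sep_combination:
  assumes K: "finite K" and ip: "\<And>i. i \<in> K \<Longrightarrow> interp (P i) (S i) (N i) (p i) (b i)"
  shows "on_set (Pi\<^sub>E K P) (\<lambda>X. \<Sum>n\<in>Pi\<^sub>E K N. C n * (\<Prod>i\<in>K. b i (n i) (X i))) \<in> sep K P S"
proof -
  have "(\<Sum>n\<in>Pi\<^sub>E K N. C n *\<^sub>C on_set (Pi\<^sub>E K P) (\<lambda>X. \<Prod>i\<in>K. b i (n i) (X i))) \<in> sep K P S"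
    using interpD(1,2,5)[OF ip]
    by (intro cvs.subspace_sum cvs.subspace_scale subspace_sep sep_product K) (simp_all add: PiE_mem)
  moreover have "(\<Sum>n\<in>Pi\<^sub>E K N. C n *\<^sub>C on_set (Pi\<^sub>E K P) (\<lambda>X. \<Prod>i\<in>K. b i (n i) (X i))) =
    on_set (Pi\<^sub>E K P) (\<lambda>X. \<Sum>n\<in>Pi\<^sub>E K N. C n * (\<Prod>i\<in>K. b i (n i) (X i)))"
    by (simp add: fun_eq_iff sum_fun_apply scaleC_fun_apply on_set_def)
  ultimately show ?thesis by simp
qed

section \<open>Tensor products of function spaces as functions of several variables\<close>

text \<open>Each \<open>W i\<close> is presented as a space of functions on \<open>P i\<close>
  through \<iota>. A tensor takes functionals as arguments, so inserting the evaluations at the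
  points \<open>X i\<close> turns it into a function of these points.\<close>

definition tensor_fun ::
  "'i set \<Rightarrow> ('i \<Rightarrow> 'p set) \<Rightarrow> ('i \<Rightarrow> 'w::complex_vector set) \<Rightarrow> ('i \<Rightarrow> 'w \<Rightarrow> 'p \<Rightarrow> complex) \<Rightarrow>
   (('i \<Rightarrow> 'w \<Rightarrow> complex) \<Rightarrow> complex) \<Rightarrow> ('i \<Rightarrow> 'p) \<Rightarrow> complex" where
  "tensor_fun K P W \<iota> T = on_set (Pi\<^sub>E K P) (\<lambda>X. T (\<lambda>i\<in>K. on_set (W i) (\<lambda>w. \<iota> i w (X i))))"

lemma lin_on_tensor_fun: "lin_on D (tensor_fun K P W \<iota>)"
  by (auto simp: lin_on_def tensor_fun_def fun_eq_iff on_set_def scaleC_fun_apply)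

lemma lin_on_eval: "lin_on W f \<Longrightarrow> lin_on W (\<lambda>w. f w x :: complex)"
  by (simp add: lin_on_def scaleC_fun_def scaleC_complex_def)

text \<open>Every w in \<open>W\<close> is the combination of the preimages of the
  \<open>b n\<close> with coefficients \<iota> w (p n). Hence the evaluations at the points
  \<open>p n\<close> span the dual of \<open>W\<close>, and a functional on the dual is determined
  by its values on them.\<close>

lemma interp_dual_dual:
  assumes W: "cvs.subspace W" and l: "lin_on W \<iota>" and bij: "bij_betw \<iota> W S" and ip: "interp P S N p b"
  shows "interp (dual W) (dual (dual W)) N (\<lambda>n. on_set W (\<lambda>w. \<iota> w (p n)))
     (\<lambda>n. on_set (dual W) (\<lambda>\<phi>. \<phi> (inv_into W \<iota> (b n))))"
proof -
  let ?b = "\<lambda>n. inv_into W \<iota> (b n)" and ?e = "\<lambda>n. on_set W (\<lambda>w. \<iota> w (p n))"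
  have b: "?b n \<in> W" "\<iota> (?b n) = b n" if "n \<in> N" for n
    using interpD(5)[OF ip that] bij bij_betw_inv_into_right[OF bij, of "b n"]
    by (auto simp: bij_betw_def inv_into_into)
  have e: "?e n \<in> dual W" for n by (rule on_set_dual[OF W lin_on_eval[OF l]])
  have ev: "w = (\<Sum>n\<in>N. \<iota> w (p n) *\<^sub>C ?b n)" if w: "w \<in> W" for w
  proof -
    have i: "inj_on \<iota> W" using bij by (simp add: bij_betw_def)
    have "\<iota> w \<in> S" using bij w by (auto simp: bij_betw_def)
    then have "\<iota> w = (\<Sum>n\<in>N. \<iota> w (p n) *\<^sub>C b n)"
      using interpD(6)[OF ip] by (simp add: fun_eq_iff sum_fun_apply scaleC_fun_apply)
    also have "\<dots> = \<iota> (\<Sum>n\<in>N. \<iota> w (p n) *\<^sub>C ?b n)"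
      by (subst lin_on_sum_scale[OF W l]) (simp_all add: b)
    finally show ?thesis
      using inj_onD[OF i] w b(1) by (metis (no_types, lifting) cvs.subspace_sum[OF W] cvs.subspace_scale[OF W])
  qed
  have exp: "f \<phi> = (\<Sum>n\<in>N. f (?e n) * on_set (dual W) (\<lambda>\<phi>. \<phi> (?b n)) \<phi>)" if f: "f \<in> dual (dual W)" for f \<phi>
  proof (cases "\<phi> \<in> dual W")
    case True
    have "\<phi> = (\<Sum>n\<in>N. \<phi> (?b n) *\<^sub>C ?e n)"
    proof
      fix w
      show "\<phi> w = (\<Sum>n\<in>N. \<phi> (?b n) *\<^sub>C ?e n) w"
      proof (cases "w \<in> W")
        case w: True
        have "\<phi> w = \<phi> (\<Sum>n\<in>N. \<iota> w (p n) *\<^sub>C ?b n)" using ev[OF w] by simp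
        also have "\<dots> = (\<Sum>n\<in>N. \<iota> w (p n) *\<^sub>C \<phi> (?b n))"
          by (rule lin_on_sum_scale[OF W dual_lin[OF True] b(1)])
        finally show ?thesis
          using w by (simp add: sum_fun_apply scaleC_fun_apply on_set_def scaleC_complex_def mult.commute)
      next
        case False
        then show ?thesis using True by (simp add: sum_fun_apply scaleC_fun_apply on_set_def dual_outside)
      qed
    qed
    then have "f \<phi> = f (\<Sum>n\<in>N. \<phi> (?b n) *\<^sub>C ?e n)" by simp
    also have "\<dots> = (\<Sum>n\<in>N. \<phi> (?b n) *\<^sub>C f (?e n))"
      by (rule lin_on_sum_scale[OF subspace_dual[OF W] dual_lin[OF f] e])
    finally show ?thesis using True by (simp add: on_set_def scaleC_complex_def mult.commute)
  next
    case False
    then show ?thesis using f by (simp add: on_set_def dual_outside)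
  qed
  show ?thesis
    unfolding interp_def
  proof (intro conjI ballI allI impI)
    show "on_set (dual W) (\<lambda>\<phi>. \<phi> (?b n)) \<in> dual (dual W)" for n
      by (rule on_set_dual[OF subspace_dual[OF W]]) (simp add: lin_on_def scaleC_fun_def)
    show "f \<phi> = (\<Sum>n\<in>N. f (?e n) * on_set (dual W) (\<lambda>\<phi>. \<phi> (?b n)) \<phi>)" if "f \<in> dual (dual W)" for f \<phi>
      by (rule exp[OF that])
  qed (simp_all add: subspace_dual W dual_outside interpD(3)[OF ip] e)
qed

text \<open>Both halves rest on one expansion: evaluations at grid points determine a tensor, and a
  tensor with prescribed values there can be written down. The result serves twice, for the boxes of
  a Young diagram and for the factors in \<open>K\<close>.\<close>

lemma tensor_fun_bij:
  assumes K: "finite K" and W: "\<And>i. i \<in> K \<Longrightarrow> cvs.subspace (W i)" and l: "\<And>i. i \<in> K \<Longrightarrow> lin_on (W i) (\<iota> i)"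
    and bij: "\<And>i. i \<in> K \<Longrightarrow> bij_betw (\<iota> i) (W i) (S i)"
    and ip: "\<And>i. i \<in> K \<Longrightarrow> interp (P i) (S i) (N i) (p i) (b i)"
  shows "bij_betw (tensor_fun K P W \<iota>) (tensor K W) (sep K P S)"
proof -
  let ?e = "\<lambda>i x. on_set (W i) (\<lambda>w. \<iota> i w x)" and ?b = "\<lambda>i n. inv_into (W i) (\<iota> i) (b i n)"
  let ?d = "\<lambda>i n. on_set (dual (W i)) (\<lambda>\<phi>. \<phi> (?b i n))"
  have ip': "interp (dual (W i)) (dual (dual (W i))) (N i) (\<lambda>n. ?e i (p i n)) (?d i)" if "i \<in> K" for i
    by (rule interp_dual_dual[OF W[OF that] l[OF that] bij[OF that] ip[OF that]])
  have b: "?b i n \<in> W i" "\<iota> i (?b i n) = b i n" if "i \<in> K" "n \<in> N i" for i n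
    using interpD(5)[OF ip[OF that(1)] that(2)] bij[OF that(1)] bij_betw_inv_into_right[OF bij[OF that(1)], of "b i n"]
    by (auto simp: bij_betw_def inv_into_into)
  have e: "?e i x \<in> dual (W i)" if "i \<in> K" for i x by (rule on_set_dual[OF W[OF that] lin_on_eval[OF l[OF that]]])
  have eX: "(\<lambda>i\<in>K. ?e i (X i)) \<in> (\<Pi>\<^sub>E i\<in>K. dual (W i))" for X using e by auto
  have pn: "(\<lambda>i\<in>K. p i (n i)) \<in> Pi\<^sub>E K P" if "n \<in> Pi\<^sub>E K N" for n
    using that interpD(4)[OF ip] by (auto simp: PiE_iff)
  have sub: "tensor_fun K P W \<iota> T \<in> sep K P S" if T: "T \<in> tensor K W" for T
    unfolding sep_def
  proof (intro CollectI conjI ballI allI impI)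
    fix X i assume X: "X \<in> Pi\<^sub>E K P" and i: "i \<in> K"
    let ?\<psi> = "\<lambda>i\<in>K. ?e i (X i)"
    have "tensor_fun K P W \<iota> T (X(i := x)) = (\<Sum>n\<in>N i. T (?\<psi>(i := ?e i (p i n))) *\<^sub>C b i n) x" for x
    proof (cases "x \<in> P i")
      case True
      have "tensor_fun K P W \<iota> T (X(i := x)) = T (\<lambda>j\<in>K. ?e j ((X(i := x)) j))"
        unfolding tensor_fun_def by (rule on_set_in[OF PiE_updD[OF X i True]])
      also have "(\<lambda>j\<in>K. ?e j ((X(i := x)) j)) = ?\<psi>(i := ?e i x)"
        using i by (auto simp: restrict_def)
      also have "T (?\<psi>(i := ?e i x)) = (\<Sum>n\<in>N i. T (?\<psi>(i := ?e i (p i n))) * ?d i n (?e i x))"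
        by (rule interpD(6)[OF ip'[OF i] sepD[OF T[unfolded tensor_eq_sep] eX i]])
      also have "\<dots> = (\<Sum>n\<in>N i. T (?\<psi>(i := ?e i (p i n))) * b i n x)"
        using b i e by (intro sum.cong refl) (simp add: on_set_def)
      finally show ?thesis unfolding sum_fun_apply scaleC_fun_apply .
    next
      case False
      then have "X(i := x) \<notin> Pi\<^sub>E K P" using i by (metis PiE_mem fun_upd_same)
      then show ?thesis
        using interpD(2)[OF ip[OF i] interpD(5)[OF ip[OF i]] False]
        by (simp add: tensor_fun_def on_set_def sum_fun_apply scaleC_fun_apply)
    qed
    then have "(\<lambda>x. tensor_fun K P W \<iota> T (X(i := x))) = (\<Sum>n\<in>N i. T (?\<psi>(i := ?e i (p i n))) *\<^sub>C b i n)" by blast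
    then show "(\<lambda>x. tensor_fun K P W \<iota> T (X(i := x))) \<in> S i"
      using interpD(1,5)[OF ip[OF i]] by (simp add: cvs.subspace_sum cvs.subspace_scale)
  qed (simp add: tensor_fun_def on_set_def)
  have expT: "T \<psi> = (\<Sum>n\<in>Pi\<^sub>E K N. tensor_fun K P W \<iota> T (\<lambda>i\<in>K. p i (n i)) * (\<Prod>i\<in>K. ?d i (n i) (\<psi> i)))"
    if T: "T \<in> tensor K W" and \<psi>: "\<psi> \<in> (\<Pi>\<^sub>E i\<in>K. dual (W i))" for T \<psi>
  proof -
    have "tensor_fun K P W \<iota> T (\<lambda>i\<in>K. p i (n i)) = T (\<lambda>i\<in>K. ?e i (p i (n i)))" if "n \<in> Pi\<^sub>E K N" for n
    proof -
      have "(\<lambda>i\<in>K. on_set (W i) (\<lambda>w. \<iota> i w ((\<lambda>i\<in>K. p i (n i)) i))) = (\<lambda>i\<in>K. ?e i (p i (n i)))"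
        by (auto simp: restrict_def)
      then show ?thesis unfolding tensor_fun_def on_set_in[OF pn[OF that]] by (rule arg_cong)
    qed
    then show ?thesis
      using sep_expand[OF K T[unfolded tensor_eq_sep] \<psi> ip'] by simp
  qed
  have inj: "inj_on (tensor_fun K P W \<iota>) (tensor K W)"
  proof (rule inj_onI, rule ext)
    fix T U \<psi> assume T: "T \<in> tensor K W" and U: "U \<in> tensor K W" and eq: "tensor_fun K P W \<iota> T = tensor_fun K P W \<iota> U"
    show "T \<psi> = U \<psi>"
    proof (cases "\<psi> \<in> (\<Pi>\<^sub>E i\<in>K. dual (W i))")
      case True
      then show ?thesis using expT[OF T] expT[OF U] eq by simp
    next
      case False
      then show ?thesis using T U by (simp add: tensor_def)
    qed
  qed
  have "U \<in> tensor_fun K P W \<iota> ` tensor K W" if U: "U \<in> sep K P S" for U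
  proof -
    \<comment> \<open>The tensor that takes the values of \<open>U\<close> on the grid, assembled
      from the coefficient functionals in the double duals.\<close>
    define T where "T = on_set (\<Pi>\<^sub>E i\<in>K. dual (W i))
       (\<lambda>\<psi>. \<Sum>n\<in>Pi\<^sub>E K N. U (\<lambda>i\<in>K. p i (n i)) * (\<Prod>i\<in>K. ?d i (n i) (\<psi> i)))"
    have T: "T \<in> tensor K W"
      unfolding T_def tensor_eq_sep by (rule sep_combination[OF K ip'])
    have "tensor_fun K P W \<iota> T X = U X" for X
    proof (cases "X \<in> Pi\<^sub>E K P")
      case True
      have "tensor_fun K P W \<iota> T X = (\<Sum>n\<in>Pi\<^sub>E K N. U (\<lambda>i\<in>K. p i (n i)) * (\<Prod>i\<in>K. ?d i (n i) (?e i (X i))))"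
        unfolding tensor_fun_def T_def on_set_in[OF True] on_set_in[OF eX]
        by (intro sum.cong prod.cong arg_cong2[where f="(*)"] refl) simp
      also have "\<dots> = (\<Sum>n\<in>Pi\<^sub>E K N. U (\<lambda>i\<in>K. p i (n i)) * (\<Prod>i\<in>K. b i (n i) (X i)))"
      proof (intro sum.cong prod.cong arg_cong2[where f="(*)"] refl)
        fix n i assume "n \<in> Pi\<^sub>E K N" "i \<in> K"
        then show "?d i (n i) (?e i (X i)) = b i (n i) (X i)"
          using b[of i "n i"] e[of i] by (simp add: on_set_def PiE_mem)
      qed
      also have "\<dots> = U X" by (rule sep_expand[OF K U True ip, symmetric])
      finally show ?thesis .
    next
      case False
      then show ?thesis using U by (simp add: tensor_fun_def on_set_def sep_outside)
    qed
    then show ?thesis using T by (metis ext image_iff)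
  qed
  then show ?thesis using inj sub unfolding bij_betw_def by blast
qed

text \<open>Endomorphisms that amount to substituting \<open>h i\<close> into the argument combine
  to a simultaneous substitution. In this way group actions on tensors become substitutions.\<close>

lemma tensor_fun_tensor_map:
  assumes W: "\<And>i. i \<in> K \<Longrightarrow> cvs.subspace (W i)" and l: "\<And>i. i \<in> K \<Longrightarrow> lin_on (W i) (\<iota> i)"
    and f: "\<And>i w. i \<in> K \<Longrightarrow> w \<in> W i \<Longrightarrow> f i w \<in> W i"
    and h: "\<And>i x. i \<in> K \<Longrightarrow> x \<in> P i \<Longrightarrow> h i x \<in> P i"
    and eq: "\<And>i w x. i \<in> K \<Longrightarrow> w \<in> W i \<Longrightarrow> x \<in> P i \<Longrightarrow> \<iota> i (f i w) x = \<iota> i w (h i x)"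
    and X: "X \<in> Pi\<^sub>E K P"
  shows "tensor_fun K P W \<iota> (tensor_map K W f T) X = tensor_fun K P W \<iota> T (\<lambda>i\<in>K. h i (X i))"
proof -
  let ?e = "\<lambda>i x. on_set (W i) (\<lambda>w. \<iota> i w x)"
  have e: "(\<lambda>i\<in>K. ?e i (X i)) \<in> (\<Pi>\<^sub>E i\<in>K. dual (W i))" for X
    using on_set_dual[OF W lin_on_eval[OF l]] by auto
  have hX: "(\<lambda>i\<in>K. h i (X i)) \<in> Pi\<^sub>E K P" using X h by (auto simp: PiE_iff)
  have "(\<lambda>i\<in>K. on_set (W i) (\<lambda>x. (\<lambda>i\<in>K. ?e i (X i)) i (f i x))) = (\<lambda>i\<in>K. ?e i ((\<lambda>i\<in>K. h i (X i)) i))"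
    using X f eq by (auto simp: restrict_def on_set_def fun_eq_iff PiE_mem)
  then show ?thesis
    unfolding tensor_fun_def tensor_map_def on_set_in[OF X] on_set_in[OF hX] on_set_in[OF e] by (rule arg_cong)
qed

section \<open>Permutations of triples and the group algebra of the symmetric group\<close>

text \<open>Indices 0, 1, 2 are the rotations and 3, 4, 5 the transpositions; every larger index
  acts like 5. With a fixed numbering, elements of the group algebra are plain coefficient
  vectors.\<close>

definition pm :: "nat \<Rightarrow> 'v \<times> 'v \<times> 'v \<Rightarrow> 'v \<times> 'v \<times> 'v" where
  "pm s = (\<lambda>(x, y, z). if s = 0 then (x, y, z) else if s = 1 then (y, z, x) else if s = 2 then (z, x, y)
     else if s = 3 then (y, x, z) else if s = 4 then (x, z, y) else (z, y, x))"

lemma pm_simps [simp]: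
  "pm 0 (x, y, z) = (x, y, z)" "pm (Suc 0) (x, y, z) = (y, z, x)" "pm 2 (x, y, z) = (z, x, y)"
  "pm 3 (x, y, z) = (y, x, z)" "pm 4 (x, y, z) = (x, z, y)" "pm 5 (x, y, z) = (z, y, x)"
  by (simp_all add: pm_def)

lemma pm_0 [simp]: "pm 0 t = t"
  by (cases t) simp

definition pm_mult :: "nat \<Rightarrow> nat \<Rightarrow> nat" where
  "pm_mult s t = [[0, 1, 2, 3, 4, 5], [1, 2, 0, 4, 5, 3], [2, 0, 1, 5, 3, 4],
     [3, 5, 4, 0, 2, 1], [4, 3, 5, 1, 0, 2], [5, 4, 3, 2, 1, 0]] ! s ! t"

lemma less_6_cases: "s < 6 \<Longrightarrow> s = 0 \<or> s = 1 \<or> s = 2 \<or> s = 3 \<or> s = 4 \<or> s = (5::nat)"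
  by arith

lemma pm_pm: "s < 6 \<Longrightarrow> t < 6 \<Longrightarrow> pm s (pm t x) = pm (pm_mult s t) x"
  by (cases x) (elim less_6_cases[THEN disjE] disjE; simp add: pm_mult_def)

definition cube :: "'v set \<Rightarrow> ('v \<times> 'v \<times> 'v) set" where
  "cube B = B \<times> B \<times> B"

lemma pm_cube [simp]: "pm s t \<in> cube B \<longleftrightarrow> t \<in> cube B"
  by (cases t) (auto simp: pm_def cube_def)

lemma sum_less_6: "(\<Sum>s<6::nat. f s) = f 0 + f 1 + f 2 + f 3 + f 4 + (f 5 :: 'c::comm_monoid_add)"
  by (simp add: eval_nat_numeral lessThan_Suc add_ac)

definition vec6 :: "complex \<Rightarrow> complex \<Rightarrow> complex \<Rightarrow> complex \<Rightarrow> complex \<Rightarrow> complex \<Rightarrow> nat \<Rightarrow> complex" where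
  "vec6 a b c d e f s = (if s = 0 then a else if s = 1 then b else if s = 2 then c else if s = 3 then d
     else if s = 4 then e else if s = 5 then f else 0)"

lemma vec6_simps [simp]:
  "vec6 a b c d e f 0 = a" "vec6 a b c d e f (Suc 0) = b" "vec6 a b c d e f 2 = c"
  "vec6 a b c d e f 3 = d" "vec6 a b c d e f 4 = e" "vec6 a b c d e f 5 = f"
  by (simp_all add: vec6_def)

text \<open>The product of the group algebra in the order of composition of operators:
  \<open>perm_op a (perm_op b f)\<close> evaluates \<open>f\<close> at \<open>pm t (pm s x)\<close>,
  so the multiplication table is entered as \<open>pm_mult t s\<close>.\<close>

definition conv :: "(nat \<Rightarrow> complex) \<Rightarrow> (nat \<Rightarrow> complex) \<Rightarrow> nat \<Rightarrow> complex" where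
  "conv a b = vec6
     (a 0 * b 0 + a 1 * b 2 + a 2 * b 1 + a 3 * b 3 + a 4 * b 4 + a 5 * b 5)
     (a 0 * b 1 + a 1 * b 0 + a 2 * b 2 + a 3 * b 4 + a 4 * b 5 + a 5 * b 3)
     (a 0 * b 2 + a 1 * b 1 + a 2 * b 0 + a 3 * b 5 + a 4 * b 3 + a 5 * b 4)
     (a 0 * b 3 + a 1 * b 4 + a 2 * b 5 + a 3 * b 0 + a 4 * b 2 + a 5 * b 1)
     (a 0 * b 4 + a 1 * b 5 + a 2 * b 3 + a 3 * b 1 + a 4 * b 0 + a 5 * b 2)
     (a 0 * b 5 + a 1 * b 3 + a 2 * b 4 + a 3 * b 2 + a 4 * b 1 + a 5 * b 0)"

lemma sum_conv: "(\<Sum>s<6. \<Sum>t<6. a s * (b t * f (pm_mult t s))) = (\<Sum>u<6. conv a b u * f u)"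
  unfolding sum_less_6 by (simp add: conv_def pm_mult_def algebra_simps)

definition perm_op :: "(nat \<Rightarrow> complex) \<Rightarrow> ('v \<times> 'v \<times> 'v \<Rightarrow> complex) \<Rightarrow> 'v \<times> 'v \<times> 'v \<Rightarrow> complex" where
  "perm_op a f x = (\<Sum>s<6. a s * f (pm s x))"

lemma perm_op_comp: "perm_op a (perm_op b f) = perm_op (conv a b) f"
proof
  fix x
  have "perm_op a (perm_op b f) x = (\<Sum>s<6. \<Sum>t<6. a s * (b t * f (pm (pm_mult t s) x)))"
    by (simp add: perm_op_def sum_distrib_left pm_pm)
  also have "\<dots> = perm_op (conv a b) f x"
    unfolding perm_op_def by (rule sum_conv)
  finally show "perm_op a (perm_op b f) x = perm_op (conv a b) f x" .
qed

section \<open>Tensor powers of the group algebra acting on functions of several triples\<close>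

text \<open>The action of the pure tensor of the \<open>a i\<close>, with one copy of S_3 for each
  factor. Cutting off outside the product of the cubes keeps the result in the form that
  \<open>sep\<close> demands.\<close>

definition tensor_op :: "'i set \<Rightarrow> ('i \<Rightarrow> 'v set) \<Rightarrow> ('i \<Rightarrow> nat \<Rightarrow> complex) \<Rightarrow>
    (('i \<Rightarrow> 'v \<times> 'v \<times> 'v) \<Rightarrow> complex) \<Rightarrow> ('i \<Rightarrow> 'v \<times> 'v \<times> 'v) \<Rightarrow> complex" where
  "tensor_op K B a T = on_set (\<Pi>\<^sub>E i\<in>K. cube (B i))
     (\<lambda>X. \<Sum>s\<in>(\<Pi>\<^sub>E i\<in>K. {..<6}). (\<Prod>i\<in>K. a i (s i)) * T (\<lambda>i\<in>K. pm (s i) (X i)))"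

lemma lin_on_tensor_op: "lin_on D (tensor_op K B a)"
  by (auto simp: lin_on_def tensor_op_def fun_eq_iff on_set_def scaleC_fun_apply sum_distrib_left sum.distrib algebra_simps)

lemma tensor_op_cong: "(\<And>i. i \<in> K \<Longrightarrow> a i = b i) \<Longrightarrow> tensor_op K B a T = tensor_op K B b T"
  by (simp add: tensor_op_def cong: prod.cong)

text \<open>Products in a tensor power of an algebra are formed factor by factor. The function
  \<open>f\<close> must vary in the induction, because splitting off a factor replaces it by a
  partial sum.\<close>

lemma prod_sum_conv:
  assumes "finite F"
  shows "(\<Sum>s\<in>(\<Pi>\<^sub>E i\<in>F. {..<6}). \<Sum>t\<in>(\<Pi>\<^sub>E i\<in>F. {..<6}).
      (\<Prod>i\<in>F. a i (s i)) * ((\<Prod>i\<in>F. b i (t i)) * f (\<lambda>i\<in>F. pm_mult (t i) (s i)))) =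
    (\<Sum>u\<in>(\<Pi>\<^sub>E i\<in>F. {..<6}). (\<Prod>i\<in>F. conv (a i) (b i) (u i)) * f u)"
  using assms
proof (induction F arbitrary: f rule: finite_induct)
  case empty
  show ?case by simp
next
  case (insert i F)
  let ?P = "\<Pi>\<^sub>E i\<in>F. {..<6::nat}"
  let ?g = "\<lambda>r. \<Sum>m<6. \<Sum>n<6. a i m * (b i n * f (r(i := pm_mult n m)))"
  have u: "(\<Prod>j\<in>insert i F. a j ((s(i := m)) j)) = a i m * (\<Prod>j\<in>F. a j (s j))" for a :: "'a \<Rightarrow> nat \<Rightarrow> complex" and s m
    using insert.hyps by (auto intro!: prod.cong)
  have r: "(\<lambda>j\<in>insert i F. pm_mult ((t(i := n)) j) ((s(i := m)) j)) = (\<lambda>j\<in>F. pm_mult (t j) (s j))(i := pm_mult n m)"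
    for s t m n using insert.hyps by (auto simp: restrict_def)
  have "(\<Sum>s\<in>(\<Pi>\<^sub>E i\<in>insert i F. {..<6}). \<Sum>t\<in>(\<Pi>\<^sub>E i\<in>insert i F. {..<6}).
      (\<Prod>i\<in>insert i F. a i (s i)) * ((\<Prod>i\<in>insert i F. b i (t i)) * f (\<lambda>i\<in>insert i F. pm_mult (t i) (s i)))) =
    (\<Sum>s\<in>?P. \<Sum>m<6. \<Sum>t\<in>?P. \<Sum>n<6. a i m * (\<Prod>j\<in>F. a j (s j)) * (b i n * (\<Prod>j\<in>F. b j (t j)) *
       f ((\<lambda>j\<in>F. pm_mult (t j) (s j))(i := pm_mult n m))))"
    by (simp only: sum_PiE_insert[OF insert.hyps(2)] u r)
  also have "\<dots> = (\<Sum>s\<in>?P. \<Sum>t\<in>?P. \<Sum>m<6. \<Sum>n<6. a i m * (\<Prod>j\<in>F. a j (s j)) * (b i n * (\<Prod>j\<in>F. b j (t j)) *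
       f ((\<lambda>j\<in>F. pm_mult (t j) (s j))(i := pm_mult n m))))"
    by (intro sum.cong refl sum.swap)
  also have "\<dots> = (\<Sum>s\<in>?P. \<Sum>t\<in>?P. (\<Prod>j\<in>F. a j (s j)) * ((\<Prod>j\<in>F. b j (t j)) * ?g (\<lambda>j\<in>F. pm_mult (t j) (s j))))"
    unfolding sum_distrib_left by (intro sum.cong refl) (simp only: mult_ac)
  also have "\<dots> = (\<Sum>u\<in>?P. (\<Prod>j\<in>F. conv (a j) (b j) (u j)) * ?g u)"
    by (rule insert.IH)
  also have "\<dots> = (\<Sum>u\<in>?P. \<Sum>v<6. (\<Prod>j\<in>insert i F. conv (a j) (b j) ((u(i := v)) j)) * f (u(i := v)))"
  proof -
    have "?g r = (\<Sum>v<6. conv (a i) (b i) v * f (r(i := v)))" for r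
      by (rule sum_conv)
    then show ?thesis
      unfolding u[of "\<lambda>j. conv (a j) (b j)"] by (simp only: sum_distrib_left mult_ac)
  qed
  finally show ?case
    by (simp only: sum_PiE_insert[OF insert.hyps(2)])
qed

lemma PiE_pm: "X \<in> (\<Pi>\<^sub>E i\<in>K. cube (B i)) \<Longrightarrow> (\<lambda>i\<in>K. pm (s i) (X i)) \<in> (\<Pi>\<^sub>E i\<in>K. cube (B i))"
  by (auto simp: PiE_iff)

lemma tensor_op_top:
  assumes "finite K"
  shows "tensor_op K B a (tensor_op K B b T) = tensor_op K B (\<lambda>i. conv (a i) (b i)) T"
proof
  fix X
  show "tensor_op K B a (tensor_op K B b T) X = tensor_op K B (\<lambda>i. conv (a i) (b i)) T X"
  proof (cases "X \<in> (\<Pi>\<^sub>E i\<in>K. cube (B i))")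
    case True
    let ?f = "\<lambda>u. T (\<lambda>i\<in>K. pm (u i) (X i))"
    have "tensor_op K B a (tensor_op K B b T) X = (\<Sum>s\<in>(\<Pi>\<^sub>E i\<in>K. {..<6}). \<Sum>t\<in>(\<Pi>\<^sub>E i\<in>K. {..<6}).
      (\<Prod>i\<in>K. a i (s i)) * ((\<Prod>i\<in>K. b i (t i)) * T (\<lambda>i\<in>K. pm (t i) ((\<lambda>i\<in>K. pm (s i) (X i)) i))))"
      unfolding tensor_op_def on_set_in[OF True] on_set_in[OF PiE_pm[OF True]] sum_distrib_left ..
    also have "\<dots> = (\<Sum>s\<in>(\<Pi>\<^sub>E i\<in>K. {..<6}). \<Sum>t\<in>(\<Pi>\<^sub>E i\<in>K. {..<6}).
      (\<Prod>i\<in>K. a i (s i)) * ((\<Prod>i\<in>K. b i (t i)) * ?f (\<lambda>i\<in>K. pm_mult (t i) (s i))))"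
    proof (intro sum.cong refl arg_cong2[where f="(*)"] arg_cong[where f=T])
      fix s t assume "s \<in> (\<Pi>\<^sub>E i\<in>K. {..<6::nat})" "t \<in> (\<Pi>\<^sub>E i\<in>K. {..<6::nat})"
      then show "(\<lambda>i\<in>K. pm (t i) ((\<lambda>i\<in>K. pm (s i) (X i)) i)) = (\<lambda>i\<in>K. pm ((\<lambda>i\<in>K. pm_mult (t i) (s i)) i) (X i))"
        by (auto simp: restrict_def PiE_iff pm_pm)
    qed
    also have "\<dots> = tensor_op K B (\<lambda>i. conv (a i) (b i)) T X"
      unfolding tensor_op_def on_set_in[OF True] by (rule prod_sum_conv[OF assms])
    finally show ?thesis .
  next
    case False
    then show ?thesis by (simp add: tensor_op_def on_set_def)
  qed
qed

text \<open>Distributivity over the choices of a summand in each factor. It yields the splitting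
  into labelled components as well as the sum over \<open>cls\<close> in the vanishing
  condition.\<close>

lemma tensor_op_sum:
  assumes "finite K" "\<And>i. i \<in> K \<Longrightarrow> finite (L i)"
  shows "tensor_op K B (\<lambda>i s. \<Sum>l\<in>L i. a i l s) T = (\<Sum>c\<in>Pi\<^sub>E K L. tensor_op K B (\<lambda>i. a i (c i)) T)"
proof
  fix X
  show "tensor_op K B (\<lambda>i s. \<Sum>l\<in>L i. a i l s) T X = (\<Sum>c\<in>Pi\<^sub>E K L. tensor_op K B (\<lambda>i. a i (c i)) T) X"
  proof (cases "X \<in> (\<Pi>\<^sub>E i\<in>K. cube (B i))")
    case True
    show ?thesis
      unfolding sum_fun_apply tensor_op_def on_set_in[OF True]
      by (subst sum.swap) (simp add: prod_sum_PiE[OF assms] sum_distrib_right)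
  next
    case False
    then show ?thesis by (simp add: tensor_op_def on_set_def sum_fun_apply)
  qed
qed

lemma tensor_op_scale:
  assumes "finite K"
  shows "tensor_op K B (\<lambda>i s. k i * a i s) T = (\<Prod>i\<in>K. k i) *\<^sub>C tensor_op K B a T"
  by (auto simp: fun_eq_iff tensor_op_def on_set_def scaleC_fun_apply prod.distrib sum_distrib_left mult.assoc)

definition unit6 :: "nat \<Rightarrow> complex" where
  "unit6 = vec6 1 0 0 0 0 0"

lemma perm_op_unit6: "perm_op unit6 f = f"
  unfolding perm_op_def sum_less_6 by (simp add: unit6_def fun_eq_iff)

text \<open>Away from \<open>i\<close> the coefficient vector \<open>unit6\<close> admits only the
  index 0, so the sum shrinks to the indices in the single variable \<open>X i\<close>.\<close>

lemma tensor_op_one_hot: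
  assumes K: "finite K" and i: "i \<in> K" and X: "X \<in> (\<Pi>\<^sub>E i\<in>K. cube (B i))"
  shows "tensor_op K B ((\<lambda>_. unit6)(i := a)) T X = perm_op a (\<lambda>x. T (X(i := x))) (X i)"
proof -
  let ?h = "\<lambda>m. (\<lambda>j\<in>K. 0::nat)(i := m)"
  have "tensor_op K B ((\<lambda>_. unit6)(i := a)) T X = (\<Sum>s\<in>?h ` {..<6}. (\<Prod>j\<in>K. ((\<lambda>_. unit6)(i := a)) j (s j)) * T (\<lambda>j\<in>K. pm (s j) (X j)))"
    unfolding tensor_op_def on_set_in[OF X]
  proof (rule sum.mono_neutral_right)
    show "finite (\<Pi>\<^sub>E i\<in>K. {..<6::nat})" using K by (simp add: finite_PiE)
    show "?h ` {..<6} \<subseteq> (\<Pi>\<^sub>E i\<in>K. {..<6})" using i by (auto simp: PiE_iff extensional_def)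
    show "\<forall>s\<in>(\<Pi>\<^sub>E i\<in>K. {..<6}) - ?h ` {..<6}. (\<Prod>j\<in>K. ((\<lambda>_. unit6)(i := a)) j (s j)) * T (\<lambda>j\<in>K. pm (s j) (X j)) = 0"
    proof
      fix s assume s: "s \<in> (\<Pi>\<^sub>E i\<in>K. {..<6::nat}) - ?h ` {..<6}"
      have "\<exists>j\<in>K. j \<noteq> i \<and> s j \<noteq> 0"
      proof (rule ccontr)
        assume "\<not> (\<exists>j\<in>K. j \<noteq> i \<and> s j \<noteq> 0)"
        then have "s = ?h (s i)" using s i by (auto simp: fun_eq_iff PiE_iff extensional_def)
        then show False using s i by (metis DiffE PiE_mem image_eqI)
      qed
      then obtain j where "j \<in> K" "j \<noteq> i" "s j \<noteq> 0" by blast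
      then have "(\<Prod>j\<in>K. ((\<lambda>_. unit6)(i := a)) j (s j)) = 0"
        using K by (intro prod_zero bexI[of _ j]) (auto simp: unit6_def vec6_def)
      then show "(\<Prod>j\<in>K. ((\<lambda>_. unit6)(i := a)) j (s j)) * T (\<lambda>j\<in>K. pm (s j) (X j)) = 0" by simp
    qed
  qed
  also have "\<dots> = (\<Sum>m<6. (\<Prod>j\<in>K. ((\<lambda>_. unit6)(i := a)) j (?h m j)) * T (\<lambda>j\<in>K. pm (?h m j) (X j)))"
    by (subst sum.reindex) (auto simp: inj_on_def fun_eq_iff split: if_splits)
  also have "\<dots> = (\<Sum>m<6. a m * T (X(i := pm m (X i))))"
  proof (intro sum.cong refl arg_cong2[where f="(*)"] arg_cong[where f=T])
    fix m :: nat
    have "(\<Prod>j\<in>K. ((\<lambda>_. unit6)(i := a)) j (?h m j)) = a m * (\<Prod>j\<in>K - {i}. 1)"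
      unfolding prod.remove[OF K i] by (auto simp: unit6_def intro!: prod.cong)
    then show "(\<Prod>j\<in>K. ((\<lambda>_. unit6)(i := a)) j (?h m j)) = a m" by simp
    show "(\<lambda>j\<in>K. pm (?h m j) (X j)) = X(i := pm m (X i))"
      using X i by (auto simp: fun_eq_iff PiE_iff extensional_def restrict_def)
  qed
  finally show ?thesis by (simp add: perm_op_def)
qed

text \<open>A simultaneous permutation is a pure tensor of group elements; this places the diagonal
  S_3 among the operators \<open>tensor_op\<close>.\<close>

lemma tensor_op_perm:
  assumes K: "finite K" and m: "m < 6" and X: "X \<in> (\<Pi>\<^sub>E i\<in>K. cube (B i))"
  shows "tensor_op K B (\<lambda>_ s. of_bool (s = m)) T X = T (\<lambda>i\<in>K. pm m (X i))"
proof -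
  let ?h = "\<lambda>i\<in>K. m"
  have h: "?h \<in> (\<Pi>\<^sub>E i\<in>K. {..<6})" using m by auto
  have "(\<Prod>j\<in>K. of_bool (s j = m)) = (of_bool (s = ?h) :: complex)" if "s \<in> (\<Pi>\<^sub>E i\<in>K. {..<6::nat})" for s
  proof (cases "s = ?h")
    case True
    then show ?thesis by simp
  next
    case False
    have "\<exists>j\<in>K. s j \<noteq> m"
    proof (rule ccontr)
      assume "\<not> (\<exists>j\<in>K. s j \<noteq> m)"
      then have "s = ?h" using that by (auto simp: fun_eq_iff PiE_iff extensional_def)
      then show False using False by simp
    qed
    then obtain j where "j \<in> K" "s j \<noteq> m" by blast
    then have "(\<Prod>j\<in>K. of_bool (s j = m)) = (0::complex)" using K by (intro prod_zero bexI[of _ j]) auto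
    then show ?thesis using False by simp
  qed
  then have "(\<Prod>j\<in>K. of_bool (s j = m)) * T (\<lambda>i\<in>K. pm (s i) (X i)) =
    (if s = ?h then T (\<lambda>i\<in>K. pm (s i) (X i)) else 0)" if "s \<in> (\<Pi>\<^sub>E i\<in>K. {..<6::nat})" for s
    using that by (simp only: of_bool_def if_distrib[of "\<lambda>x. x * _"] mult_1_left mult_zero_left)
  then have "tensor_op K B (\<lambda>_ s. of_bool (s = m)) T X = (\<Sum>s\<in>(\<Pi>\<^sub>E i\<in>K. {..<6}). if s = ?h then T (\<lambda>i\<in>K. pm (s i) (X i)) else 0)"
    unfolding tensor_op_def on_set_in[OF X] by (intro sum.cong refl)
  also have "\<dots> = T (\<lambda>i\<in>K. pm (?h i) (X i))"
    using h K by (subst sum.delta) (simp_all add: finite_PiE)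
  also have "(\<lambda>i\<in>K. pm (?h i) (X i)) = (\<lambda>i\<in>K. pm m (X i))" by (auto simp: restrict_def)
  finally show ?thesis .
qed

definition pm_stable :: "('v \<times> 'v \<times> 'v \<Rightarrow> complex) set \<Rightarrow> bool" where
  "pm_stable S \<longleftrightarrow> cvs.subspace S \<and> (\<forall>f\<in>S. \<forall>s. (\<lambda>t. f (pm s t)) \<in> S)"

lemma pm_stableD:
  assumes "pm_stable S"
  shows "cvs.subspace S" "f \<in> S \<Longrightarrow> (\<lambda>t. f (pm s t)) \<in> S"
  using assms by (auto simp: pm_stable_def)

lemma perm_op_eq_sum: "perm_op a f = (\<Sum>s<6. a s *\<^sub>C (\<lambda>t. f (pm s t)))"
  by (simp add: fun_eq_iff perm_op_def sum_fun_apply scaleC_fun_apply)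

lemma perm_op_closed: "pm_stable S \<Longrightarrow> f \<in> S \<Longrightarrow> perm_op a f \<in> S"
  unfolding perm_op_eq_sum by (intro cvs.subspace_sum cvs.subspace_scale) (auto simp: pm_stableD)

lemma lin_on_perm_op: "lin_on D (perm_op a)"
  by (auto simp: lin_on_def perm_op_def fun_eq_iff scaleC_fun_apply sum_distrib_left sum.distrib algebra_simps)

lemma perm_op_linear: "perm_op a (f + g) = perm_op a f + perm_op a g" "perm_op a (c *\<^sub>C f) = c *\<^sub>C perm_op a f" "perm_op a 0 = 0"
  by (simp_all add: perm_op_def fun_eq_iff scaleC_fun_apply sum_distrib_left sum.distrib algebra_simps)

lemma tensor_op_cong6:
  assumes "\<And>i s. i \<in> K \<Longrightarrow> s < 6 \<Longrightarrow> a i s = b i s"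
  shows "tensor_op K B a T = tensor_op K B b T"
proof -
  have "(\<Prod>i\<in>K. a i (s i)) = (\<Prod>i\<in>K. b i (s i))" if "s \<in> (\<Pi>\<^sub>E i\<in>K. {..<6})" for s
    using that assms by (intro prod.cong) auto
  then show ?thesis by (simp add: tensor_op_def)
qed

abbreviation cubes :: "('i \<Rightarrow> 'v set) \<Rightarrow> 'i \<Rightarrow> ('v \<times> 'v \<times> 'v) set" where
  "cubes B \<equiv> \<lambda>i. cube (B i)"

lemma tensor_op_sep:
  assumes S: "\<And>i. i \<in> K \<Longrightarrow> pm_stable (S i)" and T: "T \<in> sep K (cubes B) S"
  shows "tensor_op K B a T \<in> sep K (cubes B) S"
  unfolding sep_def
proof (intro CollectI conjI ballI allI impI)
  fix X i assume X: "X \<in> Pi\<^sub>E K (cubes B)" and i: "i \<in> K"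
  have e: "tensor_op K B a T (X(i := x)) =
    (\<Sum>s\<in>(\<Pi>\<^sub>E i\<in>K. {..<6}). (\<Prod>i\<in>K. a i (s i)) * T ((\<lambda>i\<in>K. pm (s i) (X i))(i := pm (s i) x)))" for x
  proof (cases "x \<in> cube (B i)")
    case True
    have "(\<lambda>j\<in>K. pm (s j) ((X(i := x)) j)) = (\<lambda>i\<in>K. pm (s i) (X i))(i := pm (s i) x)" for s
      using i by (auto simp: restrict_def)
    then show ?thesis unfolding tensor_op_def on_set_in[OF PiE_updD[OF X i True]] by simp
  next
    case False
    then have "X(i := x) \<notin> Pi\<^sub>E K (cubes B)" using i by (metis PiE_mem fun_upd_same)
    moreover have "(\<lambda>i\<in>K. pm (s i) (X i))(i := pm (s i) x) \<notin> Pi\<^sub>E K (cubes B)" for s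
      using False i by (metis PiE_mem fun_upd_same pm_cube)
    ultimately show ?thesis using sep_outside[OF T] by (simp add: tensor_op_def on_set_def)
  qed
  have "(\<lambda>x. tensor_op K B a T (X(i := x))) = (\<Sum>s\<in>(\<Pi>\<^sub>E i\<in>K. {..<6}). (\<Prod>i\<in>K. a i (s i)) *\<^sub>C
       (\<lambda>x. T ((\<lambda>i\<in>K. pm (s i) (X i))(i := pm (s i) x))))"
    by (rule ext) (simp only: sum_fun_apply scaleC_fun_apply e)
  also have "\<dots> \<in> S i"
    by (intro cvs.subspace_sum cvs.subspace_scale pm_stableD(1)[OF S[OF i]]
        pm_stableD(2)[OF S[OF i], of "\<lambda>x. T (_(i := x))"] sepD[OF T PiE_pm[OF X] i])
  finally show "(\<lambda>x. tensor_op K B a T (X(i := x))) \<in> S i" .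
qed (simp add: tensor_op_def on_set_def)

lemma tensor_op_unit:
  assumes "finite K" "\<And>X. X \<notin> Pi\<^sub>E K (cubes B) \<Longrightarrow> T X = 0"
  shows "tensor_op K B (\<lambda>_. unit6) T = T"
proof
  fix X
  show "tensor_op K B (\<lambda>_. unit6) T X = T X"
  proof (cases "X \<in> Pi\<^sub>E K (cubes B)")
    case True
    have "tensor_op K B (\<lambda>_. unit6) T X = tensor_op K B (\<lambda>_ s. of_bool (s = 0)) T X"
      by (rule fun_cong[OF tensor_op_cong6]) (simp add: unit6_def vec6_def)
    also have "\<dots> = T (\<lambda>i\<in>K. pm 0 (X i))" by (rule tensor_op_perm[OF assms(1) _ True]) simp
    also have "(\<lambda>i\<in>K. pm 0 (X i)) = X" using True by (auto simp: PiE_iff extensional_def restrict_def)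
    finally show ?thesis .
  qed (simp add: tensor_op_def on_set_def assms(2))
qed

lemma conv_unit6: "s < 6 \<Longrightarrow> conv unit6 a s = a s" "s < 6 \<Longrightarrow> conv a unit6 s = a s"
  by (elim less_6_cases[THEN disjE] disjE; simp add: conv_def unit6_def)+

definition fixed :: "(nat \<Rightarrow> complex) \<Rightarrow> ('v \<times> 'v \<times> 'v \<Rightarrow> complex) set \<Rightarrow> ('v \<times> 'v \<times> 'v \<Rightarrow> complex) set" where
  "fixed e S = {f \<in> S. perm_op e f = f}"

text \<open>The idempotents in different factors commute. A function fixed in each variable is fixed
  by their product, built up one factor at a time; conversely \<open>e i\<close> times the product
  is the product again, so what the product fixes is fixed in each variable.\<close>

lemma sep_fixed:
  assumes K: "finite K" and S: "\<And>i. i \<in> K \<Longrightarrow> pm_stable (S i)" and e: "\<And>i. i \<in> K \<Longrightarrow> conv (e i) (e i) = e i"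
  shows "sep K (cubes B) (\<lambda>i. fixed (e i) (S i)) = {T \<in> sep K (cubes B) S. tensor_op K B e T = T}"
proof (intro equalityI subsetI CollectI conjI)
  fix T assume T: "T \<in> sep K (cubes B) (\<lambda>i. fixed (e i) (S i))"
  then show T': "T \<in> sep K (cubes B) S" by (auto simp: sep_def fixed_def)
  have one: "tensor_op K B ((\<lambda>_. unit6)(i := e i)) T = T" if i: "i \<in> K" for i
  proof
    fix X
    show "tensor_op K B ((\<lambda>_. unit6)(i := e i)) T X = T X"
    proof (cases "X \<in> Pi\<^sub>E K (cubes B)")
      case True
      have "perm_op (e i) (\<lambda>x. T (X(i := x))) = (\<lambda>x. T (X(i := x)))"
        using sepD[OF T True i] by (simp add: fixed_def)
      then show ?thesis by (simp add: tensor_op_one_hot[OF K i True])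
    qed (simp add: tensor_op_def on_set_def sep_outside[OF T])
  qed
  have "tensor_op K B (\<lambda>i. if i \<in> F then e i else unit6) T = T" if "F \<subseteq> K" for F
    using finite_subset[OF that K] that
  proof (induction F rule: finite_induct)
    case empty
    show ?case using tensor_op_unit[OF K sep_outside[OF T]] by simp
  next
    case (insert i F)
    have "tensor_op K B (\<lambda>j. if j \<in> insert i F then e j else unit6) T =
      tensor_op K B (\<lambda>j. conv (((\<lambda>_. unit6)(i := e i)) j) (if j \<in> F then e j else unit6)) T"
      using insert.hyps by (intro tensor_op_cong6) (auto simp: conv_unit6)
    also have "\<dots> = tensor_op K B ((\<lambda>_. unit6)(i := e i)) (tensor_op K B (\<lambda>j. if j \<in> F then e j else unit6) T)"
      by (rule tensor_op_top[OF K, symmetric])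
    also have "\<dots> = T" using insert one by simp
    finally show ?case .
  qed
  from this[of K] show "tensor_op K B e T = T" using tensor_op_cong[of K "\<lambda>i. if i \<in> K then e i else unit6" e B T] by simp
next
  fix T assume "T \<in> {T \<in> sep K (cubes B) S. tensor_op K B e T = T}"
  then have T: "T \<in> sep K (cubes B) S" and eq: "tensor_op K B e T = T" by auto
  show "T \<in> sep K (cubes B) (\<lambda>i. fixed (e i) (S i))"
    unfolding sep_def fixed_def
  proof (intro CollectI conjI ballI allI impI)
    fix X i assume X: "X \<in> Pi\<^sub>E K (cubes B)" and i: "i \<in> K"
    show "(\<lambda>x. T (X(i := x))) \<in> S i" by (rule sepD[OF T X i])
    have "tensor_op K B ((\<lambda>_. unit6)(i := e i)) T = tensor_op K B (\<lambda>j. conv (((\<lambda>_. unit6)(i := e i)) j) (e j)) T"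
      using tensor_op_top[OF K, of B "(\<lambda>_. unit6)(i := e i)" e T] eq by simp
    also have "\<dots> = tensor_op K B e T" using e[OF i] by (intro tensor_op_cong6) (auto simp: conv_unit6)
    finally have h: "tensor_op K B ((\<lambda>_. unit6)(i := e i)) T = T" using eq by simp
    show "perm_op (e i) (\<lambda>x. T (X(i := x))) = (\<lambda>x. T (X(i := x)))"
    proof
      fix x
      show "perm_op (e i) (\<lambda>x. T (X(i := x))) x = T (X(i := x))"
      proof (cases "x \<in> cube (B i)")
        case True
        show ?thesis
          using tensor_op_one_hot[OF K i PiE_updD[OF X i True], of "e i" T] h by simp
      next
        case False
        then have "X(i := pm s x) \<notin> Pi\<^sub>E K (cubes B)" for s using i by (metis PiE_mem fun_upd_same pm_cube)
        from this this[of 0] show ?thesis using sep_outside[OF T] by (simp add: perm_op_def)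
      qed
    qed
  qed (rule sep_outside[OF T])
qed

text \<open>Applying \<open>e\<close> to both sides of the interpolation formula keeps the values at
  the points and only projects the coefficient functions.\<close>

lemma interp_fixed:
  assumes ip: "interp P S N p b" and S: "pm_stable S" and e: "conv e e = e"
  shows "interp P (fixed e S) N p (\<lambda>n. perm_op e (b n))"
  unfolding interp_def
proof (intro conjI ballI allI impI)
  show "cvs.subspace (fixed e S)"
    unfolding cvs.subspace_def fixed_def
    using pm_stableD(1)[OF S] by (simp add: cvs.subspace_def perm_op_linear)
  show "perm_op e (b n) \<in> fixed e S" if "n \<in> N" for n
    using perm_op_closed[OF S interpD(5)[OF ip that]] by (simp add: fixed_def perm_op_comp e)
  show "f x = (\<Sum>n\<in>N. f (p n) * perm_op e (b n) x)" if f: "f \<in> fixed e S" for f x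
  proof -
    have "f \<in> S" "f x = perm_op e f x" using f by (auto simp: fixed_def)
    then have "f x = (\<Sum>s<6. e s * (\<Sum>n\<in>N. f (p n) * b n (pm s x)))"
      using interpD(6)[OF ip] by (simp add: perm_op_def)
    also have "\<dots> = (\<Sum>n\<in>N. f (p n) * perm_op e (b n) x)"
      unfolding perm_op_def sum_distrib_left by (subst sum.swap) (simp only: mult_ac)
    finally show ?thesis .
  qed
qed (use interpD[OF ip] in \<open>auto simp: fixed_def\<close>)

text \<open>The two relations express that \<open>e\<close> and \<open>f\<close> have the same
  image, while their kernels may differ. This is the situation of the idempotents for
  \<open>Pl\<close> and \<open>Mi\<close>.\<close>

lemma fixed_eq:
  assumes "conv e f = f" "conv f e = e"
  shows "fixed e S = fixed f S"
  unfolding fixed_def using assms perm_op_comp by metis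


section \<open>Trilinear functions\<close>

definition tri :: "'v::complex_vector set \<Rightarrow> ('v \<times> 'v \<times> 'v \<Rightarrow> complex) set" where
  "tri A = {f. (\<forall>t. t \<notin> cube A \<longrightarrow> f t = 0) \<and> (\<forall>x\<in>A. \<forall>y\<in>A. lin_on A (\<lambda>u. f (u, x, y)) \<and>
     lin_on A (\<lambda>u. f (x, u, y)) \<and> lin_on A (\<lambda>u. f (x, y, u)))}"

lemma lin_on_plus: "lin_on A f \<Longrightarrow> lin_on A g \<Longrightarrow> lin_on A (\<lambda>x. f x + g x :: complex)"
  by (simp add: lin_on_def algebra_simps scaleC_complex_def)

lemma lin_on_times: "lin_on A f \<Longrightarrow> lin_on A (\<lambda>x. c * f x :: complex)"
  by (simp add: lin_on_def algebra_simps scaleC_complex_def)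

lemma lin_on_times_right: "lin_on A f \<Longrightarrow> lin_on A (\<lambda>x. f x * c :: complex)"
  by (simp add: lin_on_def algebra_simps scaleC_complex_def)

lemma lin_on_0: "lin_on A (\<lambda>x. 0 :: complex)"
  by (simp add: lin_on_def)

lemma subspace_tri: "cvs.subspace (tri A)"
  unfolding cvs.subspace_def tri_def
  by (simp add: scaleC_fun_apply plus_fun_def zero_fun_def lin_on_plus lin_on_times lin_on_0)

lemma pm_stable_tri: "pm_stable (tri A)"
  unfolding pm_stable_def
proof (intro conjI ballI allI)
  fix f :: "'a \<times> 'a \<times> 'a \<Rightarrow> complex" and s assume f: "f \<in> tri A"
  \<comment> \<open>All indices from 5 on give the same permutation, so it suffices to check six of
    them.\<close>
  have "min s 5 < 6" "pm s = (pm (min s 5) :: 'a \<times> 'a \<times> 'a \<Rightarrow> _)"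
    by (auto simp: pm_def fun_eq_iff min_def)
  then obtain r :: nat where "r < 6" "pm s = (pm r :: 'a \<times> 'a \<times> 'a \<Rightarrow> _)" by blast
  then show "(\<lambda>t. f (pm s t)) \<in> tri A"
    using f unfolding tri_def mem_Collect_eq
    by (elim less_6_cases[THEN disjE] disjE; auto simp: cube_def)
qed (rule subspace_tri)

text \<open>A basis extracted from the spanning set provides the points, and its coordinate
  functionals provide the coefficients.\<close>

lemma exists_interp_dual:
  fixes A :: "'v::complex_vector set"
  assumes "finite B" "cvs.span B = A"
  shows "\<exists>N p b. interp A (dual A) (N :: 'v set) p b"
proof -
  obtain C where C: "C \<subseteq> B" "cvs.independent C" "B \<subseteq> cvs.span C"
    using cvs.maximal_independent_subset by blast
  have A: "cvs.span C = A"
    using C assms by (metis cvs.span_eq cvs.span_superset order_trans)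
  have fin: "finite C" using C assms finite_subset by blast
  have sub: "cvs.subspace A" using assms cvs.subspace_span by blast
  let ?b = "\<lambda>c. on_set A (\<lambda>v. cvs.representation C v c)"
  have "interp A (dual A) C id ?b"
    unfolding interp_def
  proof (intro conjI ballI allI impI)
    show "?b c \<in> dual A" for c
      using C(2) A by (intro on_set_dual[OF sub])
        (auto simp: lin_on_def cvs.representation_add cvs.representation_scale scaleC_complex_def)
    show "id c \<in> A" if "c \<in> C" for c using that A cvs.span_base by auto
    show "f x = (\<Sum>c\<in>C. f (id c) * ?b c x)" if f: "f \<in> dual A" for f x
    proof (cases "x \<in> A")
      case True
      have "x = (\<Sum>c\<in>C. cvs.representation C x c *\<^sub>C c)"
        using cvs.sum_representation_eq[OF C(2) _ fin order_refl] True A by simp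
      then have "f x = f (\<Sum>c\<in>C. cvs.representation C x c *\<^sub>C c)" by simp
      also have "\<dots> = (\<Sum>c\<in>C. cvs.representation C x c *\<^sub>C f c)"
        using A cvs.span_base by (intro lin_on_sum_scale[OF sub dual_lin[OF f]]) auto
      finally show ?thesis using True by (simp add: on_set_def scaleC_complex_def mult.commute)
    qed (simp add: on_set_def dual_outside[OF f])
  qed (auto simp: fin subspace_dual[OF sub] dual_outside)
  then show ?thesis by blast
qed

lemma interp_tri:
  assumes ip: "interp A (dual A) N p b"
  shows "interp (cube A) (tri A) (N \<times> N \<times> N) (\<lambda>(n, m, l). (p n, p m, p l)) (\<lambda>(n, m, l) (x, y, z). b n x * (b m y * b l z))"
  unfolding interp_def
proof (intro conjI ballI allI impI)
  note I = interpD[OF ip]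
  show "finite (N \<times> N \<times> N)" using I(3) by simp
  show "(case n of (n, m, l) \<Rightarrow> (p n, p m, p l)) \<in> cube A" if "n \<in> N \<times> N \<times> N" for n
    using that I(4) by (auto simp: cube_def)
  show "(case n of (n, m, l) \<Rightarrow> \<lambda>(x, y, z). b n x * (b m y * b l z)) \<in> tri A" if n: "n \<in> N \<times> N \<times> N" for n
  proof -
    obtain i j l where "n = (i, j, l)" "i \<in> N" "j \<in> N" "l \<in> N" using n by auto
    then have b: "b i \<in> dual A" "b j \<in> dual A" "b l \<in> dual A" "n = (i, j, l)" using I(5) by auto
    note l = dual_lin[OF b(1)] dual_lin[OF b(2)] dual_lin[OF b(3)]
    show ?thesis
      unfolding tri_def using b
      by (auto simp: cube_def dual_outside intro!: lin_on_times lin_on_times_right l)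
  qed
  fix f t assume f: "f \<in> tri A"
  show "f t = (\<Sum>n\<in>N \<times> N \<times> N. f (case n of (n, m, l) \<Rightarrow> (p n, p m, p l)) * (case n of (n, m, l) \<Rightarrow> \<lambda>(x, y, z). b n x * (b m y * b l z)) t)"
  proof -
    obtain x y z where t: "t = (x, y, z)" by (cases t)
    have d: "(\<lambda>u. f (u, y, z)) \<in> dual A" for y z
      using f by (cases "y \<in> A \<and> z \<in> A") (auto simp: tri_def dual_def cube_def lin_on_0)
    have d2: "(\<lambda>u. f (y, u, z)) \<in> dual A" for y z
      using f by (cases "y \<in> A \<and> z \<in> A") (auto simp: tri_def dual_def cube_def lin_on_0)
    have d3: "(\<lambda>u. f (y, z, u)) \<in> dual A" for y z
      using f by (cases "y \<in> A \<and> z \<in> A") (auto simp: tri_def dual_def cube_def lin_on_0)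
    have "f (x, y, z) = (\<Sum>n\<in>N. f (p n, y, z) * b n x)" by (rule I(6)[OF d])
    also have "\<dots> = (\<Sum>n\<in>N. (\<Sum>m\<in>N. f (p n, p m, z) * b m y) * b n x)"
      by (intro sum.cong refl arg_cong2[where f="(*)"] I(6)[OF d2])
    also have "\<dots> = (\<Sum>n\<in>N. (\<Sum>m\<in>N. (\<Sum>l\<in>N. f (p n, p m, p l) * b l z) * b m y) * b n x)"
      by (intro sum.cong refl arg_cong2[where f="(*)"] I(6)[OF d3])
    also have "\<dots> = (\<Sum>n\<in>N. \<Sum>m\<in>N. \<Sum>l\<in>N. f (p n, p m, p l) * (b n x * (b m y * b l z)))"
      by (simp add: sum_distrib_left sum_distrib_right mult_ac)
    finally show ?thesis
      by (simp add: t sum.cartesian_product case_prod_unfold)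
  qed
qed (rule subspace_tri, unfold tri_def, blast)


section \<open>Components of trilinear functions\<close>

text \<open>A primitive cube root of unity. Its square, which is also its conjugate, is written
  \<open>-1 - omega\<close> throughout, so that \<open>omega_square\<close> reduces every identity
  to linear expressions in omega.\<close>

definition omega :: complex where
  "omega = Complex (-1/2) (sqrt 3 / 2)"

lemma omega_square: "omega * omega = - 1 - omega"
  by (simp add: omega_def complex_eq_iff)

lemma omega_square': "omega * (omega * x) = - x - omega * x"
proof -
  have "omega * (omega * x) = (omega * omega) * x" by (rule mult.assoc[symmetric])
  then show ?thesis by (simp add: omega_square algebra_simps)
qed

datatype label = Sy | Al | Pl | Mi

text \<open>
  A trilinear function is decomposed into its symmetric and alternating parts and the two nontrivial
  eigenspaces of the rotation; \<open>proj Pl\<close> and \<open>proj Mi\<close> compose the projections to these eigenspaces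
  with the identification of either of them with the same copy of the Schur module of shape \<open>[2, 1]\<close>,
  and \<open>emb\<close> inverts this identification.
\<close>

fun proj :: "label \<Rightarrow> nat \<Rightarrow> complex" where
  "proj Sy = vec6 (1/6) (1/6) (1/6) (1/6) (1/6) (1/6)"
| "proj Al = vec6 (1/6) (1/6) (1/6) (-1/6) (-1/6) (-1/6)"
| "proj Pl = vec6 (1/9) (omega/9) ((-1-omega)/9) (1/9) (omega/9) ((-1-omega)/9)"
| "proj Mi = vec6 (1/9) ((-1-omega)/9) (omega/9) (1/9) ((-1-omega)/9) (omega/9)"

fun emb :: "label \<Rightarrow> nat \<Rightarrow> complex" where
  "emb Sy = proj Sy"
| "emb Al = proj Al"
| "emb Pl = vec6 1 omega (-1-omega) 0 0 0"
| "emb Mi = vec6 1 (-1-omega) omega 0 0 0"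

text \<open>The product of \<open>proj c\<close> and \<open>emb c\<close>. For \<open>Pl\<close> and
  \<open>Mi\<close>, let \<pi> be the projection to the eigenspace of the rotation and s the
  transposition of the first two arguments: then \<open>proj\<close> is (1 + s) \<pi> / 3,
  \<open>emb\<close> is 3 \<pi>, and \<open>idem\<close> is (1 + s) \<pi>. In both cases the image
  of \<open>idem\<close> consists of the functions symmetric in the first two arguments whose cyclic
  sum is zero.\<close>

fun idem :: "label \<Rightarrow> nat \<Rightarrow> complex" where
  "idem Sy = proj Sy"
| "idem Al = proj Al"
| "idem Pl = vec6 (1/3) (omega/3) ((-1-omega)/3) (1/3) (omega/3) ((-1-omega)/3)"
| "idem Mi = vec6 (1/3) ((-1-omega)/3) (omega/3) (1/3) ((-1-omega)/3) (omega/3)"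

fun flip :: "label \<Rightarrow> label" where
  "flip Pl = Mi" | "flip Mi = Pl" | "flip Sy = Sy" | "flip Al = Al"

lemma vec6_cong:
  "a = a' \<Longrightarrow> b = b' \<Longrightarrow> c = c' \<Longrightarrow> d = d' \<Longrightarrow> e = e' \<Longrightarrow> f = f' \<Longrightarrow> vec6 a b c d e f = vec6 a' b' c' d' e' f'"
  by simp

lemma vec6_scale: "k * vec6 a b c d e f s = vec6 (k*a) (k*b) (k*c) (k*d) (k*e) (k*f) s"
  by (simp add: vec6_def)

lemma vec6_add: "vec6 a b c d e f s + vec6 a' b' c' d' e' f' s = vec6 (a+a') (b+b') (c+c') (d+d') (e+e') (f+f') s"
  by (simp add: vec6_def)

lemma vec6_0: "vec6 0 0 0 0 0 0 = (\<lambda>s. 0)"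
  by (simp add: vec6_def fun_eq_iff)

text \<open>Distinct labels belong to complementary parts of the group algebra, so the projection to
  one part annihilates what is embedded in another.\<close>

lemma conv_proj_emb: "conv (proj c) (emb d) = (if c = d then idem c else (\<lambda>s. 0))"
  by (cases c; cases d; simp add: vec6_0[symmetric]) (simp_all only: conv_def, auto intro!: vec6_cong simp: field_simps omega_square omega_square')

lemma conv_idem_proj: "conv (idem c) (proj c) = proj c"
  by (cases c) (simp_all only: conv_def idem.simps proj.simps, auto intro!: vec6_cong simp: field_simps omega_square omega_square')

lemma conv_idem_idem: "conv (idem c) (idem c) = idem c"
  by (cases c) (simp_all only: conv_def idem.simps proj.simps, auto intro!: vec6_cong simp: field_simps omega_square omega_square')

text \<open>Symmetrising the eigenfunctions of either eigenvalue produces the same space of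
  functions, so the two different idempotents share their image.\<close>

lemma conv_idem_flip: "conv (idem c) (idem (flip c)) = idem (flip c)"
  by (cases c) (simp_all only: conv_def idem.simps proj.simps flip.simps, auto intro!: vec6_cong simp: field_simps omega_square omega_square')

text \<open>A transposition carries one eigenspace of the rotation to the other, whence \<pi> s
  \<pi> = 0 and \<open>emb\<close> after \<open>proj\<close> is just \<pi>. The four projections
  then add up to the identity.\<close>

lemma sum_conv_emb_proj: "conv (emb Sy) (proj Sy) s + conv (emb Al) (proj Al) s + conv (emb Pl) (proj Pl) s + conv (emb Mi) (proj Mi) s = unit6 s"
  unfolding unit6_def conv_def vec6_add
  by (rule fun_cong[where x=s], rule vec6_cong) (simp_all add: field_simps omega_square omega_square')

section \<open>Schur functors of degree three\<close>

definition place :: "'b \<Rightarrow> 'b \<Rightarrow> 'b \<Rightarrow> 'v \<times> 'v \<times> 'v \<Rightarrow> 'b \<Rightarrow> 'v" where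
  "place b0 b1 b2 t = (\<lambda>b\<in>{b0, b1, b2}. if b = b0 then fst t else if b = b1 then fst (snd t) else snd (snd t))"

text \<open>The three boxes take the roles of the three arguments, so a tensor over a diagram of
  degree three becomes a function of a triple.\<close>

definition box_fun :: "'b \<Rightarrow> 'b \<Rightarrow> 'b \<Rightarrow> 'v::complex_vector set \<Rightarrow>
    (('b \<Rightarrow> ('v \<Rightarrow> complex) \<Rightarrow> complex) \<Rightarrow> complex) \<Rightarrow> 'v \<times> 'v \<times> 'v \<Rightarrow> complex" where
  "box_fun b0 b1 b2 A f = on_set (cube A) (\<lambda>t. tensor_fun {b0, b1, b2} (\<lambda>_. A) (\<lambda>_. dual A) (\<lambda>_ \<phi>. \<phi>) f (place b0 b1 b2 t))"

lemma place_PiE: "t \<in> cube A \<Longrightarrow> place b0 b1 b2 t \<in> (\<Pi>\<^sub>E b\<in>{b0, b1, b2}. A)"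
  by (auto simp: place_def cube_def)

lemma lin_on_box_fun: "lin_on D (box_fun b0 b1 b2 A)"
  using lin_on_tensor_fun[of UNIV "{b0, b1, b2}" "\<lambda>_. A" "\<lambda>_. dual A" "\<lambda>_ \<phi>. \<phi>"]
  by (auto simp: lin_on_def box_fun_def fun_eq_iff on_set_def scaleC_fun_apply)

lemma bij_betw_place:
  assumes d: "b0 \<noteq> b1" "b0 \<noteq> b2" "b1 \<noteq> b2"
  shows "bij_betw (\<lambda>U. on_set (cube A) (\<lambda>t. U (place b0 b1 b2 t))) (sep {b0, b1, b2} (\<lambda>_. A) (\<lambda>_. dual A)) (tri A)"
    (is "bij_betw ?F ?S _")
proof (rule bij_betw_byWitness)
  let ?G = "\<lambda>f. on_set (\<Pi>\<^sub>E b\<in>{b0, b1, b2}. A) (\<lambda>X. f (X b0, X b1, X b2))"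
  have XX: "place b0 b1 b2 (X b0, X b1, X b2) = X" "(X b0, X b1, X b2) \<in> cube A" if "X \<in> (\<Pi>\<^sub>E b\<in>{b0, b1, b2}. A)" for X
    using that d by (auto simp: place_def cube_def PiE_iff extensional_def fun_eq_iff restrict_def)
  show "\<forall>U\<in>?S. ?G (?F U) = U"
  proof (intro ballI ext)
    fix U X assume U: "U \<in> ?S"
    show "?G (?F U) X = U X"
      using sep_outside[OF U] XX by (cases "X \<in> (\<Pi>\<^sub>E b\<in>{b0, b1, b2}. A)") (simp_all add: on_set_def)
  qed
  show "\<forall>f\<in>tri A. ?F (?G f) = f"
  proof (intro ballI ext)
    fix f t assume f: "f \<in> tri A"
    show "?F (?G f) t = f t"
    proof (cases "t \<in> cube A")
      case True
      have "(place b0 b1 b2 t b0, place b0 b1 b2 t b1, place b0 b1 b2 t b2) = t"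
        using d by (simp add: place_def)
      then show ?thesis unfolding on_set_in[OF True] on_set_in[OF place_PiE[OF True]] by simp
    next
      case False
      then have "f t = 0" using f unfolding tri_def by blast
      then show ?thesis using False by (simp add: on_set_def)
    qed
  qed
  show "?F ` ?S \<subseteq> tri A"
  proof
    fix f assume "f \<in> ?F ` ?S"
    then obtain U where U: "U \<in> ?S" and f: "f = ?F U" by blast
    have l: "lin_on A (\<lambda>u. U (X(b := u)))" if "X \<in> (\<Pi>\<^sub>E b\<in>{b0, b1, b2}. A)" "b \<in> {b0, b1, b2}" for X b
      using sepD[OF U that] by (simp add: dual_def)
    show "f \<in> tri A"
      unfolding tri_def
    proof (intro CollectI conjI allI ballI impI)
      fix x y assume xy: "x \<in> A" "y \<in> A"
      have X: "place b0 b1 b2 (x, x, y) \<in> (\<Pi>\<^sub>E b\<in>{b0, b1, b2}. A)" "place b0 b1 b2 (x, y, y) \<in> (\<Pi>\<^sub>E b\<in>{b0, b1, b2}. A)"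
        using xy by (auto intro!: place_PiE simp: cube_def)
      have e: "place b0 b1 b2 (u, x, y) = (place b0 b1 b2 (x, x, y))(b0 := u)"
        "place b0 b1 b2 (x, u, y) = (place b0 b1 b2 (x, x, y))(b1 := u)"
        "place b0 b1 b2 (x, y, u) = (place b0 b1 b2 (x, y, y))(b2 := u)" for u
        using d by (auto simp: place_def)
      have sum: "f (u, x, y) = U ((place b0 b1 b2 (x, x, y))(b0 := u))"
        "f (x, u, y) = U ((place b0 b1 b2 (x, x, y))(b1 := u))"
        "f (x, y, u) = U ((place b0 b1 b2 (x, y, y))(b2 := u))" for u
      proof -
        have "f t = U (place b0 b1 b2 t)" for t
        proof (cases "t \<in> cube A")
          case False
          have "place b0 b1 b2 t \<notin> (\<Pi>\<^sub>E b\<in>{b0, b1, b2}. A)"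
          proof
            assume "place b0 b1 b2 t \<in> (\<Pi>\<^sub>E b\<in>{b0, b1, b2}. A)"
            then have "place b0 b1 b2 t b0 \<in> A" "place b0 b1 b2 t b1 \<in> A" "place b0 b1 b2 t b2 \<in> A" by auto
            then show False using False d by (cases t) (auto simp: place_def cube_def)
          qed
          then show ?thesis using sep_outside[OF U] False by (simp add: f on_set_def)
        qed (simp add: f on_set_def)
        then show "f (u, x, y) = U ((place b0 b1 b2 (x, x, y))(b0 := u))"
          "f (x, u, y) = U ((place b0 b1 b2 (x, x, y))(b1 := u))"
          "f (x, y, u) = U ((place b0 b1 b2 (x, y, y))(b2 := u))" by (simp_all only: e[symmetric])
      qed
      show "lin_on A (\<lambda>u. f (u, x, y))" "lin_on A (\<lambda>u. f (x, u, y))" "lin_on A (\<lambda>u. f (x, y, u))"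
        unfolding sum by (intro l X; simp)+
    qed (simp add: f on_set_def)
  qed
  show "?G ` tri A \<subseteq> ?S"
  proof
    fix U assume "U \<in> ?G ` tri A"
    then obtain f where f: "f \<in> tri A" and U: "U = ?G f" by blast
    have f0: "f t = 0" if "t \<notin> cube A" for t using f that unfolding tri_def by blast
    have l: "lin_on A (\<lambda>u. f (u, x, y))" "lin_on A (\<lambda>u. f (x, u, y))" "lin_on A (\<lambda>u. f (x, y, u))"
      if "x \<in> A" "y \<in> A" for x y using f that unfolding tri_def by blast+
    show "U \<in> ?S"
      unfolding sep_def
    proof (intro CollectI conjI ballI allI impI)
      fix X b assume X: "X \<in> (\<Pi>\<^sub>E b\<in>{b0, b1, b2}. A)" and b: "b \<in> {b0, b1, b2}"
      have A: "X b0 \<in> A" "X b1 \<in> A" "X b2 \<in> A" using X by auto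
      have e: "U (X(b := u)) = f ((X(b := u)) b0, (X(b := u)) b1, (X(b := u)) b2)" for u
      proof (cases "u \<in> A")
        case True
        show ?thesis unfolding U on_set_in[OF PiE_updD[OF X b True]] ..
      next
        case False
        then have "X(b := u) \<notin> (\<Pi>\<^sub>E b\<in>{b0, b1, b2}. A)" using b by (metis PiE_mem fun_upd_same)
        moreover have "((X(b := u)) b0, (X(b := u)) b1, (X(b := u)) b2) \<notin> cube A"
          using False b d by (auto simp: cube_def)
        ultimately show ?thesis using f0 by (simp add: U on_set_def)
      qed
      have "lin_on A (\<lambda>u. U (X(b := u)))"
        unfolding e using b d l A by auto
      moreover have "U (X(b := u)) = 0" if "u \<notin> A" for u
        unfolding e using that b d by (intro f0) (auto simp: cube_def)
      ultimately show "(\<lambda>u. U (X(b := u))) \<in> dual A" by (simp add: dual_def)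
    qed (simp add: U on_set_def)
  qed
qed

lemma box_fun_bij:
  assumes d: "b0 \<noteq> b1" "b0 \<noteq> b2" "b1 \<noteq> b2" and A: "cvs.subspace A" and ip: "interp A (dual A) N p b"
  shows "bij_betw (box_fun b0 b1 b2 A) (tensor {b0, b1, b2} (\<lambda>_. dual A)) (tri A)"
proof -
  have "bij_betw (tensor_fun {b0, b1, b2} (\<lambda>_. A) (\<lambda>_. dual A) (\<lambda>_ \<phi>. \<phi>)) (tensor {b0, b1, b2} (\<lambda>_. dual A))
      (sep {b0, b1, b2} (\<lambda>_. A) (\<lambda>_. dual A))"
    by (rule tensor_fun_bij[OF _ subspace_dual[OF A] _ _ ip]) (auto simp: lin_on_def bij_betw_def)
  from bij_betw_trans[OF this bij_betw_place[OF d]] show ?thesis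
    by (simp add: comp_def box_fun_def[abs_def])
qed

lemma tensor_permute:
  assumes p: "p permutes K" and T: "T \<in> tensor K (\<lambda>_. W)"
  shows "(\<lambda>\<psi>. T (\<psi> \<circ> p)) \<in> tensor K (\<lambda>_. W)"
  unfolding tensor_eq_sep sep_def
proof (intro CollectI conjI ballI allI impI)
  have T': "T \<in> sep K (\<lambda>_. dual W) (\<lambda>_. dual (dual W))" using T by (simp add: tensor_eq_sep)
  have mem: "\<psi> \<circ> p \<in> (\<Pi>\<^sub>E i\<in>K. dual W) \<longleftrightarrow> \<psi> \<in> (\<Pi>\<^sub>E i\<in>K. dual W)" for \<psi> :: "'a \<Rightarrow> 'b \<Rightarrow> complex"
  proof -
    have "(\<forall>i\<in>K. \<psi> (p i) \<in> dual W) \<longleftrightarrow> (\<forall>i\<in>K. \<psi> i \<in> dual W)"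
      using permutes_image[OF p] by (metis image_iff)
    moreover have "(\<forall>i. i \<notin> K \<longrightarrow> \<psi> (p i) = undefined) \<longleftrightarrow> (\<forall>i. i \<notin> K \<longrightarrow> \<psi> i = undefined)"
      using permutes_not_in[OF p] by metis
    ultimately show ?thesis by (simp add: PiE_iff extensional_def)
  qed
  show "T (\<psi> \<circ> p) = 0" if "\<psi> \<notin> (\<Pi>\<^sub>E i\<in>K. dual W)" for \<psi>
    using sep_outside[OF T'] mem that by blast
  fix \<psi> i assume \<psi>: "\<psi> \<in> (\<Pi>\<^sub>E i\<in>K. dual W)" and i: "i \<in> K"
  obtain j where j: "j \<in> K" "p j = i" using permutes_image[OF p] i by (metis image_iff)
  have "(\<psi>(i := x)) \<circ> p = (\<psi> \<circ> p)(j := x)" for x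
    using j permutes_inj[OF p] by (auto simp: fun_eq_iff inj_def)
  then show "(\<lambda>x. T ((\<psi>(i := x)) \<circ> p)) \<in> dual (dual W)"
    using sepD[OF T' _ j(1), of "\<psi> \<circ> p"] mem \<psi> by simp
qed

lemma subspace_tensor: "(\<And>i. i \<in> K \<Longrightarrow> cvs.subspace (W i)) \<Longrightarrow> cvs.subspace (tensor K W)"
  unfolding tensor_eq_sep by (intro subspace_sep subspace_dual)

lemma lin_on_young: "lin_on D (young_symmetrizer \<pi>)"
  by (auto simp: lin_on_def young_symmetrizer_def fun_eq_iff scaleC_fun_apply sum_distrib_left sum.distrib algebra_simps)

lemma subspace_schur: "cvs.subspace W \<Longrightarrow> cvs.subspace (schur \<pi> W)"
  unfolding schur_def by (intro lin_on_image_subspace subspace_tensor lin_on_young)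

lemma schur_subset_tensor:
  assumes W: "cvs.subspace W"
  shows "schur \<pi> W \<subseteq> tensor (boxes \<pi>) (\<lambda>_. W)"
proof
  fix U assume "U \<in> schur \<pi> W"
  then obtain T where T: "T \<in> tensor (boxes \<pi>) (\<lambda>_. W)" and U: "U = young_symmetrizer \<pi> T"
    unfolding schur_def by blast
  have "U = (\<Sum>p\<in>row_group \<pi>. \<Sum>q\<in>col_group \<pi>. of_int (sign q) *\<^sub>C (\<lambda>\<psi>. T (\<psi> \<circ> p \<circ> q)))"
    by (simp add: U young_symmetrizer_def fun_eq_iff sum_fun_apply scaleC_fun_apply)
  also have "\<dots> \<in> tensor (boxes \<pi>) (\<lambda>_. W)"
  proof (intro cvs.subspace_sum cvs.subspace_scale subspace_tensor W)
    fix p q assume "p \<in> row_group \<pi>" "q \<in> col_group \<pi>"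
    then have "p \<circ> q permutes boxes \<pi>" by (auto simp: row_group_def col_group_def intro: permutes_compose)
    from tensor_permute[OF this T] show "(\<lambda>\<psi>. T (\<psi> \<circ> p \<circ> q)) \<in> tensor (boxes \<pi>) (\<lambda>_. W)"
      by (simp add: comp_assoc)
  qed
  finally show "U \<in> tensor (boxes \<pi>) (\<lambda>_. W)" .
qed

lemma sum_permutes_2:
  "a \<noteq> b \<Longrightarrow> (\<Sum>p\<in>{p. p permutes {a, b}}. f p) = f id + (f (transpose a b) :: 'c::comm_monoid_add)"
  by (subst sum_over_permutations_insert) (simp_all add: permutes_sing add.commute)

lemma sum_permutes_3:
  assumes "a \<noteq> b" "a \<noteq> c" "b \<noteq> c"
  shows "(\<Sum>p\<in>{p. p permutes {a, b, c}}. f p) = (f id + f (transpose b c)) + (f (transpose a b) + f (transpose a b \<circ> transpose b c)) +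
    (f (transpose a c) + (f (transpose a c \<circ> transpose b c) :: 'c::comm_monoid_add))"
  using assms by (subst sum_over_permutations_insert) (simp_all add: sum_permutes_2 add_ac)

definition ev_place :: "'b \<Rightarrow> 'b \<Rightarrow> 'b \<Rightarrow> 'v::complex_vector set \<Rightarrow> 'v \<times> 'v \<times> 'v \<Rightarrow> 'b \<Rightarrow> ('v \<Rightarrow> complex) \<Rightarrow> complex" where
  "ev_place b0 b1 b2 A t = (\<lambda>b\<in>{b0, b1, b2}. on_set (dual A) (\<lambda>\<phi>. \<phi> (place b0 b1 b2 t b)))"

lemma box_fun_eq: "t \<in> cube A \<Longrightarrow> box_fun b0 b1 b2 A f t = f (ev_place b0 b1 b2 A t)"
  unfolding box_fun_def tensor_fun_def by (simp only: on_set_in place_PiE ev_place_def)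

lemma ev_place_transpose:
  assumes "b0 \<noteq> b1" "b0 \<noteq> b2" "b1 \<noteq> b2"
  shows "ev_place b0 b1 b2 A t \<circ> transpose b0 b1 = ev_place b0 b1 b2 A (pm 3 t)"
    "ev_place b0 b1 b2 A t \<circ> transpose b1 b2 = ev_place b0 b1 b2 A (pm 4 t)"
    "ev_place b0 b1 b2 A t \<circ> transpose b0 b2 = ev_place b0 b1 b2 A (pm 5 t)"
  using assms by (cases t; auto simp: ev_place_def place_def transpose_def fun_eq_iff)+

fun shape :: "label \<Rightarrow> nat list" where
  "shape Sy = [3]" | "shape Al = [1, 1, 1]" | "shape Pl = [2, 1]" | "shape Mi = [2, 1]"

fun box1 :: "label \<Rightarrow> nat \<times> nat" where
  "box1 Sy = (0, 1)" | "box1 Al = (1, 0)" | "box1 Pl = (0, 1)" | "box1 Mi = (0, 1)"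

fun box2 :: "label \<Rightarrow> nat \<times> nat" where
  "box2 Sy = (0, 2)" | "box2 Al = (2, 0)" | "box2 Pl = (1, 0)" | "box2 Mi = (1, 0)"

lemma boxes_shape: "boxes (shape c) = {(0, 0), box1 c, box2 c}"
  by (cases c) (auto simp: boxes_def less_Suc_eq numeral_3_eq_3 numeral_2_eq_2)

lemma box_distinct: "(0, 0) \<noteq> box1 c" "(0, 0) \<noteq> box2 c" "box1 c \<noteq> box2 c"
  by (cases c; simp)+

text \<open>A permutation preserving \<open>g\<close> moves nothing outside \<open>R\<close>, where
  \<open>g\<close> is injective. Taking for \<open>g\<close> the row or the column of a box yields
  the row and column groups, as a diagram of degree three has at most one row and at most one column
  with several boxes.\<close>

lemma permutes_fix_eq:
  assumes R: "R \<subseteq> S" and inj: "\<And>b b'. b \<in> S \<Longrightarrow> b' \<in> S \<Longrightarrow> g b = g b' \<Longrightarrow> b \<in> R \<and> b' \<in> R \<or> b = b'"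
    and c: "\<And>b b'. b \<in> R \<Longrightarrow> b' \<in> R \<Longrightarrow> g b = g b'"
  shows "{p. p permutes S \<and> (\<forall>b. g (p b) = g b)} = {p. p permutes R}"
proof (intro Collect_eqI iffI conjI allI)
  fix p assume p: "p permutes S \<and> (\<forall>b. g (p b) = g b)"
  show "p permutes R"
  proof (rule permutes_superset[of p S])
    fix x assume x: "x \<in> S - R"
    have "p x \<in> S" "g (p x) = g x" using p x permutes_in_image[of p S x] by auto
    then show "p x = x" using inj[of "p x" x] x by auto
  qed (use p in simp)
next
  fix p b assume p: "p permutes R"
  show "p permutes S" using p R by (rule permutes_subset)
  show "g (p b) = g b"
    using c[of "p b" b] permutes_in_image[OF p, of b] permutes_not_in[OF p, of b] by (cases "b \<in> R") auto
qed

fun row_boxes :: "label \<Rightarrow> (nat \<times> nat) set" where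
  "row_boxes Sy = {(0, 0), (0, 1), (0, 2)}" | "row_boxes Al = {}" | "row_boxes Pl = {(0, 0), (0, 1)}" | "row_boxes Mi = {(0, 0), (0, 1)}"

fun col_boxes :: "label \<Rightarrow> (nat \<times> nat) set" where
  "col_boxes Sy = {}" | "col_boxes Al = {(0, 0), (1, 0), (2, 0)}" | "col_boxes Pl = {(0, 0), (1, 0)}" | "col_boxes Mi = {(0, 0), (1, 0)}"

lemma row_group_shape: "row_group (shape c) = {p. p permutes row_boxes c}"
  unfolding row_group_def boxes_shape
  by (rule permutes_fix_eq) (cases c; auto)+

lemma col_group_shape: "col_group (shape c) = {p. p permutes col_boxes c}"
  unfolding col_group_def boxes_shape
  by (rule permutes_fix_eq) (cases c; auto)+

text \<open>Coefficients of the Young symmetrizers in the numbering of \<open>pm\<close>. For shape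
  \<open>[2, 1]\<close> the row transposition is 3, the column transposition is 5, and their product
  is the rotation 2 with sign -1.\<close>

fun young :: "label \<Rightarrow> nat \<Rightarrow> complex" where
  "young Sy = vec6 1 1 1 1 1 1" | "young Al = vec6 1 1 1 (-1) (-1) (-1)"
| "young Pl = vec6 1 0 (-1) 1 0 (-1)" | "young Mi = vec6 1 0 (-1) 1 0 (-1)"

abbreviation schur_fun1 :: "label \<Rightarrow> 'v::complex_vector set \<Rightarrow>
    ((nat \<times> nat \<Rightarrow> ('v \<Rightarrow> complex) \<Rightarrow> complex) \<Rightarrow> complex) \<Rightarrow> 'v \<times> 'v \<times> 'v \<Rightarrow> complex" where
  "schur_fun1 c A \<equiv> box_fun (0, 0) (box1 c) (box2 c) A"

lemma schur_fun1_young: "schur_fun1 c A (young_symmetrizer (shape c) f) = perm_op (young c) (schur_fun1 c A f)"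
proof
  fix t
  let ?e = "ev_place (0, 0) (box1 c) (box2 c) A"
  show "schur_fun1 c A (young_symmetrizer (shape c) f) t = perm_op (young c) (schur_fun1 c A f) t"
  proof (cases "t \<in> cube A")
    case True
    have T: "?e t \<circ> transpose (0, 0) (box1 c) = ?e (pm 3 t)" "?e t \<circ> transpose (box1 c) (box2 c) = ?e (pm 4 t)"
       "?e t \<circ> transpose (0, 0) (box2 c) = ?e (pm 5 t)" for t
      by (rule ev_place_transpose[OF box_distinct])+
    have T2: "?e t \<circ> (transpose (0, 0) (box1 c) \<circ> transpose (box1 c) (box2 c)) = ?e (pm 4 (pm 3 t))"
      "?e t \<circ> (transpose (0, 0) (box2 c) \<circ> transpose (box1 c) (box2 c)) = ?e (pm 4 (pm 5 t))" for t
      by (simp_all only: comp_assoc[symmetric] T)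
    have P: "pm 4 (pm 3 t) = pm 1 t" "pm 4 (pm 5 t) = pm 2 t" "pm 5 (pm 3 t) = pm 2 t" for t :: "'a \<times> 'a \<times> 'a"
      by (simp_all add: pm_pm pm_mult_def)
    have "schur_fun1 c A (young_symmetrizer (shape c) f) t =
        (\<Sum>p\<in>row_group (shape c). \<Sum>q\<in>col_group (shape c). of_int (sign q) * f (?e t \<circ> p \<circ> q))"
      by (simp add: box_fun_eq[OF True] young_symmetrizer_def)
    also have "\<dots> = (\<Sum>s<6. young c s * f (?e (pm s t)))"
      unfolding row_group_shape col_group_shape sum_less_6
      using T T2 P
      by (cases c) (simp_all add: permutes_empty sum_permutes_2 sum_permutes_3 sign_compose sign_swap_id permutation_swap_id)
    also have "\<dots> = perm_op (young c) (schur_fun1 c A f) t"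
      using True by (simp add: perm_op_def box_fun_eq)
    finally show ?thesis .
  next
    case False
    then show ?thesis by (simp add: perm_op_def box_fun_def on_set_def)
  qed
qed

lemma conv_idem_young: "conv (idem c) (young c) = young c"
  by (cases c) (simp_all only: conv_def idem.simps proj.simps young.simps, auto intro!: vec6_cong simp: field_simps omega_square omega_square')

text \<open>The scalar is the product of the hook lengths, 6 or 3. Together with
  \<open>conv_idem_young\<close> this means that \<open>young c\<close> and \<open>idem c\<close>
  have the same image.\<close>

lemma conv_young_idem: "\<exists>k. k \<noteq> 0 \<and> conv (young c) (idem c) = (\<lambda>s. k * idem c s)"
  by (intro exI[of _ "if c = Sy \<or> c = Al then 6 else 3"], cases c)
    (simp_all only: conv_def idem.simps proj.simps young.simps vec6_scale, auto intro!: vec6_cong simp: field_simps omega_square omega_square')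

text \<open>Seen on trilinear functions, the Young symmetrizer is the operator
  \<open>young c\<close>, whose image is the fixed space of \<open>idem c\<close>. Injectivity is
  inherited from the space of all tensors over the boxes.\<close>

lemma schur_fun1_bij:
  assumes A: "cvs.subspace A" and ip: "interp A (dual A) N p b"
  shows "bij_betw (schur_fun1 c A) (schur (shape c) (dual A)) (fixed (idem c) (tri A))"
proof -
  let ?B = "boxes (shape c)" and ?F = "schur_fun1 c A"
  have bij: "bij_betw ?F (tensor ?B (\<lambda>_. dual A)) (tri A)"
    unfolding boxes_shape by (rule box_fun_bij[OF box_distinct A ip])
  have "?F ` schur (shape c) (dual A) = perm_op (young c) ` (?F ` tensor ?B (\<lambda>_. dual A))"
    unfolding schur_def image_image schur_fun1_young ..
  also have "\<dots> = perm_op (young c) ` tri A"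
    by (simp only: bij_betw_imp_surj_on[OF bij])
  also have "\<dots> = fixed (idem c) (tri A)"
  proof (intro equalityI subsetI)
    fix f assume "f \<in> perm_op (young c) ` tri A"
    then show "f \<in> fixed (idem c) (tri A)"
      by (auto simp: fixed_def perm_op_comp conv_idem_young perm_op_closed pm_stable_tri)
  next
    fix f assume f: "f \<in> fixed (idem c) (tri A)"
    \<comment> \<open>On the fixed space \<open>young c\<close> is multiplication by
      \<open>k\<close>, so \<open>f\<close> divided by \<open>k\<close> is a preimage of
      \<open>f\<close>.\<close>
    obtain k where k: "k \<noteq> 0" "conv (young c) (idem c) = (\<lambda>s. k * idem c s)" using conv_young_idem by blast
    have "perm_op (young c) f = perm_op (young c) (perm_op (idem c) f)" using f by (simp add: fixed_def)
    also have "\<dots> = k *\<^sub>C perm_op (idem c) f"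
      unfolding perm_op_comp k(2) by (simp add: perm_op_def fun_eq_iff scaleC_fun_apply sum_distrib_left mult.assoc)
    also have "\<dots> = k *\<^sub>C f" using f by (simp add: fixed_def)
    finally have "f = perm_op (young c) ((1 / k) *\<^sub>C f)"
      using k(1) by (simp add: perm_op_linear scaleC_scaleC scaleC_one)
    then show "f \<in> perm_op (young c) ` tri A"
      using f cvs.subspace_scale[OF subspace_tri] by (auto simp: fixed_def intro!: image_eqI)
  qed
  finally show ?thesis
    using bij schur_subset_tensor[OF subspace_dual[OF A]]
    by (auto simp: bij_betw_def intro: inj_on_subset)
qed

definition schur_fun :: "'i set \<Rightarrow> ('i \<Rightarrow> 'v::complex_vector set) \<Rightarrow> ('i \<Rightarrow> label) \<Rightarrow>
    (('i \<Rightarrow> ((nat \<times> nat \<Rightarrow> ('v \<Rightarrow> complex) \<Rightarrow> complex) \<Rightarrow> complex) \<Rightarrow> complex) \<Rightarrow> complex) \<Rightarrow> ('i \<Rightarrow> 'v \<times> 'v \<times> 'v) \<Rightarrow> complex" where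
  "schur_fun K A c = tensor_fun K (cubes A) (\<lambda>i. schur (shape (c i)) (dual (A i))) (\<lambda>i. schur_fun1 (c i) (A i))"

lemma schur_fun1_tensor_map:
  assumes A: "cvs.subspace A" and f: "\<And>\<phi>. \<phi> \<in> dual A \<Longrightarrow> f \<phi> \<in> dual A"
    and h: "\<And>x. x \<in> A \<Longrightarrow> h x \<in> A" and eq: "\<And>\<phi> x. \<phi> \<in> dual A \<Longrightarrow> x \<in> A \<Longrightarrow> f \<phi> x = \<phi> (h x)"
    and t: "(x, y, z) \<in> cube A"
  shows "schur_fun1 c A (tensor_map (boxes (shape c)) (\<lambda>_. dual A) (\<lambda>_. f) T) (x, y, z) = schur_fun1 c A T (h x, h y, h z)"
proof -
  let ?p = "place (0, 0) (box1 c) (box2 c)"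
  have ht: "(h x, h y, h z) \<in> cube A" using t h by (simp add: cube_def)
  have "(\<lambda>b\<in>{(0, 0), box1 c, box2 c}. h (?p (x, y, z) b)) = ?p (h x, h y, h z)"
    by (auto simp: place_def fun_eq_iff)
  moreover have "tensor_fun (boxes (shape c)) (\<lambda>_. A) (\<lambda>_. dual A) (\<lambda>_ \<phi>. \<phi>) (tensor_map (boxes (shape c)) (\<lambda>_. dual A) (\<lambda>_. f) T) (?p (x, y, z)) =
    tensor_fun (boxes (shape c)) (\<lambda>_. A) (\<lambda>_. dual A) (\<lambda>_ \<phi>. \<phi>) T (\<lambda>b\<in>boxes (shape c). h (?p (x, y, z) b))"
    using place_PiE[OF t, of "(0, 0)" "box1 c" "box2 c"]
    by (intro tensor_fun_tensor_map subspace_dual A f h eq) (auto simp: lin_on_def boxes_shape)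
  ultimately show ?thesis
    using t ht by (simp add: box_fun_def on_set_in boxes_shape)
qed

section \<open>Cubic polynomials and their polarisations\<close>

text \<open>Points and coefficients change places: the \<open>b n\<close> are now the points, and
  evaluations at the \<open>p n\<close> are the coefficients.\<close>

lemma interp_double_dual:
  assumes W: "cvs.subspace W" and ip: "interp W (dual W) N p b"
  shows "interp (dual W) (dual (dual W)) N b (\<lambda>n. on_set (dual W) (\<lambda>\<phi>. \<phi> (p n)))"
  unfolding interp_def
proof (intro conjI ballI allI impI)
  show "on_set (dual W) (\<lambda>\<phi>. \<phi> (p n)) \<in> dual (dual W)" for n
    by (rule on_set_dual[OF subspace_dual[OF W]]) (simp add: lin_on_def scaleC_fun_def)
  show "f \<phi> = (\<Sum>n\<in>N. f (b n) * on_set (dual W) (\<lambda>\<phi>. \<phi> (p n)) \<phi>)" if f: "f \<in> dual (dual W)" for f \<phi>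
  proof (cases "\<phi> \<in> dual W")
    case True
    have "\<phi> = (\<Sum>n\<in>N. \<phi> (p n) *\<^sub>C b n)"
      unfolding fun_eq_iff sum_fun_apply scaleC_fun_apply using interpD(6)[OF ip True] by blast
    then have "f \<phi> = f (\<Sum>n\<in>N. \<phi> (p n) *\<^sub>C b n)" by (rule arg_cong)
    also have "\<dots> = (\<Sum>n\<in>N. \<phi> (p n) *\<^sub>C f (b n))"
      by (rule lin_on_sum_scale[OF subspace_dual[OF W] dual_lin[OF f] interpD(5)[OF ip]])
    finally show ?thesis using True by (simp add: on_set_def scaleC_complex_def mult.commute)
  qed (simp add: on_set_def dual_outside[OF f])
qed (simp_all add: subspace_dual W dual_outside interpD(3,5)[OF ip])

lemma hom_polys_outside: "P \<in> hom_polys d V \<Longrightarrow> v \<notin> V \<Longrightarrow> P v = 0"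
  unfolding hom_polys_def
  by (induction rule: cvs.span_induct) (auto simp: cvs.subspace_def scaleC_fun_apply zero_fun_def plus_fun_def on_set_def)

lemma subspace_hom_polys: "cvs.subspace (hom_polys d V)"
  unfolding hom_polys_def by (rule cvs.subspace_span)

text \<open>The third difference of \<open>P\<close> at the origin, divided by 3!. The term P 0 is
  absent because a cubic form vanishes at 0.\<close>

definition polz :: "'v::complex_vector set \<Rightarrow> ('v \<Rightarrow> complex) \<Rightarrow> 'v \<times> 'v \<times> 'v \<Rightarrow> complex" where
  "polz V P = on_set (cube V) (\<lambda>(u, v, w).
     (P (u + v + w) - P (u + v) - P (u + w) - P (v + w) + P u + P v + P w) / 6)"

lemma lin_on_polz: "lin_on D (polz V)"
  by (auto simp: lin_on_def polz_def fun_eq_iff on_set_def scaleC_fun_apply algebra_simps diff_divide_distrib add_divide_distrib)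

definition triple_prod :: "('v \<Rightarrow> complex) \<Rightarrow> ('v \<Rightarrow> complex) \<Rightarrow> ('v \<Rightarrow> complex) \<Rightarrow> 'v \<times> 'v \<times> 'v \<Rightarrow> complex" where
  "triple_prod f g h = (\<lambda>(x, y, z). f x * (g y * h z))"

lemma triple_prod_tri:
  assumes "f \<in> dual V" "g \<in> dual V" "h \<in> dual V"
  shows "triple_prod f g h \<in> tri V"
proof -
  note l = dual_lin[OF assms(1)] dual_lin[OF assms(2)] dual_lin[OF assms(3)]
  show ?thesis
    unfolding tri_def triple_prod_def using assms
    by (auto simp: cube_def dual_outside intro!: lin_on_times lin_on_times_right l)
qed

lemma subspace_fixed: "pm_stable S \<Longrightarrow> cvs.subspace (fixed e S)"
  unfolding cvs.subspace_def fixed_def using pm_stableD(1)[of S] by (simp add: cvs.subspace_def perm_op_linear)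

text \<open>The third difference keeps exactly the terms in which each of the three vectors occurs
  once, that is, the six ways of distributing them over the linear forms.\<close>

lemma polz_product:
  fixes V :: "'v::complex_vector set"
  assumes V: "cvs.subspace V" and f: "f \<in> dual V" and g: "g \<in> dual V" and h: "h \<in> dual V"
  shows "polz V (on_set V (\<lambda>v. f v * (g v * h v))) = perm_op (proj Sy) (triple_prod f g h)"
proof
  fix t :: "'v \<times> 'v \<times> 'v"
  obtain u v w where t: "t = (u, v, w)" by (cases t)
  have l: "k (x + y) = k x + k y" if "k \<in> dual V" "x \<in> V" "y \<in> V" for k x y
    using lin_on_add[OF dual_lin[OF that(1)] that(2,3)] .
  show "polz V (on_set V (\<lambda>v. f v * (g v * h v))) t = perm_op (proj Sy) (triple_prod f g h) t"
  proof (cases "t \<in> cube V")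
    case True
    then have m: "u \<in> V" "v \<in> V" "w \<in> V" by (auto simp: t cube_def)
    then have s: "u + v \<in> V" "u + w \<in> V" "v + w \<in> V" "u + v + w \<in> V" by (auto intro: cvs.subspace_add[OF V])
    note L = l[OF f] l[OF g] l[OF h]
    show ?thesis
      unfolding perm_op_def sum_less_6 t polz_def on_set_in[OF True[unfolded t]] prod.case on_set_in[OF m(1)] on_set_in[OF m(2)]
        on_set_in[OF m(3)] on_set_in[OF s(1)] on_set_in[OF s(2)] on_set_in[OF s(3)] on_set_in[OF s(4)]
      using m s by (simp add: L triple_prod_def field_simps)
  next
    case False
    have "perm_op (proj Sy) (triple_prod f g h) \<in> tri V" by (rule perm_op_closed[OF pm_stable_tri triple_prod_tri[OF f g h]])
    then have "perm_op (proj Sy) (triple_prod f g h) t = 0" using False unfolding tri_def by blast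
    then show ?thesis using False by (simp add: polz_def on_set_def)
  qed
qed

lemma hom_polys_3:
  "hom_polys 3 V = cvs.span {on_set V (\<lambda>v. f v * (g v * h v)) |f g h. f \<in> dual V \<and> g \<in> dual V \<and> h \<in> dual V}"
  unfolding hom_polys_def
proof (intro arg_cong[where f = cvs.span] Collect_eqI iffI)
  have p: "(\<Prod>s<3::nat. \<phi> s v) = \<phi> 0 v * (\<phi> 1 v * \<phi> 2 v)" for \<phi> :: "nat \<Rightarrow> 'a \<Rightarrow> complex" and v
    by (simp add: eval_nat_numeral mult_ac)
  {
    fix P assume "\<exists>\<phi>. P = on_set V (\<lambda>v. \<Prod>s<3::nat. \<phi> s v) \<and> (\<forall>s<3::nat. \<phi> s \<in> dual V)"
    then obtain \<phi> where "P = on_set V (\<lambda>v. \<Prod>s<3::nat. \<phi> s v)" and \<phi>: "\<forall>s<3::nat. \<phi> s \<in> dual V" by blast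
    then have "P = on_set V (\<lambda>v. \<phi> 0 v * (\<phi> 1 v * \<phi> 2 v))" by (simp only: p)
    moreover have "\<phi> 0 \<in> dual V \<and> \<phi> 1 \<in> dual V \<and> \<phi> 2 \<in> dual V" using \<phi> by simp
    ultimately show "\<exists>f g h. P = on_set V (\<lambda>v. f v * (g v * h v)) \<and> f \<in> dual V \<and> g \<in> dual V \<and> h \<in> dual V" by blast
  next
    fix P assume "\<exists>f g h. P = on_set V (\<lambda>v. f v * (g v * h v)) \<and> f \<in> dual V \<and> g \<in> dual V \<and> h \<in> dual V"
    then obtain f g h where P: "P = on_set V (\<lambda>v. f v * (g v * h v))" and m: "f \<in> dual V" "g \<in> dual V" "h \<in> dual V" by blast
    let ?\<phi> = "\<lambda>s::nat. if s = 0 then f else if s = 1 then g else h"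
    have "P = on_set V (\<lambda>v. \<Prod>s<3::nat. ?\<phi> s v)" unfolding P by (simp add: eval_nat_numeral mult_ac)
    moreover have "\<forall>s<3::nat. ?\<phi> s \<in> dual V" using m by simp
    ultimately show "\<exists>\<phi>. P = on_set V (\<lambda>v. \<Prod>s<3::nat. \<phi> s v) \<and> (\<forall>s<3::nat. \<phi> s \<in> dual V)"
      by (intro exI[of _ ?\<phi>] conjI)
  }
qed

text \<open>Both claims are linear in \<open>P\<close>, hence need checking only on products of
  three linear forms. The second one makes polarisation injective.\<close>

lemma polz_hom_polys:
  assumes V: "cvs.subspace V" and P: "P \<in> hom_polys 3 V"
  shows "polz V P \<in> fixed (proj Sy) (tri V)" "v \<in> V \<Longrightarrow> polz V P (v, v, v) = P v"
proof -
  have "polz V P \<in> fixed (proj Sy) (tri V) \<and> (\<forall>v\<in>V. polz V P (v, v, v) = P v)"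
    using P unfolding hom_polys_3
  proof (induction rule: cvs.span_induct)
    case base
    have s: "cvs.subspace (fixed (proj Sy) (tri V))" by (rule subspace_fixed[OF pm_stable_tri])
    have l: "polz V (x + y) = polz V x + polz V y" "polz V (c *\<^sub>C x) = c *\<^sub>C polz V x" "polz V 0 = 0" for x y c
      by (auto simp: polz_def fun_eq_iff on_set_def scaleC_fun_apply algebra_simps diff_divide_distrib add_divide_distrib)
    show ?case
      unfolding cvs.subspace_def using s by (simp add: l cvs.subspace_def scaleC_fun_apply)
  next
    case (step P)
    then obtain f g h where P: "P = on_set V (\<lambda>v. f v * (g v * h v))" and m: "f \<in> dual V" "g \<in> dual V" "h \<in> dual V" by blast
    have e: "polz V P = perm_op (proj Sy) (triple_prod f g h)" unfolding P by (rule polz_product[OF V m])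
    have "perm_op (proj Sy) (perm_op (proj Sy) (triple_prod f g h)) = perm_op (proj Sy) (triple_prod f g h)"
      using conv_idem_idem[of Sy] by (simp add: perm_op_comp del: proj.simps)
    moreover have "perm_op (proj Sy) (triple_prod f g h) (v, v, v) = P v" if "v \<in> V" for v
      unfolding perm_op_def sum_less_6 using that by (simp add: P triple_prod_def on_set_def)
    ultimately show ?case
      unfolding e using perm_op_closed[OF pm_stable_tri triple_prod_tri[OF m]] by (simp add: fixed_def)
  qed
  then show "polz V P \<in> fixed (proj Sy) (tri V)" "v \<in> V \<Longrightarrow> polz V P (v, v, v) = P v" by blast+
qed

lemma polz_bij:
  assumes V: "cvs.subspace V" and ip: "interp V (dual V) N p b"
  shows "bij_betw (polz V) (hom_polys 3 V) (fixed (proj Sy) (tri V))"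
  unfolding bij_betw_def
proof (intro conjI inj_onI equalityI subsetI)
  fix P Q assume P: "P \<in> hom_polys 3 V" and Q: "Q \<in> hom_polys 3 V" and eq: "polz V P = polz V Q"
  show "P = Q"
  proof
    fix v show "P v = Q v"
      using polz_hom_polys(2)[OF V P, of v] polz_hom_polys(2)[OF V Q, of v] eq hom_polys_outside[OF P, of v]
        hom_polys_outside[OF Q, of v] by (cases "v \<in> V") auto
  qed
next
  fix f assume f: "f \<in> fixed (proj Sy) (tri V)"
  let ?N = "N \<times> N \<times> N"
  let ?g = "\<lambda>(n, m, l). triple_prod (b n) (b m) (b l)"
  let ?P = "\<lambda>(n, m, l). on_set V (\<lambda>v. b n v * (b m v * b l v))"
  let ?c = "\<lambda>n. f (case n of (n, m, l) \<Rightarrow> (p n, p m, p l))"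
  have b: "b n \<in> dual V" if "n \<in> N" for n using interpD(5)[OF ip that] .
  have ft: "f \<in> tri V" using f by (simp add: fixed_def)
  \<comment> \<open>The expansion over the grid writes \<open>f\<close> as a combination of products
    of linear forms. Polarising the same combination of polynomials symmetrises \<open>f\<close>,
    which is symmetric already.\<close>
  have e: "(\<Sum>n\<in>?N. ?c n *\<^sub>C ?g n) = f"
  proof
    fix t
    have "(\<Sum>n\<in>?N. ?c n *\<^sub>C ?g n) t = (\<Sum>n\<in>?N. ?c n * (case n of (n, m, l) \<Rightarrow> \<lambda>(x, y, z). b n x * (b m y * b l z)) t)"
      unfolding sum_fun_apply scaleC_fun_apply by (intro sum.cong refl) (simp add: triple_prod_def case_prod_unfold)
    also have "\<dots> = f t" by (rule interpD(6)[OF interp_tri[OF ip] ft, symmetric])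
    finally show "(\<Sum>n\<in>?N. ?c n *\<^sub>C ?g n) t = f t" .
  qed
  have mem: "(\<Sum>n\<in>?N. ?c n *\<^sub>C ?P n) \<in> hom_polys 3 V"
    unfolding hom_polys_3
  proof (intro cvs.subspace_sum cvs.subspace_scale cvs.subspace_span cvs.span_base)
    fix n assume "n \<in> ?N"
    then obtain i j l where n: "n = (i, j, l)" "i \<in> N" "j \<in> N" "l \<in> N" by auto
    show "?P n \<in> {on_set V (\<lambda>v. f v * (g v * h v)) |f g h. f \<in> dual V \<and> g \<in> dual V \<and> h \<in> dual V}"
      unfolding n(1) prod.case using b[OF n(2)] b[OF n(3)] b[OF n(4)] by blast
  qed
  have Pn: "?P n \<in> UNIV" for n by simp
  have "polz V (\<Sum>n\<in>?N. ?c n *\<^sub>C ?P n) = (\<Sum>n\<in>?N. ?c n *\<^sub>C polz V (?P n))"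
    by (rule lin_on_sum_scale[OF cvs.subspace_UNIV lin_on_polz Pn])
  also have "\<dots> = (\<Sum>n\<in>?N. ?c n *\<^sub>C perm_op (proj Sy) (?g n))"
    using polz_product[OF V b b b] by (intro sum.cong refl) (auto simp del: proj.simps)
  also have "\<dots> = perm_op (proj Sy) (\<Sum>n\<in>?N. ?c n *\<^sub>C ?g n)"
    by (rule lin_on_sum_scale[OF cvs.subspace_UNIV lin_on_perm_op, symmetric]) simp
  also have "\<dots> = f" using f unfolding e by (simp add: fixed_def del: proj.simps)
  finally show "f \<in> polz V ` hom_polys 3 V" using mem by (metis (no_types, lifting) image_eqI)
qed (use polz_hom_polys(1)[OF V] in blast)

section \<open>Restricting trilinear functions to decomposable tensors\<close>

lemma lin_on_comp: "lin_on W f \<Longrightarrow> (\<And>x. x \<in> W \<Longrightarrow> f x \<in> W') \<Longrightarrow> lin_on W' g \<Longrightarrow> lin_on W (\<lambda>x. g (f x))"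
  by (simp add: lin_on_def)

lemma triD:
  assumes "f \<in> tri W"
  shows "\<And>t. t \<notin> cube W \<Longrightarrow> f t = 0" "\<And>x y. x \<in> W \<Longrightarrow> y \<in> W \<Longrightarrow> lin_on W (\<lambda>u. f (u, x, y))"
    "\<And>x y. x \<in> W \<Longrightarrow> y \<in> W \<Longrightarrow> lin_on W (\<lambda>u. f (x, u, y))" "\<And>x y. x \<in> W \<Longrightarrow> y \<in> W \<Longrightarrow> lin_on W (\<lambda>u. f (x, y, u))"
  using assms unfolding tri_def by blast+

text \<open>Finite dimension of the \<open>A i\<close> enters in the form of interpolation data
  chosen once; all grids and expansions below refer to this choice.\<close>

locale vs_family =
  fixes K :: "'i set" and A :: "'i \<Rightarrow> 'v::complex_vector set"
    and N :: "'i \<Rightarrow> 'v set" and p :: "'i \<Rightarrow> 'v \<Rightarrow> 'v" and b :: "'i \<Rightarrow> 'v \<Rightarrow> 'v \<Rightarrow> complex"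
  assumes K: "finite K" and A: "\<And>i. i \<in> K \<Longrightarrow> cvs.subspace (A i)"
    and ip: "\<And>i. i \<in> K \<Longrightarrow> interp (A i) (dual (A i)) (N i) (p i) (b i)"
begin

abbreviation V :: "(('i \<Rightarrow> 'v \<Rightarrow> complex) \<Rightarrow> complex) set" where
  "V \<equiv> tensor K A"

abbreviation pure :: "('i \<Rightarrow> 'v) \<Rightarrow> ('i \<Rightarrow> 'v \<Rightarrow> complex) \<Rightarrow> complex" where
  "pure \<equiv> pure_tensor K A"

abbreviation trilinears :: "(('i \<Rightarrow> 'v \<times> 'v \<times> 'v) \<Rightarrow> complex) set" where
  "trilinears \<equiv> sep K (cubes A) (\<lambda>i. tri (A i))"

lemma V: "cvs.subspace V"
  by (rule subspace_tensor[OF A])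

lemma pure_in:
  assumes "\<And>i. i \<in> K \<Longrightarrow> w i \<in> A i"
  shows "pure w \<in> V"
proof -
  have "on_set (Pi\<^sub>E K (\<lambda>i. dual (A i))) (\<lambda>\<psi>. \<Prod>i\<in>K. on_set (dual (A i)) (\<lambda>\<phi>. \<phi> (w i)) (\<psi> i)) \<in> V"
    unfolding tensor_eq_sep
  proof (rule sep_product[OF K])
    fix i assume i: "i \<in> K"
    show "on_set (dual (A i)) (\<lambda>\<phi>. \<phi> (w i)) \<in> dual (dual (A i))"
      by (rule on_set_dual[OF subspace_dual[OF A[OF i]]]) (simp add: lin_on_def scaleC_fun_def)
  qed (simp_all add: subspace_dual A dual_outside)
  also have "on_set (Pi\<^sub>E K (\<lambda>i. dual (A i))) (\<lambda>\<psi>. \<Prod>i\<in>K. on_set (dual (A i)) (\<lambda>\<phi>. \<phi> (w i)) (\<psi> i)) = pure w"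
    by (auto simp: pure_tensor_def on_set_def fun_eq_iff PiE_iff intro!: prod.cong)
  finally show ?thesis .
qed

lemma pure_cong: "(\<And>i. i \<in> K \<Longrightarrow> w i = w' i) \<Longrightarrow> pure w = pure w'"
  by (simp add: pure_tensor_def cong: prod.cong)

lemma lin_on_pure:
  assumes "i \<in> K"
  shows "lin_on (A i) (\<lambda>x. pure (w(i := x)))"
proof -
  have "pure (w(i := x)) = on_set (Pi\<^sub>E K (\<lambda>i. dual (A i))) (\<lambda>\<psi>. \<psi> i x * (\<Prod>j\<in>K - {i}. \<psi> j (w j)))" for x
  proof -
    have "(\<Prod>j\<in>K. \<psi> j ((w(i := x)) j)) = \<psi> i x * (\<Prod>j\<in>K - {i}. \<psi> j (w j))" for \<psi> :: "'i \<Rightarrow> 'v \<Rightarrow> complex"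
      unfolding prod.remove[OF K assms] by (auto intro!: arg_cong2[where f="(*)"] prod.cong)
    then show ?thesis by (simp add: pure_tensor_def)
  qed
  note e = this
  have l: "lin_on (A i) (\<psi> i)" if "\<psi> \<in> Pi\<^sub>E K (\<lambda>i. dual (A i))" for \<psi>
    using that assms by (auto simp: dual_def)
  show ?thesis
    unfolding lin_on_def
  proof (intro conjI ballI allI ext)
    fix x y \<psi> assume "x \<in> A i" "y \<in> A i"
    then show "pure (w(i := x + y)) \<psi> = (pure (w(i := x)) + pure (w(i := y))) \<psi>"
      unfolding e using lin_on_add[OF l, of \<psi> x y] by (simp add: on_set_def algebra_simps)
  next
    fix c x \<psi> assume "x \<in> A i"
    then show "pure (w(i := c *\<^sub>C x)) \<psi> = (c *\<^sub>C pure (w(i := x))) \<psi>"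
      unfolding e scaleC_fun_apply using lin_on_scale[OF l, of \<psi> x c] by (simp add: on_set_def scaleC_complex_def)
  qed
qed

lemma pure_zero:
  assumes "i \<in> K" "w i = 0"
  shows "pure w = 0"
  using lin_on_zero[OF A lin_on_pure, OF assms(1) assms(1), of w] assms(2) by (metis fun_upd_triv)

text \<open>Pure tensors of grid vectors span \<open>V\<close>. The coefficients of a tensor are its
  values on the functionals \<open>b i (n i)\<close>, because a tensor is itself a function that can
  be expanded in each dual space.\<close>

lemma interp_V:
  "interp V (dual V) (Pi\<^sub>E K N) (\<lambda>n. pure (\<lambda>i\<in>K. p i (n i))) (\<lambda>n. on_set V (\<lambda>v. v (\<lambda>i\<in>K. b i (n i))))"
proof -
  note I = interpD[OF ip]
  have pn: "pure (\<lambda>i\<in>K. p i (n i)) \<in> V" if "n \<in> Pi\<^sub>E K N" for n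
    using that I(4) by (intro pure_in) auto
  have bn: "on_set V (\<lambda>v. v (\<lambda>i\<in>K. b i (n i))) \<in> dual V" for n
    by (rule on_set_dual[OF V]) (simp add: lin_on_def scaleC_fun_def)
  have v: "v = (\<Sum>n\<in>Pi\<^sub>E K N. v (\<lambda>i\<in>K. b i (n i)) *\<^sub>C pure (\<lambda>i\<in>K. p i (n i)))" if v: "v \<in> V" for v
  proof
    fix \<psi>
    show "v \<psi> = (\<Sum>n\<in>Pi\<^sub>E K N. v (\<lambda>i\<in>K. b i (n i)) *\<^sub>C pure (\<lambda>i\<in>K. p i (n i))) \<psi>"
    proof (cases "\<psi> \<in> Pi\<^sub>E K (\<lambda>i. dual (A i))")
      case True
      have "v \<psi> = (\<Sum>n\<in>Pi\<^sub>E K N. v (\<lambda>i\<in>K. b i (n i)) * (\<Prod>i\<in>K. on_set (dual (A i)) (\<lambda>\<phi>. \<phi> (p i (n i))) (\<psi> i)))"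
        by (rule sep_expand[OF K v[unfolded tensor_eq_sep] True interp_double_dual[OF A ip]])
      also have "\<dots> = (\<Sum>n\<in>Pi\<^sub>E K N. v (\<lambda>i\<in>K. b i (n i)) * pure (\<lambda>i\<in>K. p i (n i)) \<psi>)"
        unfolding pure_tensor_def on_set_in[OF True]
        using True by (intro sum.cong prod.cong arg_cong2[where f="(*)"] refl) (auto simp: on_set_def)
      finally show ?thesis by (simp only: sum_fun_apply scaleC_fun_apply)
    next
      case False
      then show ?thesis
        using sep_outside[OF v[unfolded tensor_eq_sep] False]
        by (simp add: sum_fun_apply scaleC_fun_apply pure_tensor_def on_set_def)
    qed
  qed
  show ?thesis
    unfolding interp_def
  proof (intro conjI ballI allI impI)
    show "finite (Pi\<^sub>E K N)" using K I(3) by (simp add: finite_PiE)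
    show "f x = (\<Sum>n\<in>Pi\<^sub>E K N. f (pure (\<lambda>i\<in>K. p i (n i))) * on_set V (\<lambda>v. v (\<lambda>i\<in>K. b i (n i))) x)"
      if f: "f \<in> dual V" for f x
    proof (cases "x \<in> V")
      case True
      have "f x = f (\<Sum>n\<in>Pi\<^sub>E K N. x (\<lambda>i\<in>K. b i (n i)) *\<^sub>C pure (\<lambda>i\<in>K. p i (n i)))"
        by (rule arg_cong[OF v[OF True]])
      also have "\<dots> = (\<Sum>n\<in>Pi\<^sub>E K N. x (\<lambda>i\<in>K. b i (n i)) *\<^sub>C f (pure (\<lambda>i\<in>K. p i (n i))))"
        by (rule lin_on_sum_scale[OF V dual_lin[OF f] pn])
      finally show ?thesis using True by (simp add: on_set_def scaleC_complex_def mult.commute)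
    qed (simp add: on_set_def dual_outside[OF f])
  qed (simp_all add: subspace_dual V dual_outside pn bn)
qed

definition zip3 :: "('i \<Rightarrow> 'v) \<Rightarrow> ('i \<Rightarrow> 'v) \<Rightarrow> ('i \<Rightarrow> 'v) \<Rightarrow> 'i \<Rightarrow> 'v \<times> 'v \<times> 'v" where
  "zip3 x y z = (\<lambda>i\<in>K. (x i, y i, z i))"

definition pure3 :: "('i \<Rightarrow> 'v \<times> 'v \<times> 'v) \<Rightarrow> (('i \<Rightarrow> 'v \<Rightarrow> complex) \<Rightarrow> complex) \<times> (('i \<Rightarrow> 'v \<Rightarrow> complex) \<Rightarrow> complex) \<times> (('i \<Rightarrow> 'v \<Rightarrow> complex) \<Rightarrow> complex)" where
  "pure3 X = (pure (\<lambda>i. fst (X i)), pure (\<lambda>i. fst (snd (X i))), pure (\<lambda>i. snd (snd (X i))))"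

definition res :: "((('i \<Rightarrow> 'v \<Rightarrow> complex) \<Rightarrow> complex) \<times> (('i \<Rightarrow> 'v \<Rightarrow> complex) \<Rightarrow> complex) \<times> (('i \<Rightarrow> 'v \<Rightarrow> complex) \<Rightarrow> complex) \<Rightarrow> complex)
    \<Rightarrow> ('i \<Rightarrow> 'v \<times> 'v \<times> 'v) \<Rightarrow> complex" where
  "res f = on_set (Pi\<^sub>E K (cubes A)) (\<lambda>X. f (pure3 X))"

lemma zip3_PiE: "zip3 x y z \<in> Pi\<^sub>E K (cubes A) \<longleftrightarrow> (\<forall>i\<in>K. x i \<in> A i \<and> y i \<in> A i \<and> z i \<in> A i)"
  by (auto simp: zip3_def cube_def PiE_iff)

lemma pure3_zip3: "pure3 (zip3 x y z) = (pure x, pure y, pure z)"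
  unfolding pure3_def by (auto simp: zip3_def intro!: pure_cong)

lemma PiE_zip3: "X \<in> Pi\<^sub>E K (cubes A) \<Longrightarrow> X = zip3 (\<lambda>i. fst (X i)) (\<lambda>i. fst (snd (X i))) (\<lambda>i. snd (snd (X i)))"
  by (auto simp: zip3_def PiE_iff extensional_def fun_eq_iff)

lemma pure3_pm: "pure3 (\<lambda>i\<in>K. pm s (X i)) = pm s (pure3 X)"
proof -
  have "pure3 (\<lambda>i\<in>K. pm s (X i)) = (pure (\<lambda>i. fst (pm s (X i))), pure (\<lambda>i. fst (snd (pm s (X i)))), pure (\<lambda>i. snd (snd (pm s (X i)))))"
    unfolding pure3_def by (auto intro!: pure_cong)
  also have "\<dots> = pm s (pure3 X)"
    by (simp add: pure3_def pm_def case_prod_unfold)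
  finally show ?thesis .
qed

lemma pure3_cube:
  assumes "X \<in> Pi\<^sub>E K (cubes A)"
  shows "pure3 X \<in> cube V"
proof -
  have "fst (X i) \<in> A i \<and> fst (snd (X i)) \<in> A i \<and> snd (snd (X i)) \<in> A i" if "i \<in> K" for i
    using PiE_mem[OF assms that] by (auto simp: cube_def)
  then show ?thesis by (auto simp: pure3_def cube_def intro!: pure_in)
qed

lemma res_trilinears:
  assumes f: "f \<in> tri V"
  shows "res f \<in> trilinears"
  unfolding sep_def
proof (intro CollectI conjI ballI allI impI)
  fix X i assume X: "X \<in> Pi\<^sub>E K (cubes A)" and i: "i \<in> K"
  let ?x = "\<lambda>i. fst (X i)" and ?y = "\<lambda>i. fst (snd (X i))" and ?z = "\<lambda>i. snd (snd (X i))"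
  have mem: "?x j \<in> A j" "?y j \<in> A j" "?z j \<in> A j" if "j \<in> K" for j
    using PiE_mem[OF X that] by (auto simp: cube_def)
  have pV: "pure (?x(i := u)) \<in> V" "pure (?y(i := u)) \<in> V" "pure (?z(i := u)) \<in> V" if "u \<in> A i" for u
    using that mem by (auto intro!: pure_in)
  have e: "res f (X(i := (x, y, z))) = f (pure (?x(i := x)), pure (?y(i := y)), pure (?z(i := z)))"
    if "x \<in> A i" "y \<in> A i" "z \<in> A i" for x y z
  proof -
    have "(x, y, z) \<in> cube (A i)" using that by (simp add: cube_def)
    moreover have "pure3 (X(i := (x, y, z))) = (pure (?x(i := x)), pure (?y(i := y)), pure (?z(i := z)))"
      unfolding pure3_def by (auto intro!: pure_cong)
    ultimately show ?thesis
      unfolding res_def using on_set_in[OF PiE_updD[OF X i]] by simp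
  qed
  have c: "lin_on (A i) g" if "lin_on (A i) h" "\<And>u. u \<in> A i \<Longrightarrow> g u = h u" for g h :: "'v \<Rightarrow> complex"
    using that cvs.subspace_add[OF A[OF i]] cvs.subspace_scale[OF A[OF i]] by (simp add: lin_on_def)
  show "(\<lambda>t. res f (X(i := t))) \<in> tri (A i)"
    unfolding tri_def
  proof (intro CollectI conjI allI ballI impI)
    fix t assume "t \<notin> cube (A i)"
    then have "X(i := t) \<notin> Pi\<^sub>E K (cubes A)" using i by (metis PiE_mem fun_upd_same)
    then show "res f (X(i := t)) = 0" by (simp add: res_def on_set_def)
  next
    fix x y assume xy: "x \<in> A i" "y \<in> A i"
    show "lin_on (A i) (\<lambda>u. res f (X(i := (u, x, y))))"
      by (rule c[OF lin_on_comp[OF lin_on_pure[OF i] pV(1) triD(2)[OF f pV(2)[OF xy(1)] pV(3)[OF xy(2)]]]])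
        (use e xy in auto)
    show "lin_on (A i) (\<lambda>u. res f (X(i := (x, u, y))))"
      by (rule c[OF lin_on_comp[OF lin_on_pure[OF i] pV(2) triD(3)[OF f pV(1)[OF xy(1)] pV(3)[OF xy(2)]]]])
        (use e xy in auto)
    show "lin_on (A i) (\<lambda>u. res f (X(i := (x, y, u))))"
      by (rule c[OF lin_on_comp[OF lin_on_pure[OF i] pV(3) triD(4)[OF f pV(1)[OF xy(1)] pV(2)[OF xy(2)]]]])
        (use e xy in auto)
  qed
qed (simp add: res_def on_set_def)

text \<open>With two of the three families of vectors fixed, the rest is a multilinear function of
  one vector in each factor, to which the expansion over the grid applies.\<close>

lemma trilinear_slice:
  assumes T: "T \<in> trilinears" and y: "\<And>i. i \<in> K \<Longrightarrow> y i \<in> A i" and z: "\<And>i. i \<in> K \<Longrightarrow> z i \<in> A i"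
  shows "on_set (Pi\<^sub>E K A) (\<lambda>x. T (zip3 x y z)) \<in> sep K A (\<lambda>i. dual (A i))"
    "on_set (Pi\<^sub>E K A) (\<lambda>x. T (zip3 y x z)) \<in> sep K A (\<lambda>i. dual (A i))"
    "on_set (Pi\<^sub>E K A) (\<lambda>x. T (zip3 y z x)) \<in> sep K A (\<lambda>i. dual (A i))"
proof -
  \<comment> \<open>\<open>Z\<close> inserts the free vectors next to the two fixed families and
    \<open>t\<close> does so in a single factor; abstracting from them treats the three positions at
    once.\<close>
  have main: "on_set (Pi\<^sub>E K A) (\<lambda>x. T (Z x)) \<in> sep K A (\<lambda>i. dual (A i))"
    if Z: "\<And>x. x \<in> Pi\<^sub>E K A \<Longrightarrow> Z x \<in> Pi\<^sub>E K (cubes A)" "\<And>x i u. i \<in> K \<Longrightarrow> Z (x(i := u)) = (Z x)(i := t i u)"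
      and t: "\<And>f i. i \<in> K \<Longrightarrow> f \<in> tri (A i) \<Longrightarrow> lin_on (A i) (\<lambda>u. f (t i u))" for Z t
    unfolding sep_def
  proof (intro CollectI conjI ballI allI impI)
    fix x i assume x: "x \<in> Pi\<^sub>E K A" and i: "i \<in> K"
    have "(\<lambda>u. on_set (Pi\<^sub>E K A) (\<lambda>x. T (Z x)) (x(i := u))) = on_set (A i) (\<lambda>u. T ((Z x)(i := t i u)))"
    proof
      fix u
      show "on_set (Pi\<^sub>E K A) (\<lambda>x. T (Z x)) (x(i := u)) = on_set (A i) (\<lambda>u. T ((Z x)(i := t i u))) u"
      proof (cases "u \<in> A i")
        case True
        show ?thesis unfolding on_set_in[OF True] on_set_in[OF PiE_updD[OF x i True]] Z(2)[OF i] ..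
      next
        case False
        then have "x(i := u) \<notin> Pi\<^sub>E K A" using i by (metis PiE_mem fun_upd_same)
        then show ?thesis using False by (simp add: on_set_def)
      qed
    qed
    also have "\<dots> \<in> dual (A i)"
      by (rule on_set_dual[OF A[OF i] t[OF i sepD[OF T Z(1)[OF x] i]]])
    finally show "(\<lambda>u. on_set (Pi\<^sub>E K A) (\<lambda>x. T (Z x)) (x(i := u))) \<in> dual (A i)" .
  qed (simp add: on_set_def)
  show "on_set (Pi\<^sub>E K A) (\<lambda>x. T (zip3 x y z)) \<in> sep K A (\<lambda>i. dual (A i))"
    by (rule main[of _ "\<lambda>i u. (u, y i, z i)"]) (use y z in \<open>auto simp: zip3_PiE zip3_def cube_def intro!: triD(2)\<close>)
  show "on_set (Pi\<^sub>E K A) (\<lambda>x. T (zip3 y x z)) \<in> sep K A (\<lambda>i. dual (A i))"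
    by (rule main[of _ "\<lambda>i u. (y i, u, z i)"]) (use y z in \<open>auto simp: zip3_PiE zip3_def cube_def intro!: triD(3)\<close>)
  show "on_set (Pi\<^sub>E K A) (\<lambda>x. T (zip3 y z x)) \<in> sep K A (\<lambda>i. dual (A i))"
    by (rule main[of _ "\<lambda>i u. (y i, z i, u)"]) (use y z in \<open>auto simp: zip3_PiE zip3_def cube_def intro!: triD(4)\<close>)
qed

abbreviation grid :: "('i \<Rightarrow> 'v) \<Rightarrow> 'i \<Rightarrow> 'v" where
  "grid n \<equiv> \<lambda>i\<in>K. p i (n i)"

abbreviation coord :: "('i \<Rightarrow> 'v) \<Rightarrow> ('i \<Rightarrow> 'v) \<Rightarrow> complex" where
  "coord n x \<equiv> \<Prod>i\<in>K. b i (n i) (x i)"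

lemma grid_PiE: "n \<in> Pi\<^sub>E K N \<Longrightarrow> grid n \<in> Pi\<^sub>E K A"
  using interpD(4)[OF ip] by (auto simp: PiE_iff)

lemma trilinear_expand:
  assumes T: "T \<in> trilinears" and x: "x \<in> Pi\<^sub>E K A" and y: "y \<in> Pi\<^sub>E K A" and z: "z \<in> Pi\<^sub>E K A"
  shows "T (zip3 x y z) = (\<Sum>(n, m, l)\<in>Pi\<^sub>E K N \<times> Pi\<^sub>E K N \<times> Pi\<^sub>E K N.
    T (zip3 (grid n) (grid m) (grid l)) * (coord n x * (coord m y * coord l z)))"
proof -
  have e: "U x = (\<Sum>n\<in>Pi\<^sub>E K N. U (grid n) * coord n x)"
    if "on_set (Pi\<^sub>E K A) U \<in> sep K A (\<lambda>i. dual (A i))" "x \<in> Pi\<^sub>E K A" for U x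
    using sep_expand[OF K that ip] that(2) grid_PiE by (simp add: on_set_in)
  have "T (zip3 x y z) = (\<Sum>n\<in>Pi\<^sub>E K N. T (zip3 (grid n) y z) * coord n x)"
    using y z by (intro e[OF trilinear_slice(1)[OF T]] x) auto
  also have "\<dots> = (\<Sum>n\<in>Pi\<^sub>E K N. (\<Sum>m\<in>Pi\<^sub>E K N. T (zip3 (grid n) (grid m) z) * coord m y) * coord n x)"
    using grid_PiE z by (intro sum.cong refl arg_cong2[where f="(*)"] e[OF trilinear_slice(2)[OF T]] y) auto
  also have "\<dots> = (\<Sum>n\<in>Pi\<^sub>E K N. (\<Sum>m\<in>Pi\<^sub>E K N. (\<Sum>l\<in>Pi\<^sub>E K N. T (zip3 (grid n) (grid m) (grid l)) * coord l z) * coord m y) * coord n x)"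
    using grid_PiE by (intro sum.cong refl arg_cong2[where f="(*)"] e[OF trilinear_slice(3)[OF T]] z) auto
  also have "\<dots> = (\<Sum>n\<in>Pi\<^sub>E K N. \<Sum>m\<in>Pi\<^sub>E K N. \<Sum>l\<in>Pi\<^sub>E K N. T (zip3 (grid n) (grid m) (grid l)) * (coord n x * (coord m y * coord l z)))"
    by (simp only: sum_distrib_left sum_distrib_right mult_ac)
  finally show ?thesis by (simp add: sum.cartesian_product case_prod_unfold)
qed

lemma coord_pure:
  assumes "n \<in> Pi\<^sub>E K N" "x \<in> Pi\<^sub>E K A"
  shows "on_set V (\<lambda>v. v (\<lambda>i\<in>K. b i (n i))) (pure x) = coord n x"
proof -
  have "pure x \<in> V" using assms by (intro pure_in) auto
  moreover have "(\<lambda>i\<in>K. b i (n i)) \<in> Pi\<^sub>E K (\<lambda>i. dual (A i))"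
    using assms interpD(5)[OF ip] by (auto simp: PiE_iff)
  ultimately show ?thesis by (simp add: on_set_in pure_tensor_def)
qed

text \<open>A trilinear form on \<open>V\<close> is determined by its values on pure tensors of grid
  vectors. Conversely, the form with the values of \<open>T\<close> at these triples restricts to
  \<open>T\<close>, by \<open>coord_pure\<close> and \<open>trilinear_expand\<close>.\<close>

lemma res_bij: "bij_betw res (tri V) trilinears"
  unfolding bij_betw_def
proof (intro conjI inj_onI equalityI subsetI)
  fix f g assume f: "f \<in> tri V" and g: "g \<in> tri V" and eq: "res f = res g"
  let ?M = "Pi\<^sub>E K N"
  have h: "f (pure (grid n), pure (grid m), pure (grid l)) = g (pure (grid n), pure (grid m), pure (grid l))"
    if "n \<in> ?M" "m \<in> ?M" "l \<in> ?M" for n m l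
  proof -
    have "zip3 (grid n) (grid m) (grid l) \<in> Pi\<^sub>E K (cubes A)"
      using that interpD(4)[OF ip] by (simp add: zip3_PiE PiE_mem)
    then show ?thesis using fun_cong[OF eq, of "zip3 (grid n) (grid m) (grid l)"]
      by (simp add: res_def on_set_in pure3_zip3)
  qed
  note I = interpD(6)[OF interp_tri[OF interp_V]]
  show "f = g"
  proof
    fix t show "f t = g t"
      unfolding I[OF f, of t] I[OF g, of t] using h by (intro sum.cong refl) auto
  qed
next
  fix T assume T: "T \<in> trilinears"
  let ?M = "Pi\<^sub>E K N" and ?b = "\<lambda>n. on_set V (\<lambda>v. v (\<lambda>i\<in>K. b i (n i)))"
  let ?T = "\<lambda>(n, m, l). T (zip3 (grid n) (grid m) (grid l))"
  let ?B = "\<lambda>(n, m, l). \<lambda>(x, y, z). ?b n x * (?b m y * ?b l z)"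
  define f where "f = (\<Sum>n\<in>?M \<times> ?M \<times> ?M. ?T n *\<^sub>C ?B n)"
  have f: "f \<in> tri V"
    unfolding f_def by (intro cvs.subspace_sum cvs.subspace_scale subspace_tri interpD(5)[OF interp_tri[OF interp_V]])
  have "res f X = T X" for X
  proof (cases "X \<in> Pi\<^sub>E K (cubes A)")
    case True
    let ?x = "\<lambda>i\<in>K. fst (X i)" and ?y = "\<lambda>i\<in>K. fst (snd (X i))" and ?z = "\<lambda>i\<in>K. snd (snd (X i))"
    have X: "X = zip3 ?x ?y ?z" by (rule trans[OF PiE_zip3[OF True]]) (auto simp: zip3_def)
    have m: "?x \<in> Pi\<^sub>E K A" "?y \<in> Pi\<^sub>E K A" "?z \<in> Pi\<^sub>E K A"
      using True by (auto simp: PiE_iff cube_def)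
    have "res f X = f (pure ?x, pure ?y, pure ?z)"
      unfolding res_def on_set_in[OF True] by (subst X) (simp only: pure3_zip3)
    also have "\<dots> = (\<Sum>n\<in>?M \<times> ?M \<times> ?M. ?T n * ?B n (pure ?x, pure ?y, pure ?z))"
      unfolding f_def sum_fun_apply scaleC_fun_apply ..
    also have "\<dots> = (\<Sum>(n, m, l)\<in>?M \<times> ?M \<times> ?M. T (zip3 (grid n) (grid m) (grid l)) * (coord n ?x * (coord m ?y * coord l ?z)))"
      by (intro sum.cong refl) (clarify, simp only: prod.case coord_pure m)
    also have "\<dots> = T (zip3 ?x ?y ?z)" by (rule trilinear_expand[OF T m, symmetric])
    finally show ?thesis using X by simp
  next
    case False
    then show ?thesis using sep_outside[OF T False] by (simp add: res_def on_set_def)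
  qed
  then show "T \<in> res ` tri V" using f by (metis ext image_eqI)
qed (use res_trilinears in blast)

end

section \<open>Equivalence of representations\<close>

lemma GL_simps:
  "carrier (GL W) = {g \<in> Bij W. lin_on W g}" "\<one>\<^bsub>GL W\<^esub> = (\<lambda>x\<in>W. x)"
  "g \<in> carrier (GL W) \<Longrightarrow> h \<in> carrier (GL W) \<Longrightarrow> g \<otimes>\<^bsub>GL W\<^esub> h = compose W g h"
  by (simp_all add: GL_def BijGroup_def)

lemma GL_D:
  assumes "g \<in> carrier (GL W)"
  shows "bij_betw g W W" "lin_on W g" "g \<in> extensional W" "x \<in> W \<Longrightarrow> g x \<in> W"
    "x \<in> W \<Longrightarrow> inv_into W g x \<in> W" "x \<in> W \<Longrightarrow> g (inv_into W g x) = x" "x \<in> W \<Longrightarrow> inv_into W g (g x) = x"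
proof -
  show b: "bij_betw g W W" and "lin_on W g" "g \<in> extensional W" using assms by (auto simp: GL_simps Bij_def)
  show "x \<in> W \<Longrightarrow> g x \<in> W" "x \<in> W \<Longrightarrow> inv_into W g x \<in> W" "x \<in> W \<Longrightarrow> g (inv_into W g x) = x" "x \<in> W \<Longrightarrow> inv_into W g (g x) = x"
    using b bij_betw_inv_into_right[OF b] bij_betw_inv_into_left[OF b]
    by (auto simp: bij_betw_def intro: inv_into_into)
qed

lemma group_GL:
  assumes W: "cvs.subspace W"
  shows "Group.group (GL W)"
proof -
  have "subgroup {g \<in> Bij W. lin_on W g} (BijGroup W)"
  proof (rule group.subgroupI[OF group_BijGroup])
    show "{g \<in> Bij W. lin_on W g} \<subseteq> carrier (BijGroup W)" by (auto simp: BijGroup_def)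
    have "(\<lambda>x\<in>W. x) \<in> {g \<in> Bij W. lin_on W g}"
      using W by (simp add: id_Bij lin_on_def cvs.subspace_def)
    then show "{g \<in> Bij W. lin_on W g} \<noteq> {}" by blast
    fix g assume g: "g \<in> {g \<in> Bij W. lin_on W g}"
    then have b: "bij_betw g W W" by (simp add: Bij_def)
    have "lin_on W (\<lambda>x\<in>W. inv_into W g x)"
      using lin_on_inv_into[OF W _ b] g W by (auto simp: lin_on_def cvs.subspace_def)
    then show "inv\<^bsub>BijGroup W\<^esub> g \<in> {g \<in> Bij W. lin_on W g}"
      using g by (simp add: inv_BijGroup restrict_inv_into_Bij)
    fix h assume h: "h \<in> {g \<in> Bij W. lin_on W g}"
    then have "\<And>x. x \<in> W \<Longrightarrow> h x \<in> W" using Bij_imp_funcset by blast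
    then have "lin_on W (compose W g h)"
      using g h W by (auto simp: lin_on_def compose_def cvs.subspace_def)
    then show "g \<otimes>\<^bsub>BijGroup W\<^esub> h \<in> {g \<in> Bij W. lin_on W g}"
      using g h by (simp add: BijGroup_def compose_Bij)
  qed
  from group.subgroup_imp_group[OF group_BijGroup this] show ?thesis by (simp add: GL_def)
qed

text \<open>The inverse group element supplies the inverse of each operator. Extensionality is
  demanded because the members of \<open>GL\<close> are undefined outside the space.\<close>

lemma is_repI:
  assumes G: "Group.group G" and W: "cvs.subspace (vspace R)"
    and ext: "\<And>g. g \<in> carrier G \<Longrightarrow> act R g \<in> extensional (vspace R)"
    and closed: "\<And>g m. g \<in> carrier G \<Longrightarrow> m \<in> vspace R \<Longrightarrow> act R g m \<in> vspace R"
    and lin: "\<And>g. g \<in> carrier G \<Longrightarrow> lin_on (vspace R) (act R g)"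
    and mult: "\<And>g h m. g \<in> carrier G \<Longrightarrow> h \<in> carrier G \<Longrightarrow> m \<in> vspace R \<Longrightarrow> act R (g \<otimes>\<^bsub>G\<^esub> h) m = act R g (act R h m)"
    and one: "\<And>m. m \<in> vspace R \<Longrightarrow> act R \<one>\<^bsub>G\<^esub> m = m"
  shows "is_rep G R"
proof -
  have c: "act R g \<in> carrier (GL (vspace R))" if g: "g \<in> carrier G" for g
  proof -
    have g': "inv\<^bsub>G\<^esub> g \<in> carrier G" using G g by (rule group.inv_closed)
    have "act R (inv\<^bsub>G\<^esub> g) (act R g m) = m" "act R g (act R (inv\<^bsub>G\<^esub> g) m) = m" if "m \<in> vspace R" for m
      using mult[OF g' g that] mult[OF g g' that] one[OF that] G g by (simp_all add: group.l_inv group.r_inv)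
    then have "bij_betw (act R g) (vspace R) (vspace R)"
      using closed[OF g] closed[OF g'] by (intro bij_betw_byWitness[of _ "act R (inv\<^bsub>G\<^esub> g)"]) auto
    then show ?thesis using ext[OF g] lin[OF g] by (simp add: GL_simps Bij_def)
  qed
  have "act R \<in> hom G (GL (vspace R))"
  proof (rule homI[OF c])
    fix g h assume g: "g \<in> carrier G" and h: "h \<in> carrier G"
    have gh: "g \<otimes>\<^bsub>G\<^esub> h \<in> carrier G" using G g h by (simp add: group.is_monoid monoid.m_closed)
    have "act R (g \<otimes>\<^bsub>G\<^esub> h) = compose (vspace R) (act R g) (act R h)"
      using ext[OF gh] mult[OF g h] by (intro extensionalityI[of _ "vspace R"]) (auto simp: compose_def)
    then show "act R (g \<otimes>\<^bsub>G\<^esub> h) = act R g \<otimes>\<^bsub>GL (vspace R)\<^esub> act R h"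
      using c[OF g] c[OF h] by (simp add: GL_simps(3))
  qed simp
  then show ?thesis
    using G W group_GL[OF W] by (simp add: is_rep_def group_hom_def group_hom_axioms_def)
qed

lemma is_repD:
  assumes "is_rep G R"
  shows "Group.group G" "cvs.subspace (vspace R)"
    "g \<in> carrier G \<Longrightarrow> act R g \<in> carrier (GL (vspace R))"
    "g \<in> carrier G \<Longrightarrow> m \<in> vspace R \<Longrightarrow> act R g m \<in> vspace R"
    "g \<in> carrier G \<Longrightarrow> lin_on (vspace R) (act R g)"
    "g \<in> carrier G \<Longrightarrow> h \<in> carrier G \<Longrightarrow> m \<in> vspace R \<Longrightarrow> act R (g \<otimes>\<^bsub>G\<^esub> h) m = act R g (act R h m)"
    "m \<in> vspace R \<Longrightarrow> act R \<one>\<^bsub>G\<^esub> m = m"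
proof -
  have h: "group_hom G (GL (vspace R)) (act R)" and W: "cvs.subspace (vspace R)" using assms by (auto simp: is_rep_def)
  show "Group.group G" using h by (simp add: group_hom_def)
  show "cvs.subspace (vspace R)" by (rule W)
  show c: "g \<in> carrier G \<Longrightarrow> act R g \<in> carrier (GL (vspace R))" for g using group_hom.hom_closed[OF h] .
  show "g \<in> carrier G \<Longrightarrow> m \<in> vspace R \<Longrightarrow> act R g m \<in> vspace R" using GL_D(4)[OF c] .
  show "g \<in> carrier G \<Longrightarrow> lin_on (vspace R) (act R g)" using GL_D(2)[OF c] .
  show "g \<in> carrier G \<Longrightarrow> h \<in> carrier G \<Longrightarrow> m \<in> vspace R \<Longrightarrow> act R (g \<otimes>\<^bsub>G\<^esub> h) m = act R g (act R h m)"
    using group_hom.hom_mult[OF h, of g h] GL_simps(3)[OF c c, of g h] by (simp add: compose_def)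
  show "m \<in> vspace R \<Longrightarrow> act R \<one>\<^bsub>G\<^esub> m = m"
    using group_hom.hom_one[OF h] by (simp add: GL_simps)
qed

text \<open>Weaker than \<open>rep_iso\<close>: of the operators on \<open>R\<close> it asks only
  that they preserve the space. The homomorphism law can then be verified for one module in a chain
  and carried along by \<open>requiv_is_rep\<close>.\<close>

definition requiv :: "'g monoid \<Rightarrow> ('g, 'm::complex_vector) linrep \<Rightarrow> ('g, 'n::complex_vector) linrep \<Rightarrow> bool" where
  "requiv G R S \<longleftrightarrow> cvs.subspace (vspace R) \<and> (\<forall>g\<in>carrier G. \<forall>m\<in>vspace R. act R g m \<in> vspace R) \<and>
     (\<exists>\<Phi>. lin_on (vspace R) \<Phi> \<and> bij_betw \<Phi> (vspace R) (vspace S) \<and>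
        (\<forall>g\<in>carrier G. \<forall>m\<in>vspace R. \<Phi> (act R g m) = act S g (\<Phi> m)))"

lemma requivI:
  assumes "cvs.subspace (vspace R)" "\<And>g m. g \<in> carrier G \<Longrightarrow> m \<in> vspace R \<Longrightarrow> act R g m \<in> vspace R"
    "lin_on (vspace R) \<Phi>" "bij_betw \<Phi> (vspace R) (vspace S)"
    "\<And>g m. g \<in> carrier G \<Longrightarrow> m \<in> vspace R \<Longrightarrow> \<Phi> (act R g m) = act S g (\<Phi> m)"
  shows "requiv G R S"
  using assms unfolding requiv_def by blast

lemma requivE:
  assumes "requiv G R S"
  obtains \<Phi> where "cvs.subspace (vspace R)" "\<And>g m. g \<in> carrier G \<Longrightarrow> m \<in> vspace R \<Longrightarrow> act R g m \<in> vspace R"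
    "lin_on (vspace R) \<Phi>" "bij_betw \<Phi> (vspace R) (vspace S)"
    "\<And>g m. g \<in> carrier G \<Longrightarrow> m \<in> vspace R \<Longrightarrow> \<Phi> (act R g m) = act S g (\<Phi> m)"
  using assms unfolding requiv_def by blast

text \<open>The subspace property of \<open>S\<close> and its closure under the operators are
  carried over from \<open>R\<close> by the intertwining bijection.\<close>

lemma requiv_sym:
  assumes "requiv G R S"
  shows "requiv G S R"
proof -
  obtain \<Phi> where R: "cvs.subspace (vspace R)" "\<And>g m. g \<in> carrier G \<Longrightarrow> m \<in> vspace R \<Longrightarrow> act R g m \<in> vspace R"
    and l: "lin_on (vspace R) \<Phi>" and b: "bij_betw \<Phi> (vspace R) (vspace S)"
    and e: "\<And>g m. g \<in> carrier G \<Longrightarrow> m \<in> vspace R \<Longrightarrow> \<Phi> (act R g m) = act S g (\<Phi> m)"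
    by (rule requivE[OF assms]) (rule that)
  have im: "\<Phi> ` vspace R = vspace S" using b by (rule bij_betw_imp_surj_on)
  let ?\<Psi> = "inv_into (vspace R) \<Phi>"
  have i: "?\<Psi> n \<in> vspace R" "\<Phi> (?\<Psi> n) = n" if "n \<in> vspace S" for n
    using that inv_into_into[of n \<Phi> "vspace R"] f_inv_into_f[of n \<Phi> "vspace R"] by (simp_all add: im)
  show ?thesis
  proof (rule requivI)
    show "cvs.subspace (vspace S)" using lin_on_image_subspace[OF R(1) l] im by simp
    show "lin_on (vspace S) ?\<Psi>" by (rule lin_on_inv_into[OF R(1) l b])
    show "bij_betw ?\<Psi> (vspace S) (vspace R)" by (rule bij_betw_inv_into[OF b])
    fix g n assume g: "g \<in> carrier G" and n: "n \<in> vspace S"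
    have a: "act S g n = \<Phi> (act R g (?\<Psi> n))" using e[OF g i(1)[OF n]] i(2)[OF n] by simp
    then show "act S g n \<in> vspace S" using R(2)[OF g i(1)[OF n]] im by auto
    show "?\<Psi> (act S g n) = act R g (?\<Psi> n)"
      unfolding a by (rule bij_betw_inv_into_left[OF b R(2)[OF g i(1)[OF n]]])
  qed
qed

lemma requiv_trans:
  assumes "requiv G R S" "requiv G S T"
  shows "requiv G R T"
proof -
  obtain \<Phi> where R: "cvs.subspace (vspace R)" "\<And>g m. g \<in> carrier G \<Longrightarrow> m \<in> vspace R \<Longrightarrow> act R g m \<in> vspace R"
    and l: "lin_on (vspace R) \<Phi>" and b: "bij_betw \<Phi> (vspace R) (vspace S)"
    and e: "\<And>g m. g \<in> carrier G \<Longrightarrow> m \<in> vspace R \<Longrightarrow> \<Phi> (act R g m) = act S g (\<Phi> m)"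
    by (rule requivE[OF assms(1)]) (rule that)
  obtain \<Psi> where "cvs.subspace (vspace S)" "\<And>g m. g \<in> carrier G \<Longrightarrow> m \<in> vspace S \<Longrightarrow> act S g m \<in> vspace S"
    and l': "lin_on (vspace S) \<Psi>" and b': "bij_betw \<Psi> (vspace S) (vspace T)"
    and e': "\<And>g m. g \<in> carrier G \<Longrightarrow> m \<in> vspace S \<Longrightarrow> \<Psi> (act S g m) = act T g (\<Psi> m)"
    by (rule requivE[OF assms(2)]) (rule that)
  have S: "\<Phi> m \<in> vspace S" if "m \<in> vspace R" for m using b that by (auto simp: bij_betw_def)
  show ?thesis
  proof (rule requivI[OF R])
    show "lin_on (vspace R) (\<Psi> \<circ> \<Phi>)" using l l' S by (simp add: lin_on_def)
    show "bij_betw (\<Psi> \<circ> \<Phi>) (vspace R) (vspace T)" by (rule bij_betw_trans[OF b b'])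
    show "(\<Psi> \<circ> \<Phi>) (act R g m) = act T g ((\<Psi> \<circ> \<Phi>) m)" if "g \<in> carrier G" "m \<in> vspace R" for g m
      using that by (simp add: e e' S)
  qed
qed

text \<open>Linearity and the group laws hold after applying the injective intertwiner, hence
  before. The values of \<open>act S g\<close> off \<open>vspace S\<close> are invisible to it,
  which explains the separate condition on extensionality.\<close>

lemma requiv_is_rep:
  assumes R: "is_rep G R" and eq: "requiv G R S" and ext: "\<And>g. g \<in> carrier G \<Longrightarrow> act S g \<in> extensional (vspace S)"
  shows "is_rep G S"
proof -
  obtain \<Phi> where S: "cvs.subspace (vspace S)" "\<And>g m. g \<in> carrier G \<Longrightarrow> m \<in> vspace S \<Longrightarrow> act S g m \<in> vspace S"
    and l: "lin_on (vspace S) \<Phi>" and b: "bij_betw \<Phi> (vspace S) (vspace R)"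
    and e: "\<And>g m. g \<in> carrier G \<Longrightarrow> m \<in> vspace S \<Longrightarrow> \<Phi> (act S g m) = act R g (\<Phi> m)"
    by (rule requivE[OF requiv_sym[OF eq]]) (rule that)
  note D = is_repD[OF R]
  have \<Phi>: "\<Phi> m \<in> vspace R" if "m \<in> vspace S" for m using b that by (auto simp: bij_betw_def)
  have inj: "x = y" if "x \<in> vspace S" "y \<in> vspace S" "\<Phi> x = \<Phi> y" for x y
    using b that by (auto simp: bij_betw_def inj_on_def)
  have m: "g \<otimes>\<^bsub>G\<^esub> h \<in> carrier G" "\<one>\<^bsub>G\<^esub> \<in> carrier G" if "g \<in> carrier G" "h \<in> carrier G" for g h
    using D(1) that by (simp_all add: group.is_monoid monoid.m_closed monoid.one_closed)
  have one: "\<one>\<^bsub>G\<^esub> \<in> carrier G" using D(1) by (simp add: group.is_monoid monoid.one_closed)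
  show ?thesis
  proof (rule is_repI[OF D(1) S(1) ext S(2)])
    fix g assume g: "g \<in> carrier G"
    show "lin_on (vspace S) (act S g)"
      unfolding lin_on_def
    proof (intro conjI ballI allI)
      fix x y assume x: "x \<in> vspace S" and y: "y \<in> vspace S"
      have "\<Phi> (act S g (x + y)) = \<Phi> (act S g x + act S g y)"
        using g x y by (simp add: e S cvs.subspace_add[OF S(1)] lin_on_add[OF l] lin_on_add[OF D(5)] \<Phi>)
      then show "act S g (x + y) = act S g x + act S g y"
        using g x y S cvs.subspace_add[OF S(1)] by (intro inj) auto
    next
      fix c x assume x: "x \<in> vspace S"
      have "\<Phi> (act S g (c *\<^sub>C x)) = \<Phi> (c *\<^sub>C act S g x)"
        using g x by (simp add: e S cvs.subspace_scale[OF S(1)] lin_on_scale[OF l] lin_on_scale[OF D(5)] \<Phi>)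
      then show "act S g (c *\<^sub>C x) = c *\<^sub>C act S g x"
        using g x S cvs.subspace_scale[OF S(1)] by (intro inj) auto
    qed
    fix h n assume h: "h \<in> carrier G" and n: "n \<in> vspace S"
    show "act S (g \<otimes>\<^bsub>G\<^esub> h) n = act S g (act S h n)"
      using g h n m S(2) by (intro inj) (simp_all add: e D(6) \<Phi>)
  next
    fix n assume n: "n \<in> vspace S"
    show "act S \<one>\<^bsub>G\<^esub> n = n"
      using n one S(2) by (intro inj) (simp_all add: e D(7) \<Phi>)
  qed
qed

lemma dsum_rep_simps:
  "vspace (dsum_rep X R) = {F. (\<forall>x\<in>X. F x \<in> vspace (R x)) \<and> (\<forall>x. x \<notin> X \<longrightarrow> F x = 0)}"
  "act (dsum_rep X R) g = restrict (\<lambda>F x. if x \<in> X then act (R x) g (F x) else 0) (vspace (dsum_rep X R))"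
  by (simp_all add: dsum_rep_def Let_def)

lemma requiv_dsum:
  assumes "\<And>x. x \<in> X \<Longrightarrow> requiv G (R x) (S x)"
  shows "requiv G (dsum_rep X R) (dsum_rep X S)"
proof -
  have "\<forall>x\<in>X. \<exists>\<Phi>. lin_on (vspace (R x)) \<Phi> \<and> bij_betw \<Phi> (vspace (R x)) (vspace (S x)) \<and>
      (\<forall>g\<in>carrier G. \<forall>m\<in>vspace (R x). \<Phi> (act (R x) g m) = act (S x) g (\<Phi> m))"
    using assms unfolding requiv_def by blast
  then obtain \<Phi> where \<Phi>: "\<forall>x\<in>X. lin_on (vspace (R x)) (\<Phi> x) \<and> bij_betw (\<Phi> x) (vspace (R x)) (vspace (S x)) \<and>
      (\<forall>g\<in>carrier G. \<forall>m\<in>vspace (R x). \<Phi> x (act (R x) g m) = act (S x) g (\<Phi> x m))"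
    by metis
  then have l: "\<And>x. x \<in> X \<Longrightarrow> lin_on (vspace (R x)) (\<Phi> x)" and b: "\<And>x. x \<in> X \<Longrightarrow> bij_betw (\<Phi> x) (vspace (R x)) (vspace (S x))"
    and e: "\<And>x g m. x \<in> X \<Longrightarrow> g \<in> carrier G \<Longrightarrow> m \<in> vspace (R x) \<Longrightarrow> \<Phi> x (act (R x) g m) = act (S x) g (\<Phi> x m)"
    by blast+
  have R: "\<And>x. x \<in> X \<Longrightarrow> cvs.subspace (vspace (R x))"
      "\<And>x g m. x \<in> X \<Longrightarrow> g \<in> carrier G \<Longrightarrow> m \<in> vspace (R x) \<Longrightarrow> act (R x) g m \<in> vspace (R x)"
    using assms unfolding requiv_def by blast+
  have \<Phi>S: "\<And>x m. x \<in> X \<Longrightarrow> m \<in> vspace (R x) \<Longrightarrow> \<Phi> x m \<in> vspace (S x)"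
    using b bij_betwE by blast
  let ?F = "\<lambda>F x. if x \<in> X then \<Phi> x (F x) else 0"
  show ?thesis
  proof (rule requivI)
    show "cvs.subspace (vspace (dsum_rep X R))"
      using R(1) by (simp add: dsum_rep_simps cvs.subspace_def zero_fun_def plus_fun_def scaleC_fun_def)
    show "act (dsum_rep X R) g m \<in> vspace (dsum_rep X R)" if "g \<in> carrier G" "m \<in> vspace (dsum_rep X R)" for g m
      using that R(2) by (simp add: dsum_rep_simps)
    show "lin_on (vspace (dsum_rep X R)) ?F"
      using l by (auto simp: lin_on_def dsum_rep_simps fun_eq_iff scaleC_fun_def)
    show "bij_betw ?F (vspace (dsum_rep X R)) (vspace (dsum_rep X S))"
    proof (rule bij_betw_byWitness)
      let ?G = "\<lambda>F x. if x \<in> X then inv_into (vspace (R x)) (\<Phi> x) (F x) else 0"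
      show "\<forall>F\<in>vspace (dsum_rep X R). ?G (?F F) = F"
        using bij_betw_inv_into_left[OF b] by (auto simp: dsum_rep_simps fun_eq_iff)
      show "\<forall>F\<in>vspace (dsum_rep X S). ?F (?G F) = F"
        using bij_betw_inv_into_right[OF b] by (auto simp: dsum_rep_simps fun_eq_iff)
      show "?F ` vspace (dsum_rep X R) \<subseteq> vspace (dsum_rep X S)"
        using \<Phi>S by (auto simp: dsum_rep_simps)
      show "?G ` vspace (dsum_rep X S) \<subseteq> vspace (dsum_rep X R)"
        using bij_betw_inv_into[OF b, THEN bij_betwE] by (auto simp: dsum_rep_simps)
    qed
    show "?F (act (dsum_rep X R) g m) = act (dsum_rep X S) g (?F m)" if "g \<in> carrier G" "m \<in> vspace (dsum_rep X R)" for g m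
      using that e \<Phi>S by (auto simp: dsum_rep_simps fun_eq_iff)
  qed
qed

lemma requiv_multiple: "requiv G R S \<Longrightarrow> requiv G (multiple_rep m R) (multiple_rep m S)"
  unfolding multiple_rep_def by (rule requiv_dsum)

lemma plus_rep_simps:
  "vspace (plus_rep R S) = vspace R \<times> vspace S"
  "act (plus_rep R S) g = restrict (map_prod (act R g) (act S g)) (vspace R \<times> vspace S)"
  by (simp_all add: plus_rep_def)

lemma requiv_plus:
  assumes "requiv G R R'" "requiv G S S'"
  shows "requiv G (plus_rep R S) (plus_rep R' S')"
proof -
  obtain \<Phi> where R: "cvs.subspace (vspace R)" "\<And>g m. g \<in> carrier G \<Longrightarrow> m \<in> vspace R \<Longrightarrow> act R g m \<in> vspace R"
    and l: "lin_on (vspace R) \<Phi>" and b: "bij_betw \<Phi> (vspace R) (vspace R')"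
    and e: "\<And>g m. g \<in> carrier G \<Longrightarrow> m \<in> vspace R \<Longrightarrow> \<Phi> (act R g m) = act R' g (\<Phi> m)"
    by (rule requivE[OF assms(1)]) (rule that)
  obtain \<Psi> where S: "cvs.subspace (vspace S)" "\<And>g m. g \<in> carrier G \<Longrightarrow> m \<in> vspace S \<Longrightarrow> act S g m \<in> vspace S"
    and l': "lin_on (vspace S) \<Psi>" and b': "bij_betw \<Psi> (vspace S) (vspace S')"
    and e': "\<And>g m. g \<in> carrier G \<Longrightarrow> m \<in> vspace S \<Longrightarrow> \<Psi> (act S g m) = act S' g (\<Psi> m)"
    by (rule requivE[OF assms(2)]) (rule that)
  show ?thesis
  proof (rule requivI)
    show "cvs.subspace (vspace (plus_rep R S))"
      using R(1) S(1) by (auto simp: plus_rep_simps cvs.subspace_def zero_prod_def plus_prod_def scaleC_prod_def)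
    show "act (plus_rep R S) g m \<in> vspace (plus_rep R S)" if "g \<in> carrier G" "m \<in> vspace (plus_rep R S)" for g m
      using that R(2) S(2) by (auto simp: plus_rep_simps)
    show "lin_on (vspace (plus_rep R S)) (map_prod \<Phi> \<Psi>)"
      using l l' by (auto simp: plus_rep_simps lin_on_def plus_prod_def scaleC_prod_def)
    show "bij_betw (map_prod \<Phi> \<Psi>) (vspace (plus_rep R S)) (vspace (plus_rep R' S'))"
      using b b' by (auto simp: plus_rep_simps bij_betw_def map_prod_inj_on map_prod_surj_on)
    show "map_prod \<Phi> \<Psi> (act (plus_rep R S) g m) = act (plus_rep R' S') g (map_prod \<Phi> \<Psi> m)"
      if "g \<in> carrier G" "m \<in> vspace (plus_rep R S)" for g m
      using that e e' bij_betwE[OF b] bij_betwE[OF b'] by (auto simp: plus_rep_simps)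
  qed
qed

section \<open>Cubics vanishing on the secant variety\<close>

lemma fixed_Sy_iff: "f \<in> fixed (proj Sy) S \<longleftrightarrow> f \<in> S \<and> (\<forall>s<6. \<forall>t. f (pm s t) = f t)"
proof -
  have "perm_op (proj Sy) f = f \<longleftrightarrow> (\<forall>s<6. \<forall>t. f (pm s t) = f t)"
  proof
    assume eq: "perm_op (proj Sy) f = f"
    show "\<forall>s<6. \<forall>t. f (pm s t) = f t"
    proof (intro allI impI)
      fix s :: nat and t :: "'a \<times> 'a \<times> 'a" assume s: "s < 6"
      have "perm_op (proj Sy) f (pm s t) = perm_op (proj Sy) f t"
        using less_6_cases[OF s] unfolding perm_op_def sum_less_6 by (cases t; elim disjE; simp)
      then show "f (pm s t) = f t" by (simp add: eq del: proj.simps)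
    qed
  next
    assume h: "\<forall>s<6. \<forall>t. f (pm s t) = f t"
    show "perm_op (proj Sy) f = f"
    proof
      fix t
      have "perm_op (proj Sy) f t = (\<Sum>s<6. proj Sy s * f t)"
        unfolding perm_op_def using h by (intro sum.cong refl) (simp only: lessThan_iff)
      also have "\<dots> = f t" unfolding sum_less_6 by simp
      finally show "perm_op (proj Sy) f t = f t" .
    qed
  qed
  then show ?thesis by (simp add: fixed_def del: proj.simps)
qed

context vs_family
begin

text \<open>What the ideal looks like on pure tensors: symmetry comes from polarisation, and the
  zeros at (x, x, y) are what \<open>ideal_part_iff\<close> extracts from vanishing on secant
  lines.\<close>

definition cub :: "(('i \<Rightarrow> 'v \<times> 'v \<times> 'v) \<Rightarrow> complex) set" where
  "cub = {T \<in> trilinears. (\<forall>s<6. \<forall>X\<in>Pi\<^sub>E K (cubes A). T (\<lambda>i\<in>K. pm s (X i)) = T X) \<and>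
     (\<forall>x\<in>Pi\<^sub>E K A. \<forall>y\<in>Pi\<^sub>E K A. T (zip3 x x y) = 0)}"

lemma polz_bij_V: "bij_betw (polz V) (hom_polys 3 V) (fixed (proj Sy) (tri V))"
  by (rule polz_bij[OF V interp_V])

text \<open>Permuting the arguments commutes with restriction, and injectivity of \<open>res\<close>
  lifts symmetry from pure tensors to all of \<open>V\<close>.\<close>

lemma res_symmetric_iff:
  assumes f: "f \<in> tri V"
  shows "f \<in> fixed (proj Sy) (tri V) \<longleftrightarrow> (\<forall>s<6. \<forall>X\<in>Pi\<^sub>E K (cubes A). res f (\<lambda>i\<in>K. pm s (X i)) = res f X)"
proof -
  have r: "res f (\<lambda>i\<in>K. pm s (X i)) = res (\<lambda>t. f (pm s t)) X" if "X \<in> Pi\<^sub>E K (cubes A)" for s X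
    unfolding res_def on_set_in[OF that] on_set_in[OF PiE_pm[OF that]] pure3_pm ..
  show ?thesis
    unfolding fixed_Sy_iff
  proof (intro iffI conjI f allI impI ballI)
    fix s :: nat and X assume h: "f \<in> tri V \<and> (\<forall>s<6. \<forall>t. f (pm s t) = f t)" "s < 6" "X \<in> Pi\<^sub>E K (cubes A)"
    then have "(\<lambda>t. f (pm s t)) = f" by blast
    then show "res f (\<lambda>i\<in>K. pm s (X i)) = res f X" using r[OF h(3), of s] by simp
  next
    fix s :: nat and t assume h: "\<forall>s<6. \<forall>X\<in>Pi\<^sub>E K (cubes A). res f (\<lambda>i\<in>K. pm s (X i)) = res f X" and s: "s < 6"
    have "res (\<lambda>t. f (pm s t)) X = res f X" for X
      using h s r[of X s] by (cases "X \<in> Pi\<^sub>E K (cubes A)") (auto simp: res_def on_set_def)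
    then have "res (\<lambda>t. f (pm s t)) = res f" by blast
    then have "(\<lambda>t. f (pm s t)) = f"
      using res_bij pm_stableD(2)[OF pm_stable_tri f] f by (auto simp: bij_betw_def dest: inj_onD)
    then show "f (pm s t) = f t" by (rule fun_cong)
  qed
qed

lemma symmetric_cube:
  assumes f: "f \<in> fixed (proj Sy) (tri V)" and v: "v \<in> V" and w: "w \<in> V"
  shows "f (a *\<^sub>C v + c *\<^sub>C w, a *\<^sub>C v + c *\<^sub>C w, a *\<^sub>C v + c *\<^sub>C w) =
    a^3 * f (v, v, v) + 3 * a^2 * c * f (v, v, w) + 3 * a * c^2 * f (w, w, v) + c^3 * f (w, w, w)"
proof -
  have ft: "f \<in> tri V" and s: "\<And>s t. s < 6 \<Longrightarrow> f (pm s t) = f t" using f by (auto simp only: fixed_Sy_iff)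
  let ?u = "a *\<^sub>C v + c *\<^sub>C w"
  have u: "?u \<in> V" and av: "a *\<^sub>C v \<in> V" "c *\<^sub>C w \<in> V" using v w by (auto intro: cvs.subspace_add[OF V] cvs.subspace_scale[OF V])
  have l: "g ?u = a * g v + c * g w" if "lin_on V g" for g :: "_ \<Rightarrow> complex"
    using lin_on_add[OF that av] lin_on_scale[OF that v] lin_on_scale[OF that w] by (simp add: scaleC_complex_def)
  have 1: "f (?u, x, y) = a * f (v, x, y) + c * f (w, x, y)" if "x \<in> V" "y \<in> V" for x y
    by (rule l[OF triD(2)[OF ft that]])
  have 2: "f (x, ?u, y) = a * f (x, v, y) + c * f (x, w, y)" if "x \<in> V" "y \<in> V" for x y
    by (rule l[OF triD(3)[OF ft that]])
  have 3: "f (x, y, ?u) = a * f (x, y, v) + c * f (x, y, w)" if "x \<in> V" "y \<in> V" for x y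
    by (rule l[OF triD(4)[OF ft that]])
  have p: "f (v, w, v) = f (v, v, w)" "f (w, v, v) = f (v, v, w)" "f (w, v, w) = f (w, w, v)" "f (v, w, w) = f (w, w, v)"
    using s[of 4 "(v, v, w)"] s[of 2 "(v, v, w)"] s[of 4 "(w, w, v)"] s[of 2 "(w, w, v)"] by simp_all
  show ?thesis
    using u v w by (simp add: 1 2 3 p algebra_simps power2_eq_square power3_eq_cube)
qed

text \<open>On the line joining two pure tensors a cubic is a binary cubic whose coefficients are,
  up to factors 3, the values of the polarisation at (x,x,x), (x,x,y), (y,y,x) and (y,y,y). Each is
  an instance of the condition, with x and y exchanged or equal.\<close>

lemma ideal_part_iff:
  assumes P: "P \<in> hom_polys 3 V"
  shows "P \<in> ideal_part 3 V (secant_variety V 2 (segre K A)) \<longleftrightarrow>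
     (\<forall>x\<in>Pi\<^sub>E K A. \<forall>y\<in>Pi\<^sub>E K A. polz V P (pure x, pure x, pure y) = 0)"
proof
  let ?f = "polz V P"
  note f = polz_hom_polys(1)[OF V P] and Pf = polz_hom_polys(2)[OF V P]
  have ft: "?f \<in> tri V" using f by (simp add: fixed_def)
  let ?U = "\<Union>x\<in>{..<2::nat} \<rightarrow> segre K A. {l \<in> proj_space V. l \<subseteq> cvs.span (\<Union>s<2. x s)}"
  {
    assume h: "\<forall>x\<in>Pi\<^sub>E K A. \<forall>y\<in>Pi\<^sub>E K A. ?f (pure x, pure x, pure y) = 0"
    have h': "?f (pure x, pure x, pure y) = 0" if "\<And>i. i \<in> K \<Longrightarrow> x i \<in> A i" "\<And>i. i \<in> K \<Longrightarrow> y i \<in> A i" for x y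
    proof -
      have "pure (restrict x K) = pure x" "pure (restrict y K) = pure y" by (auto intro: pure_cong)
      moreover have "restrict x K \<in> Pi\<^sub>E K A" "restrict y K \<in> Pi\<^sub>E K A" using that by auto
      ultimately show ?thesis using h by metis
    qed
    \<comment> \<open>The zero set of \<open>P\<close> alone is closed, so once it contains the
      secant lines it contains their closure.\<close>
    let ?Z = "{l \<in> proj_space V. \<forall>Q\<in>{P}. \<forall>v\<in>l - {0}. Q v = 0}"
    have "zariski_closed V ?Z" unfolding zariski_closed_def using P by (intro exI[of _ "{P}"]) auto
    moreover have "?U \<subseteq> ?Z"
    proof
      fix l assume "l \<in> ?U"
      then obtain x where x: "x \<in> {..<2::nat} \<rightarrow> segre K A" and l: "l \<in> proj_space V" "l \<subseteq> cvs.span (\<Union>s<2. x s)" by blast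
      have "x 0 \<in> segre K A" "x 1 \<in> segre K A" using x by auto
      then obtain a c where a: "\<forall>i\<in>K. a i \<in> A i" "x 0 = cvs.span {pure a}" and c: "\<forall>i\<in>K. c i \<in> A i" "x 1 = cvs.span {pure c}"
        unfolding segre_def by blast
      have pV: "pure a \<in> V" "pure c \<in> V" using a c by (auto intro: pure_in)
      have "(\<Union>s<2. x s) = cvs.span {pure a} \<union> cvs.span {pure c}"
        using a c by (auto simp: lessThan_Suc numeral_2_eq_2)
      also have "\<dots> \<subseteq> cvs.span {pure a, pure c}" using cvs.span_mono[of "{pure a}" "{pure a, pure c}"] cvs.span_mono[of "{pure c}" "{pure a, pure c}"] by blast
      finally have "cvs.span (\<Union>s<2. x s) \<subseteq> cvs.span {pure a, pure c}"
        using cvs.span_minimal cvs.subspace_span by blast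
      then have ls: "l \<subseteq> cvs.span {pure a, pure c}" using l by blast
      have "P v = 0" if "v \<in> l" for v
      proof -
        have "v \<in> cvs.span {pure a, pure c}" using ls that by blast
        then obtain \<alpha> \<beta> where v: "v = \<alpha> *\<^sub>C pure a + \<beta> *\<^sub>C pure c"
          unfolding cvs.span_insert[of "pure a"] cvs.span_singleton by (auto simp: algebra_simps)
        have "v \<in> V" unfolding v using pV by (intro cvs.subspace_add[OF V] cvs.subspace_scale[OF V])
        then have "P v = ?f (v, v, v)" using Pf by simp
        also have "\<dots> = 0" unfolding v symmetric_cube[OF f pV] using h'[of a a] h'[of a c] h'[of c a] h'[of c c] a c by simp
        finally show ?thesis .
      qed
      then show "l \<in> ?Z" using l(1) by simp
    qed
    ultimately have "zariski_closure V ?U \<subseteq> ?Z"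
      unfolding zariski_closure_def by (intro Inter_lower CollectI conjI)
    then have "secant_variety V 2 (segre K A) \<subseteq> ?Z" unfolding secant_variety_def .
    then have "\<forall>l\<in>secant_variety V 2 (segre K A). \<forall>v\<in>l - {0}. P v = 0" by (simp add: subset_eq)
    then show "P \<in> ideal_part 3 V (secant_variety V 2 (segre K A))"
      unfolding ideal_part_def using P by (intro CollectI conjI)
  next
    assume I: "P \<in> ideal_part 3 V (secant_variety V 2 (segre K A))"
    show "\<forall>x\<in>Pi\<^sub>E K A. \<forall>y\<in>Pi\<^sub>E K A. ?f (pure x, pure x, pure y) = 0"
    proof (intro ballI)
      fix x y assume x: "x \<in> Pi\<^sub>E K A" and y: "y \<in> Pi\<^sub>E K A"
      have pV: "pure x \<in> V" "pure y \<in> V" using x y by (auto intro!: pure_in)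
      have zero: "?f (0, v, w) = 0" "?f (v, w, 0) = 0" if "v \<in> V" "w \<in> V" for v w
        using lin_on_zero[OF V triD(2)[OF ft that]] lin_on_zero[OF V triD(4)[OF ft that]] by auto
      show "?f (pure x, pure x, pure y) = 0"
      proof (cases "\<exists>i\<in>K. x i = 0 \<or> y i = 0")
        \<comment> \<open>A zero factor makes the pure tensor 0, which represents no point of the
          Segre variety; the claim is then plain linearity.\<close>
        case True
        then have "pure x = 0 \<or> pure y = 0" using pure_zero by blast
        then show ?thesis using zero pV cvs.subspace_0[OF V] by auto
      next
        case False
        have sub: "?U \<subseteq> secant_variety V 2 (segre K A)"
          unfolding secant_variety_def zariski_closure_def by blast
        have P0: "P v = 0" if v: "v = \<alpha> *\<^sub>C pure x + \<beta> *\<^sub>C pure y" for \<alpha> \<beta> v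
        proof (cases "v = 0")
          case True
          have "0 \<in> V" by (rule cvs.subspace_0[OF V])
          then show ?thesis using Pf[of 0] zero(1)[of 0 0] True by simp
        next
          case nz: False
          have vV: "v \<in> V" unfolding v using pV by (intro cvs.subspace_add[OF V] cvs.subspace_scale[OF V])
          let ?l = "cvs.span {v}" and ?x = "\<lambda>s::nat. if s = 0 then cvs.span {pure x} else cvs.span {pure y}"
          have 1: "?l \<in> proj_space V" using vV nz unfolding proj_space_def by blast
          have "cvs.span {pure w} \<in> segre K A" if "w \<in> Pi\<^sub>E K A" "\<forall>i\<in>K. w i \<noteq> 0" for w
            unfolding segre_def using that by (intro CollectI exI[of _ w]) auto
          then have 2: "?x \<in> {..<2::nat} \<rightarrow> segre K A" using x y False by auto
          have sx: "?x 0 \<union> ?x 1 \<subseteq> (\<Union>s<2. ?x s)" by (intro Un_least UN_upper) auto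
          have "pure x \<in> ?x 0" "pure y \<in> ?x 1" by (auto intro: cvs.span_base)
          then have m: "pure x \<in> (\<Union>s<2. ?x s)" "pure y \<in> (\<Union>s<2. ?x s)" using sx by blast+
          have "v \<in> cvs.span (\<Union>s<2. ?x s)"
            unfolding v by (intro cvs.span_add cvs.span_scale cvs.span_base m)
          then have 3: "?l \<subseteq> cvs.span (\<Union>s<2. ?x s)"
            by (intro cvs.span_minimal cvs.subspace_span) simp
          have "?l \<in> ?U" using 1 2 3 by blast
          then have "?l \<in> secant_variety V 2 (segre K A)" using sub by blast
          moreover have "v \<in> ?l - {0}" using nz by (auto intro: cvs.span_base)
          ultimately show ?thesis using I unfolding ideal_part_def by blast
        qed
        have e: "\<alpha>^3 * ?f (pure x, pure x, pure x) + 3 * \<alpha>^2 * \<beta> * ?f (pure x, pure x, pure y) +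
            3 * \<alpha> * \<beta>^2 * ?f (pure y, pure y, pure x) + \<beta>^3 * ?f (pure y, pure y, pure y) = 0" for \<alpha> \<beta>
        proof -
          have "\<alpha> *\<^sub>C pure x + \<beta> *\<^sub>C pure y \<in> V" using pV by (intro cvs.subspace_add[OF V] cvs.subspace_scale[OF V])
          then show ?thesis using Pf P0[OF refl, of \<alpha> \<beta>] symmetric_cube[OF f pV, of \<alpha> \<beta>] by simp
        qed
        \<comment> \<open>A binary cubic that vanishes at the four points (1,0), (0,1), (1,1),
          (1,-1) is zero.\<close>
        show ?thesis using e[of 1 0] e[of 0 1] e[of 1 1] e[of 1 "-1"] by simp
      qed
    qed
  }
qed

definition phi :: "((('i \<Rightarrow> 'v \<Rightarrow> complex) \<Rightarrow> complex) \<Rightarrow> complex) \<Rightarrow> ('i \<Rightarrow> 'v \<times> 'v \<times> 'v) \<Rightarrow> complex" where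
  "phi P = res (polz V P)"

lemma phi_bij: "bij_betw phi (ideal_part 3 V (secant_variety V 2 (segre K A))) cub"
  unfolding bij_betw_def
proof (intro conjI inj_onI equalityI subsetI)
  have hp: "P \<in> hom_polys 3 V" if "P \<in> ideal_part 3 V (secant_variety V 2 (segre K A))" for P
    using that by (simp add: ideal_part_def)
  have zip: "res f (zip3 x x y) = f (pure x, pure x, pure y)" if "x \<in> Pi\<^sub>E K A" "y \<in> Pi\<^sub>E K A" for f x y
  proof -
    have "zip3 x x y \<in> Pi\<^sub>E K (cubes A)" using that by (auto simp: zip3_PiE)
    then show ?thesis by (simp add: res_def on_set_in pure3_zip3)
  qed
  {
    fix P Q assume P: "P \<in> ideal_part 3 V (secant_variety V 2 (segre K A))" and Q: "Q \<in> ideal_part 3 V (secant_variety V 2 (segre K A))" and eq: "phi P = phi Q"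
    have "polz V P = polz V Q"
      using res_bij eq polz_hom_polys(1)[OF V hp[OF P]] polz_hom_polys(1)[OF V hp[OF Q]]
      unfolding phi_def bij_betw_def fixed_def by (auto dest: inj_onD)
    then show "P = Q" using polz_bij_V hp[OF P] hp[OF Q] by (auto simp: bij_betw_def dest: inj_onD)
  next
    fix T assume "T \<in> phi ` ideal_part 3 V (secant_variety V 2 (segre K A))"
    then obtain P where P: "P \<in> ideal_part 3 V (secant_variety V 2 (segre K A))" and T: "T = res (polz V P)"
      unfolding phi_def by blast
    note f = polz_hom_polys(1)[OF V hp[OF P]]
    have ft: "polz V P \<in> tri V" using f by (simp add: fixed_def)
    show "T \<in> cub"
      unfolding cub_def T
      using res_trilinears[OF ft] f[unfolded res_symmetric_iff[OF ft]] ideal_part_iff[OF hp[OF P]] P by (simp add: zip)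
  next
    fix T assume T: "T \<in> cub"
    then have "T \<in> res ` tri V" using bij_betw_imp_surj_on[OF res_bij] by (simp add: cub_def)
    then obtain f where f: "f \<in> tri V" and Tf: "T = res f" by blast
    have "f \<in> fixed (proj Sy) (tri V)" using T unfolding res_symmetric_iff[OF f] cub_def Tf by blast
    then have "f \<in> polz V ` hom_polys 3 V" using bij_betw_imp_surj_on[OF polz_bij_V] by blast
    then obtain P where P: "P \<in> hom_polys 3 V" and fP: "f = polz V P" by blast
    have "P \<in> ideal_part 3 V (secant_variety V 2 (segre K A))"
      unfolding ideal_part_iff[OF P] using T by (simp add: zip[symmetric] cub_def Tf fP)
    then show "T \<in> phi ` ideal_part 3 V (secant_variety V 2 (segre K A))"
      unfolding phi_def Tf fP by blast
  }
qed

end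

section \<open>The group actions\<close>

lemma on_set_comp_dual:
  assumes W: "cvs.subspace W" and f: "lin_on W f" "\<And>x. x \<in> W \<Longrightarrow> f x \<in> W" and \<phi>: "\<phi> \<in> dual W"
  shows "on_set W (\<lambda>x. \<phi> (f x)) \<in> dual W"
  by (rule on_set_dual[OF W]) (use f dual_lin[OF \<phi>] in \<open>simp add: lin_on_def\<close>)

lemma tensor_map_in_tensor:
  assumes W: "\<And>i. i \<in> K \<Longrightarrow> cvs.subspace (W i)" and f: "\<And>i. i \<in> K \<Longrightarrow> lin_on (W i) (f i)"
    "\<And>i x. i \<in> K \<Longrightarrow> x \<in> W i \<Longrightarrow> f i x \<in> W i" and T: "T \<in> tensor K W"
  shows "tensor_map K W f T \<in> tensor K W"
  unfolding tensor_eq_sep sep_def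
proof (intro CollectI conjI ballI allI impI)
  let ?u = "\<lambda>i \<phi>. on_set (W i) (\<lambda>x. \<phi> (f i x))"
  fix \<psi> i assume \<psi>: "\<psi> \<in> (\<Pi>\<^sub>E i\<in>K. dual (W i))" and i: "i \<in> K"
  have u: "?u j \<phi> \<in> dual (W j)" if "j \<in> K" "\<phi> \<in> dual (W j)" for j \<phi>
    by (rule on_set_comp_dual[OF W[OF that(1)] f(1)[OF that(1)] f(2)[OF that(1)] that(2)])
  have \<psi>': "(\<lambda>i\<in>K. ?u i (\<psi> i)) \<in> (\<Pi>\<^sub>E i\<in>K. dual (W i))" using \<psi> u by auto
  have l: "lin_on (dual (W i)) (?u i)"
    by (auto simp: lin_on_def on_set_def fun_eq_iff scaleC_fun_apply)
  have "(\<lambda>\<phi>. tensor_map K W f T (\<psi>(i := \<phi>))) = on_set (dual (W i)) (\<lambda>\<phi>. T ((\<lambda>i\<in>K. ?u i (\<psi> i))(i := ?u i \<phi>)))"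
  proof
    fix \<phi>
    show "tensor_map K W f T (\<psi>(i := \<phi>)) = on_set (dual (W i)) (\<lambda>\<phi>. T ((\<lambda>i\<in>K. ?u i (\<psi> i))(i := ?u i \<phi>))) \<phi>"
    proof (cases "\<phi> \<in> dual (W i)")
      case True
      have "(\<lambda>j\<in>K. ?u j ((\<psi>(i := \<phi>)) j)) = (\<lambda>i\<in>K. ?u i (\<psi> i))(i := ?u i \<phi>)"
        using i by (auto simp: restrict_def)
      then show ?thesis
        unfolding tensor_map_def on_set_in[OF PiE_updD[OF \<psi> i True]] on_set_in[OF True] by (rule arg_cong)
    next
      case False
      then have "\<psi>(i := \<phi>) \<notin> (\<Pi>\<^sub>E i\<in>K. dual (W i))" using i by (metis PiE_mem fun_upd_same)
      then show ?thesis using False by (simp add: tensor_map_def on_set_def)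
    qed
  qed
  also have "\<dots> \<in> dual (dual (W i))"
    by (rule on_set_dual[OF subspace_dual[OF W[OF i]] lin_on_comp[OF l u[OF i] dual_lin[OF sepD[OF T[unfolded tensor_eq_sep] \<psi>' i]]]])
  finally show "(\<lambda>\<phi>. tensor_map K W f T (\<psi>(i := \<phi>))) \<in> dual (dual (W i))" .
qed (simp add: tensor_map_def on_set_def)

lemma lin_on_tensor_map: "lin_on D (tensor_map K W f)"
  by (auto simp: lin_on_def tensor_map_def fun_eq_iff on_set_def scaleC_fun_apply)

lemma tensor_map_inverse:
  assumes W: "\<And>i. i \<in> K \<Longrightarrow> cvs.subspace (W i)" and f: "\<And>i. i \<in> K \<Longrightarrow> lin_on (W i) (f i)"
    "\<And>i x. i \<in> K \<Longrightarrow> x \<in> W i \<Longrightarrow> f i x \<in> W i" and h: "\<And>i x. i \<in> K \<Longrightarrow> x \<in> W i \<Longrightarrow> h i x \<in> W i \<and> f i (h i x) = x"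
    and T: "T \<in> tensor K W"
  shows "tensor_map K W f (tensor_map K W h T) = T"
proof
  fix \<psi>
  show "tensor_map K W f (tensor_map K W h T) \<psi> = T \<psi>"
  proof (cases "\<psi> \<in> (\<Pi>\<^sub>E i\<in>K. dual (W i))")
    case True
    have m: "(\<lambda>i\<in>K. on_set (W i) (\<lambda>x. \<psi> i (f i x))) \<in> (\<Pi>\<^sub>E i\<in>K. dual (W i))"
      using True on_set_comp_dual[OF W f] by auto
    have "on_set (W i) (\<lambda>x. on_set (W i) (\<lambda>x. \<psi> i (f i x)) (h i x)) = \<psi> i" if "i \<in> K" for i
      using h[OF that] dual_outside[OF PiE_mem[OF True that]] by (auto simp: on_set_def fun_eq_iff)
    then have "(\<lambda>i\<in>K. on_set (W i) (\<lambda>x. (\<lambda>i\<in>K. on_set (W i) (\<lambda>x. \<psi> i (f i x))) i (h i x))) = \<psi>"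
      using True by (auto simp: fun_eq_iff PiE_iff extensional_def)
    then show ?thesis
      unfolding tensor_map_def on_set_in[OF True] on_set_in[OF m] by (rule arg_cong)
  next
    case False
    then show ?thesis using sep_outside[OF T[unfolded tensor_eq_sep]] by (simp add: tensor_map_def on_set_def)
  qed
qed

definition map3 :: "('v \<Rightarrow> 'v) \<Rightarrow> 'v \<times> 'v \<times> 'v \<Rightarrow> 'v \<times> 'v \<times> 'v" where
  "map3 h = map_prod h (map_prod h h)"

lemma map3_simp [simp]: "map3 h (x, y, z) = (h x, h y, h z)"
  by (simp add: map3_def)

lemma map3_pm: "map3 h (pm s t) = pm s (map3 h t)"
  by (cases t) (simp add: pm_def)

lemma tri_map3:
  assumes A: "cvs.subspace A" and h: "lin_on A h" "\<And>x. x \<in> A \<Longrightarrow> h x \<in> A" and f: "f \<in> tri A"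
  shows "on_set (cube A) (\<lambda>t. f (map3 h t)) \<in> tri A"
proof -
  have c: "lin_on A g'" if "lin_on A (\<lambda>u. g (h u))" "\<And>u. u \<in> A \<Longrightarrow> g' u = g (h u)" for g g' :: "'a \<Rightarrow> complex"
    using that cvs.subspace_add[OF A] cvs.subspace_scale[OF A] by (simp add: lin_on_def)
  note l = lin_on_comp[OF h]
  show ?thesis
    unfolding tri_def
  proof (intro CollectI conjI allI ballI impI)
    fix x y assume xy: "x \<in> A" "y \<in> A"
    show "lin_on A (\<lambda>u. on_set (cube A) (\<lambda>t. f (map3 h t)) (u, x, y))"
      by (rule c[OF l[OF _ triD(2)[OF f h(2)[OF xy(1)] h(2)[OF xy(2)]]]]) (use xy in \<open>auto simp: on_set_def cube_def\<close>)
    show "lin_on A (\<lambda>u. on_set (cube A) (\<lambda>t. f (map3 h t)) (x, u, y))"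
      by (rule c[OF l[OF _ triD(3)[OF f h(2)[OF xy(1)] h(2)[OF xy(2)]]]]) (use xy in \<open>auto simp: on_set_def cube_def\<close>)
    show "lin_on A (\<lambda>u. on_set (cube A) (\<lambda>t. f (map3 h t)) (x, y, u))"
      by (rule c[OF l[OF _ triD(4)[OF f h(2)[OF xy(1)] h(2)[OF xy(2)]]]]) (use xy in \<open>auto simp: on_set_def cube_def\<close>)
  qed (simp add: on_set_def)
qed

lemma fixed_map3:
  assumes A: "cvs.subspace A" and h: "lin_on A h" "\<And>x. x \<in> A \<Longrightarrow> h x \<in> A" and f: "f \<in> fixed e (tri A)"
  shows "on_set (cube A) (\<lambda>t. f (map3 h t)) \<in> fixed e (tri A)"
proof -
  have "perm_op e (on_set (cube A) (\<lambda>t. f (map3 h t))) = on_set (cube A) (\<lambda>t. perm_op e f (map3 h t))"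
    by (simp add: perm_op_def on_set_def fun_eq_iff map3_pm)
  then show ?thesis using f tri_map3[OF A h] by (simp add: fixed_def)
qed

context vs_family
begin

abbreviation G :: "('i \<Rightarrow> 'v \<Rightarrow> 'v) monoid" where
  "G \<equiv> product_group K (\<lambda>i. GL (A i))"

abbreviation ginv :: "('i \<Rightarrow> 'v \<Rightarrow> 'v) \<Rightarrow> 'i \<Rightarrow> 'v \<Rightarrow> 'v" where
  "ginv g i \<equiv> inv_into (A i) (g i)"

lemma G_D:
  assumes "g \<in> carrier G" "i \<in> K"
  shows "g i \<in> carrier (GL (A i))" "lin_on (A i) (ginv g i)"
proof -
  show g: "g i \<in> carrier (GL (A i))" using assms by auto
  show "lin_on (A i) (ginv g i)" by (rule lin_on_inv_into[OF A[OF assms(2)] GL_D(2,1)[OF g]])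
qed

lemma group_G: "Group.group G"
  using group_GL[OF A] by simp

text \<open>Inverses appear because the group acts contragrediently on functions, as in
  \<open>contra_act\<close>.\<close>

definition gact :: "('i \<Rightarrow> 'v \<Rightarrow> 'v) \<Rightarrow> ('i \<Rightarrow> 'v \<times> 'v \<times> 'v) \<Rightarrow> 'i \<Rightarrow> 'v \<times> 'v \<times> 'v" where
  "gact g X = (\<lambda>i\<in>K. map3 (ginv g i) (X i))"

definition pull :: "('i \<Rightarrow> 'v \<Rightarrow> 'v) \<Rightarrow> (('i \<Rightarrow> 'v \<times> 'v \<times> 'v) \<Rightarrow> complex) \<Rightarrow> ('i \<Rightarrow> 'v \<times> 'v \<times> 'v) \<Rightarrow> complex" where
  "pull g T = on_set (Pi\<^sub>E K (cubes A)) (\<lambda>X. T (gact g X))"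

lemma map3_cube: "g \<in> carrier G \<Longrightarrow> i \<in> K \<Longrightarrow> t \<in> cube (A i) \<Longrightarrow> map3 (ginv g i) t \<in> cube (A i)"
  using GL_D(5)[OF G_D(1)] by (cases t) (auto simp: cube_def)

lemma gact_PiE: "g \<in> carrier G \<Longrightarrow> X \<in> Pi\<^sub>E K (cubes A) \<Longrightarrow> gact g X \<in> Pi\<^sub>E K (cubes A)"
  unfolding gact_def using map3_cube by (auto simp: PiE_iff)

lemma gact_pm: "gact g (\<lambda>i\<in>K. pm (s i) (X i)) = (\<lambda>i\<in>K. pm (s i) (gact g X i))"
  by (auto simp: gact_def map3_pm)

lemma gact_zip3: "gact g (zip3 x y z) = zip3 (\<lambda>i\<in>K. ginv g i (x i)) (\<lambda>i\<in>K. ginv g i (y i)) (\<lambda>i\<in>K. ginv g i (z i))"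
  by (auto simp: gact_def zip3_def)

lemma lin_on_pull: "lin_on D (pull g)"
  by (auto simp: lin_on_def pull_def fun_eq_iff on_set_def scaleC_fun_apply)

text \<open>The group applies one map to all three entries of a triple, whereas the operators
  permute the entries. Taking components is therefore equivariant.\<close>

lemma tensor_op_pull:
  assumes g: "g \<in> carrier G"
  shows "tensor_op K A a (pull g T) = pull g (tensor_op K A a T)"
proof
  fix X
  show "tensor_op K A a (pull g T) X = pull g (tensor_op K A a T) X"
  proof (cases "X \<in> Pi\<^sub>E K (cubes A)")
    case True
    show ?thesis
      unfolding tensor_op_def pull_def on_set_in[OF True] on_set_in[OF PiE_pm[OF True]] on_set_in[OF gact_PiE[OF g True]] gact_pm ..
  qed (simp add: tensor_op_def pull_def on_set_def)
qed

lemma pull_sep: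
  assumes g: "g \<in> carrier G" and T: "T \<in> sep K (cubes A) (\<lambda>i. fixed (e i) (tri (A i)))"
  shows "pull g T \<in> sep K (cubes A) (\<lambda>i. fixed (e i) (tri (A i)))"
  unfolding sep_def
proof (intro CollectI conjI ballI allI impI)
  fix X i assume X: "X \<in> Pi\<^sub>E K (cubes A)" and i: "i \<in> K"
  have "(\<lambda>t. pull g T (X(i := t))) = on_set (cube (A i)) (\<lambda>t. T ((gact g X)(i := map3 (ginv g i) t)))"
  proof
    fix t
    show "pull g T (X(i := t)) = on_set (cube (A i)) (\<lambda>t. T ((gact g X)(i := map3 (ginv g i) t))) t"
    proof (cases "t \<in> cube (A i)")
      case True
      have "gact g (X(i := t)) = (gact g X)(i := map3 (ginv g i) t)" using i by (auto simp: gact_def)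
      then show ?thesis unfolding pull_def on_set_in[OF PiE_updD[OF X i True]] on_set_in[OF True] by simp
    next
      case False
      then have "X(i := t) \<notin> Pi\<^sub>E K (cubes A)" using i by (metis PiE_mem fun_upd_same)
      then show ?thesis using False by (simp add: pull_def on_set_def)
    qed
  qed
  also have "\<dots> \<in> fixed (e i) (tri (A i))"
    by (rule fixed_map3[OF A[OF i] G_D(2)[OF g i] GL_D(5)[OF G_D(1)[OF g i]] sepD[OF T gact_PiE[OF g X] i]])
  finally show "(\<lambda>t. pull g T (X(i := t))) \<in> fixed (e i) (tri (A i))" .
qed (simp add: pull_def on_set_def)

lemma trilinears_eq: "trilinears = sep K (cubes A) (\<lambda>i. fixed unit6 (tri (A i)))"
  by (rule sep_cong) (simp_all add: fixed_def perm_op_unit6)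

lemma pull_trilinears: "g \<in> carrier G \<Longrightarrow> T \<in> trilinears \<Longrightarrow> pull g T \<in> trilinears"
  unfolding trilinears_eq by (rule pull_sep)

lemma pull_cub:
  assumes g: "g \<in> carrier G" and T: "T \<in> cub"
  shows "pull g T \<in> cub"
  unfolding cub_def
proof (intro CollectI conjI allI impI ballI)
  show "pull g T \<in> trilinears" using pull_trilinears[OF g] T by (simp add: cub_def)
  fix s :: nat and X assume s: "s < 6" and X: "X \<in> Pi\<^sub>E K (cubes A)"
  show "pull g T (\<lambda>i\<in>K. pm s (X i)) = pull g T X"
    unfolding pull_def on_set_in[OF X] on_set_in[OF PiE_pm[OF X]] gact_pm
    using T s gact_PiE[OF g X] unfolding cub_def by blast
next
  fix x y assume x: "x \<in> Pi\<^sub>E K A" and y: "y \<in> Pi\<^sub>E K A"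
  have "(\<lambda>i\<in>K. ginv g i (x i)) \<in> Pi\<^sub>E K A" if "x \<in> Pi\<^sub>E K A" for x
    using that GL_D(5)[OF G_D(1)[OF g]] by auto
  from this[OF x] this[OF y] show "pull g T (zip3 x x y) = 0"
    unfolding pull_def on_set_def gact_zip3 using T by (simp add: cub_def)
qed

definition cub_rep :: "('i \<Rightarrow> 'v \<Rightarrow> 'v, ('i \<Rightarrow> 'v \<times> 'v \<times> 'v) \<Rightarrow> complex) linrep" where
  "cub_rep = \<lparr>vspace = cub, act = (\<lambda>g. restrict (pull g) cub)\<rparr>"

lemma subspace_trilinears: "cvs.subspace trilinears"
  by (rule subspace_sep[OF subspace_tri])

lemma subspace_cub: "cvs.subspace cub"
proof -
  have "cub = trilinears \<inter> {T. (\<forall>s<6. \<forall>X\<in>Pi\<^sub>E K (cubes A). T (\<lambda>i\<in>K. pm s (X i)) = T X) \<and>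
     (\<forall>x\<in>Pi\<^sub>E K A. \<forall>y\<in>Pi\<^sub>E K A. T (zip3 x x y) = 0)}" by (auto simp: cub_def)
  moreover have "cvs.subspace {T. (\<forall>s<6. \<forall>X\<in>Pi\<^sub>E K (cubes A). T (\<lambda>i\<in>K. pm s (X i)) = T X) \<and>
     (\<forall>x\<in>Pi\<^sub>E K A. \<forall>y\<in>Pi\<^sub>E K A. T (zip3 x x y) = (0::complex))}"
    by (simp add: cvs.subspace_def scaleC_fun_apply)
  ultimately show ?thesis using subspace_trilinears cvs.subspace_inter by simp
qed

text \<open>This is where the homomorphism law is checked directly: inverting a product reverses the
  order of the factors, and substitution into the argument reverses it back.\<close>

lemma is_rep_cub: "is_rep G cub_rep"
proof (rule is_repI[OF group_G])
  show "cvs.subspace (vspace cub_rep)" by (simp add: cub_rep_def subspace_cub)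
  show "act cub_rep g \<in> extensional (vspace cub_rep)" for g by (simp add: cub_rep_def)
  show closed: "act cub_rep g m \<in> vspace cub_rep" if "g \<in> carrier G" "m \<in> vspace cub_rep" for g m
    using that pull_cub by (simp add: cub_rep_def del: carrier_product_group)
  show "lin_on (vspace cub_rep) (act cub_rep g)" for g
    using lin_on_pull[of UNIV g] subspace_cub by (simp add: cub_rep_def lin_on_def cvs.subspace_def)
  fix g h m assume g: "g \<in> carrier G" and h: "h \<in> carrier G" and m: "m \<in> vspace cub_rep"
  have gi: "ginv (g \<otimes>\<^bsub>G\<^esub> h) i x = ginv h i (ginv g i x)" if i: "i \<in> K" and x: "x \<in> A i" for i x
  proof -
    note g' = G_D(1)[OF g i] and h' = G_D(1)[OF h i]
    have "(g \<otimes>\<^bsub>G\<^esub> h) i = compose (A i) (g i) (h i)" using i by (simp add: GL_simps(3)[OF g' h'])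
    moreover have "inv_into (A i) (compose (A i) (g i) (h i)) x = ginv h i (ginv g i x)"
    proof (rule inv_into_f_eq)
      show "inj_on (compose (A i) (g i) (h i)) (A i)"
        using GL_D(1)[OF g'] GL_D(1)[OF h'] by (metis bij_betw_compose bij_betw_imp_inj_on)
      show "ginv h i (ginv g i x) \<in> A i" using x GL_D(5)[OF g'] GL_D(5)[OF h'] by simp
      then show "compose (A i) (g i) (h i) (ginv h i (ginv g i x)) = x"
        using x GL_D(5,6)[OF g'] GL_D(6)[OF h'] by (simp add: compose_def)
    qed
    ultimately show ?thesis by simp
  qed
  have "pull (g \<otimes>\<^bsub>G\<^esub> h) m = pull g (pull h m)"
  proof
    fix X
    show "pull (g \<otimes>\<^bsub>G\<^esub> h) m X = pull g (pull h m) X"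
    proof (cases "X \<in> Pi\<^sub>E K (cubes A)")
      case True
      have "map3 (ginv (g \<otimes>\<^bsub>G\<^esub> h) i) (X i) = map3 (ginv h i) (map3 (ginv g i) (X i))" if "i \<in> K" for i
        using gi[OF that] PiE_mem[OF True that] by (cases "X i") (simp add: cube_def del: mult_product_group)
      then have "gact (g \<otimes>\<^bsub>G\<^esub> h) X = gact h (gact g X)"
        unfolding gact_def by (auto simp: fun_eq_iff simp del: mult_product_group)
      then show ?thesis unfolding pull_def on_set_in[OF True] on_set_in[OF gact_PiE[OF g True]] by (rule arg_cong)
    qed (simp add: pull_def on_set_def)
  qed
  then show "act cub_rep (g \<otimes>\<^bsub>G\<^esub> h) m = act cub_rep g (act cub_rep h m)"
    using m pull_cub[OF h] by (simp add: cub_rep_def del: mult_product_group)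
next
  fix m assume m: "m \<in> vspace cub_rep"
  have "pull \<one>\<^bsub>G\<^esub> m = m"
  proof
    fix X
    show "pull \<one>\<^bsub>G\<^esub> m X = m X"
    proof (cases "X \<in> Pi\<^sub>E K (cubes A)")
      case True
      have "ginv \<one>\<^bsub>G\<^esub> i x = x" if "i \<in> K" "x \<in> A i" for i x
        using that by (simp add: GL_simps(2)) (rule inv_into_f_eq, auto simp: inj_on_def)
      then have "map3 (ginv \<one>\<^bsub>G\<^esub> i) (X i) = X i" if "i \<in> K" for i
        using that PiE_mem[OF True that] by (cases "X i") (simp add: cube_def del: one_product_group)
      then have "gact \<one>\<^bsub>G\<^esub> X = X"
        unfolding gact_def using True by (auto simp: fun_eq_iff PiE_iff extensional_def simp del: one_product_group)
      then show ?thesis unfolding pull_def on_set_in[OF True] by (rule arg_cong)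
    next
      case False
      have "m \<in> trilinears" using m by (simp add: cub_rep_def cub_def)
      then show ?thesis using sep_outside[OF _ False] False by (simp add: pull_def on_set_def)
    qed
  qed
  then show "act cub_rep \<one>\<^bsub>G\<^esub> m = m" using m by (simp add: cub_rep_def del: one_product_group)
qed

end

section \<open>Equivariance of polarisation and of the passage from Schur modules to
  functions\<close>

lemma lin_on_restrict: "cvs.subspace W \<Longrightarrow> lin_on W f \<Longrightarrow> lin_on W (restrict f W)"
  by (simp add: lin_on_def cvs.subspace_def)

lemma tensor_rep_cong:
  assumes "\<And>i. i \<in> K \<Longrightarrow> R i = R' i"
  shows "tensor_rep K R = tensor_rep K R'"
proof -
  have P: "(\<Pi>\<^sub>E i\<in>K. dual (vspace (R i))) = (\<Pi>\<^sub>E i\<in>K. dual (vspace (R' i)))"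
    using assms by (intro PiE_cong) simp
  have t: "tensor K (\<lambda>i. vspace (R i)) = tensor K (\<lambda>i. vspace (R' i))"
    unfolding tensor_eq_sep using assms by (intro sep_cong) simp_all
  have "(\<lambda>i\<in>K. on_set (vspace (R i)) (\<lambda>x. \<psi> i (act (R i) g x))) = (\<lambda>i\<in>K. on_set (vspace (R' i)) (\<lambda>x. \<psi> i (act (R' i) g x)))" for \<psi> g
    using assms by (intro restrict_ext) simp
  then show ?thesis unfolding tensor_rep_def t tensor_map_def P by simp
qed

context vs_family
begin

text \<open>The model of \<open>schur_term\<close> inside the trilinear functions; the two are
  matched by \<open>requiv_tensor_schur\<close>.\<close>

definition frep :: "('i \<Rightarrow> label) \<Rightarrow> ('i \<Rightarrow> 'v \<Rightarrow> 'v, ('i \<Rightarrow> 'v \<times> 'v \<times> 'v) \<Rightarrow> complex) linrep" where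
  "frep c = \<lparr>vspace = sep K (cubes A) (\<lambda>i. fixed (idem (c i)) (tri (A i))),
     act = (\<lambda>g. restrict (pull g) (sep K (cubes A) (\<lambda>i. fixed (idem (c i)) (tri (A i)))))\<rparr>"

abbreviation Vrep :: "('i \<Rightarrow> 'v \<Rightarrow> 'v, ('i \<Rightarrow> 'v \<Rightarrow> complex) \<Rightarrow> complex) linrep" where
  "Vrep \<equiv> tensor_rep K (std_rep A)"

abbreviation secants :: "(('i \<Rightarrow> 'v \<Rightarrow> complex) \<Rightarrow> complex) set set" where
  "secants \<equiv> secant_variety V 2 (segre K A)"

lemma Vrep_simps: "vspace Vrep = V" "act Vrep g = restrict (tensor_map K A g) V"
  by (simp_all add: tensor_rep_def std_rep_def)

text \<open>The contragredient action involves the inverse of the operator on all of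
  \<open>V\<close>; it is recognised here as the tensor product of the inverses on the
  factors.\<close>

lemma Vrep_act:
  assumes g: "g \<in> carrier G"
  shows "v \<in> V \<Longrightarrow> inv_into V (act Vrep g) v = tensor_map K A (ginv g) v"
    "v \<in> V \<Longrightarrow> tensor_map K A (ginv g) v \<in> V"
    "(\<And>i. i \<in> K \<Longrightarrow> w i \<in> A i) \<Longrightarrow> tensor_map K A (ginv g) (pure w) = pure (\<lambda>i. ginv g i (w i))"
proof -
  note g' = G_D(1)[OF g] and l = G_D(2)[OF g]
  show m: "v \<in> V \<Longrightarrow> tensor_map K A (ginv g) v \<in> V" for v
    by (rule tensor_map_in_tensor[OF A l GL_D(5)[OF g']])
  have r: "tensor_map K A g (tensor_map K A (ginv g) v) = v" if "v \<in> V" for v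
    by (rule tensor_map_inverse[OF A GL_D(2)[OF g'] GL_D(4)[OF g'] _ that]) (use GL_D(5,6)[OF g'] in auto)
  have r': "tensor_map K A (ginv g) (tensor_map K A g v) = v" if "v \<in> V" for v
    by (rule tensor_map_inverse[OF A l GL_D(5)[OF g'] _ that]) (use GL_D(4,7)[OF g'] in auto)
  have i: "inj_on (act Vrep g) V"
  proof (rule inj_onI)
    fix v w assume v: "v \<in> V" and w: "w \<in> V" and eq: "act Vrep g v = act Vrep g w"
    have "tensor_map K A g v = tensor_map K A g w" using v w eq by (simp add: Vrep_simps)
    then show "v = w" using r'[OF v] r'[OF w] by metis
  qed
  show "v \<in> V \<Longrightarrow> inv_into V (act Vrep g) v = tensor_map K A (ginv g) v"
    by (rule inv_into_f_eq[OF i m]) (simp_all add: Vrep_simps m r)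
  assume w: "\<And>i. i \<in> K \<Longrightarrow> w i \<in> A i"
  show "tensor_map K A (ginv g) (pure w) = pure (\<lambda>i. ginv g i (w i))"
  proof
    fix \<psi>
    show "tensor_map K A (ginv g) (pure w) \<psi> = pure (\<lambda>i. ginv g i (w i)) \<psi>"
    proof (cases "\<psi> \<in> (\<Pi>\<^sub>E i\<in>K. dual (A i))")
      case True
      have m: "(\<lambda>i\<in>K. on_set (A i) (\<lambda>x. \<psi> i (ginv g i x))) \<in> (\<Pi>\<^sub>E i\<in>K. dual (A i))"
        using True on_set_comp_dual[OF A l GL_D(5)[OF g']] by auto
      show ?thesis
        unfolding tensor_map_def pure_tensor_def on_set_in[OF True] on_set_in[OF m]
        using w by (intro prod.cong refl) (simp add: on_set_in)
    qed (simp add: tensor_map_def pure_tensor_def on_set_def)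
  qed
qed

lemma contra_hom_polys:
  assumes g: "g \<in> carrier G" and P: "P \<in> hom_polys 3 V"
  shows "contra_act Vrep g P \<in> hom_polys 3 V"
  using P unfolding hom_polys_def
proof (induction rule: cvs.span_induct)
  case base
  have e: "contra_act Vrep g (x + y) = contra_act Vrep g x + contra_act Vrep g y"
    "contra_act Vrep g (a *\<^sub>C x) = a *\<^sub>C contra_act Vrep g x" "contra_act Vrep g 0 = 0" for x y a
    by (auto simp: contra_act_def on_set_def fun_eq_iff scaleC_fun_apply)
  show ?case
    unfolding cvs.subspace_def mem_Collect_eq e
    by (auto intro: cvs.span_zero cvs.span_add cvs.span_scale)
next
  case (step P)
  then obtain \<phi> where P: "P = on_set V (\<lambda>v. \<Prod>s<3::nat. \<phi> s v)" and \<phi>: "\<forall>s<3. \<phi> s \<in> dual V" by blast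
  let ?\<phi> = "\<lambda>s. on_set V (\<lambda>v. \<phi> s (tensor_map K A (ginv g) v))"
  have "contra_act Vrep g P = on_set V (\<lambda>v. \<Prod>s<3::nat. ?\<phi> s v)"
  proof
    fix v
    show "contra_act Vrep g P v = on_set V (\<lambda>v. \<Prod>s<3::nat. ?\<phi> s v) v"
    proof (cases "v \<in> V")
      case True
      then show ?thesis
        using Vrep_act(1)[OF g True] Vrep_act(2)[OF g True] by (simp add: contra_act_def P on_set_in Vrep_simps(1))
    qed (simp add: contra_act_def on_set_def Vrep_simps(1))
  qed
  moreover have "\<forall>s<3. ?\<phi> s \<in> dual V"
    using on_set_comp_dual[OF V lin_on_tensor_map Vrep_act(2)[OF g]] \<phi> by blast
  ultimately show ?case by (intro cvs.span_base CollectI exI[of _ ?\<phi>] conjI)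
qed

text \<open>Polarisation is natural for linear substitutions, and the substitution induced by
  \<open>g\<close> acts on pure tensors factor by factor.\<close>

lemma polz_contra:
  assumes g: "g \<in> carrier G" and X: "X \<in> Pi\<^sub>E K (cubes A)"
  shows "polz V (contra_act Vrep g P) (pure3 X) = polz V P (pure3 (gact g X))"
proof -
  let ?h = "tensor_map K A (ginv g)"
  have mem: "fst (X i) \<in> A i" "fst (snd (X i)) \<in> A i" "snd (snd (X i)) \<in> A i" if "i \<in> K" for i
    using PiE_mem[OF X that] by (auto simp: cube_def)
  have "(pure (\<lambda>i. ginv g i (fst (X i))), pure (\<lambda>i. ginv g i (fst (snd (X i)))), pure (\<lambda>i. ginv g i (snd (snd (X i))))) = pure3 (gact g X)"
    unfolding pure3_def by (auto simp: gact_def map3_def intro!: pure_cong)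
  then have p: "pure3 (gact g X) = map3 ?h (pure3 X)"
    unfolding pure3_def using Vrep_act(3)[OF g mem(1)] Vrep_act(3)[OF g mem(2)] Vrep_act(3)[OF g mem(3)] by simp
  have "polz V (contra_act Vrep g P) t = polz V P (map3 ?h t)" if t: "t \<in> cube V" for t
  proof -
    obtain u v w where t': "t = (u, v, w)" by (cases t)
    have m: "u \<in> V" "v \<in> V" "w \<in> V" using t by (auto simp: t' cube_def)
    have s: "u + v \<in> V" "u + w \<in> V" "v + w \<in> V" "u + v + w \<in> V" using m by (auto intro: cvs.subspace_add[OF V])
    have c: "contra_act Vrep g P x = P (?h x)" if "x \<in> V" for x
      using that by (simp add: contra_act_def Vrep_simps(1) on_set_def Vrep_act(1)[OF g])
    have ht: "(?h u, ?h v, ?h w) \<in> cube V" using m Vrep_act(2)[OF g] by (simp add: cube_def)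
    have add: "?h (x + y) = ?h x + ?h y" for x y
      using lin_on_add[OF lin_on_tensor_map[of UNIV]] by simp
    show ?thesis
      unfolding t' map3_simp polz_def on_set_in[OF t[unfolded t']] on_set_in[OF ht] prod.case
      by (simp only: c[OF m(1)] c[OF m(2)] c[OF m(3)] c[OF s(1)] c[OF s(2)] c[OF s(3)] c[OF s(4)] add)
  qed
  then show ?thesis using pure3_cube[OF X] p by simp
qed

lemma phi_contra: "g \<in> carrier G \<Longrightarrow> phi (contra_act Vrep g P) = pull g (phi P)"
  unfolding phi_def res_def pull_def
  by (auto simp: fun_eq_iff on_set_def polz_contra gact_PiE simp del: carrier_product_group)

lemma requiv_ideal_cub: "requiv G (ideal_rep 3 Vrep secants) cub_rep"
proof (rule requivI)
  have v: "vspace (ideal_rep 3 Vrep secants) = ideal_part 3 V secants" "vspace cub_rep = cub"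
    "act (ideal_rep 3 Vrep secants) g = restrict (contra_act Vrep g) (ideal_part 3 V secants)" "act cub_rep g = restrict (pull g) cub" for g
    by (simp_all add: ideal_rep_def Vrep_simps(1) cub_rep_def)
  have hp: "P \<in> hom_polys 3 V" if "P \<in> ideal_part 3 V secants" for P
    using that by (simp add: ideal_part_def)
  \<comment> \<open>Invariance of the ideal follows from its description by
    \<open>ideal_part_iff\<close>, since the group carries pure tensors to pure tensors.\<close>
  have closed: "contra_act Vrep g P \<in> ideal_part 3 V secants" if g: "g \<in> carrier G" and P: "P \<in> ideal_part 3 V secants" for g P
    unfolding ideal_part_iff[OF contra_hom_polys[OF g hp[OF P]]]
  proof (intro ballI)
    fix x y assume x: "x \<in> Pi\<^sub>E K A" and y: "y \<in> Pi\<^sub>E K A"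
    let ?g = "\<lambda>x. \<lambda>i\<in>K. ginv g i (x i)"
    have m: "?g x \<in> Pi\<^sub>E K A" if "x \<in> Pi\<^sub>E K A" for x using that GL_D(5)[OF G_D(1)[OF g]] by auto
    have X: "zip3 x x y \<in> Pi\<^sub>E K (cubes A)" using x y by (auto simp: zip3_PiE)
    have "polz V (contra_act Vrep g P) (pure x, pure x, pure y) = polz V P (pure (?g x), pure (?g x), pure (?g y))"
      using polz_contra[OF g X, of P] by (simp add: gact_zip3 pure3_zip3)
    also have "\<dots> = 0" using P[unfolded ideal_part_iff[OF hp[OF P]]] m[OF x] m[OF y] by blast
    finally show "polz V (contra_act Vrep g P) (pure x, pure x, pure y) = 0" .
  qed
  show "cvs.subspace (vspace (ideal_rep 3 Vrep secants))"
    unfolding v ideal_part_def using subspace_hom_polys[of 3 V] by (auto simp: cvs.subspace_def scaleC_fun_apply)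
  show "lin_on (vspace (ideal_rep 3 Vrep secants)) phi"
    by (auto simp: lin_on_def phi_def polz_def res_def fun_eq_iff on_set_def scaleC_fun_apply case_prod_unfold algebra_simps diff_divide_distrib add_divide_distrib)
  show "bij_betw phi (vspace (ideal_rep 3 Vrep secants)) (vspace cub_rep)" unfolding v by (rule phi_bij)
  show "act (ideal_rep 3 Vrep secants) g m \<in> vspace (ideal_rep 3 Vrep secants)"
    if "g \<in> carrier G" "m \<in> vspace (ideal_rep 3 Vrep secants)" for g m
    using that closed unfolding v by (simp del: carrier_product_group)
  show "phi (act (ideal_rep 3 Vrep secants) g m) = act cub_rep g (phi m)"
    if "g \<in> carrier G" "m \<in> vspace (ideal_rep 3 Vrep secants)" for g m
    using that bij_betwE[OF phi_bij] unfolding v by (simp add: phi_contra del: carrier_product_group)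
qed

text \<open>Two layers: \<open>schur_fun1\<close> turns the Schur module of each factor into a fixed
  space of trilinear functions, and \<open>tensor_fun\<close> joins the factors. As
  \<open>Pl\<close> and \<open>Mi\<close> have the same shape, the labelling may choose between them
  freely.\<close>

lemma requiv_tensor_schur:
  assumes g: "\<And>i. i \<in> K \<Longrightarrow> \<pi> i = shape (c i)"
  shows "requiv G (tensor_rep K (\<lambda>i. schur_rep (\<pi> i) (dual_rep (std_rep A i)))) (frep c)"
proof -
  let ?W = "\<lambda>i. schur (shape (c i)) (dual (A i))"
  let ?f = "\<lambda>g i. restrict (tensor_map (boxes (shape (c i))) (\<lambda>_. dual (A i)) (\<lambda>_. restrict (contra_act (std_rep A i) g) (dual (A i)))) (?W i)"
  let ?R = "tensor_rep K (\<lambda>i. schur_rep (shape (c i)) (dual_rep (std_rep A i)))"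
  have "tensor_rep K (\<lambda>i. schur_rep (\<pi> i) (dual_rep (std_rep A i))) = ?R"
    by (rule tensor_rep_cong) (simp add: g)
  moreover have "requiv G ?R (frep c)"
  proof (rule requivI)
    have R: "vspace ?R = tensor K ?W" "act ?R g = restrict (tensor_map K ?W (?f g)) (tensor K ?W)" for g
      by (simp_all add: tensor_rep_def schur_rep_def dual_rep_def std_rep_def)
    have W: "cvs.subspace (?W i)" if "i \<in> K" for i by (rule subspace_schur[OF subspace_dual[OF A[OF that]]])
    have lf: "lin_on (?W i) (?f g i)" if i: "i \<in> K" for g i
      by (rule lin_on_restrict[OF W[OF i] lin_on_tensor_map])
    have con: "contra_act (std_rep A i) g \<phi> = on_set (A i) (\<lambda>x. \<phi> (ginv g i x))" for i g \<phi>
      by (simp add: contra_act_def std_rep_def)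
    have cd: "contra_act (std_rep A i) g \<phi> \<in> dual (A i)" if "g \<in> carrier G" "i \<in> K" "\<phi> \<in> dual (A i)" for g i \<phi>
      unfolding con by (rule on_set_comp_dual[OF A[OF that(2)] G_D(2)[OF that(1,2)] GL_D(5)[OF G_D(1)[OF that(1,2)]] that(3)])
    have lcd: "lin_on (dual (A i)) (restrict (contra_act (std_rep A i) g) (dual (A i)))" if "i \<in> K" for g i
      using subspace_dual[OF A[OF that]] by (simp add: lin_on_def cvs.subspace_def con on_set_def fun_eq_iff scaleC_fun_apply)
    have eq: "schur_fun1 (c i) (A i) (tensor_map (boxes (shape (c i))) (\<lambda>_. dual (A i)) (\<lambda>_. restrict (contra_act (std_rep A i) g) (dual (A i))) w) t =
        schur_fun1 (c i) (A i) w (map3 (ginv g i) t)" if "g \<in> carrier G" "i \<in> K" "t \<in> cube (A i)" for g i w t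
    proof -
      obtain x y z where t: "t = (x, y, z)" by (cases t)
      show ?thesis
        unfolding t map3_simp
        by (rule schur_fun1_tensor_map[OF A[OF that(2)]])
          (use that cd GL_D(5)[OF G_D(1)[OF that(1,2)]] in \<open>simp_all add: t con on_set_in del: carrier_product_group\<close>)
    qed
    \<comment> \<open>Seen on functions, the operator maps into the fixed space, which is the image
      of the Schur module. Injectivity on all tensors over the boxes then identifies the transformed
      tensor with a member of that module.\<close>
    have fW: "?f g i w \<in> ?W i" if g: "g \<in> carrier G" and i: "i \<in> K" and w: "w \<in> ?W i" for g i w
    proof -
      let ?a = "tensor_map (boxes (shape (c i))) (\<lambda>_. dual (A i)) (\<lambda>_. restrict (contra_act (std_rep A i) g) (dual (A i))) w"
      note ipi = ip[OF i]
      have wt: "w \<in> tensor (boxes (shape (c i))) (\<lambda>_. dual (A i))" using schur_subset_tensor[OF subspace_dual[OF A[OF i]]] w by blast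
      have a: "?a \<in> tensor (boxes (shape (c i))) (\<lambda>_. dual (A i))"
        by (rule tensor_map_in_tensor[OF subspace_dual[OF A[OF i]] lcd[OF i] _ wt]) (use cd[OF g i] in auto)
      note b1 = schur_fun1_bij[OF A[OF i] ipi, of "c i"]
      have "schur_fun1 (c i) (A i) ?a = on_set (cube (A i)) (\<lambda>t. schur_fun1 (c i) (A i) w (map3 (ginv g i) t))"
        using eq[OF g i, of _ w] by (auto simp: fun_eq_iff on_set_def box_fun_def)
      also have "\<dots> \<in> fixed (idem (c i)) (tri (A i))"
        by (rule fixed_map3[OF A[OF i] G_D(2)[OF g i] GL_D(5)[OF G_D(1)[OF g i]] bij_betwE[OF b1, rule_format, OF w]])
      finally have "schur_fun1 (c i) (A i) ?a \<in> schur_fun1 (c i) (A i) ` ?W i"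
        by (simp only: bij_betw_imp_surj_on[OF b1])
      then obtain w' where w': "schur_fun1 (c i) (A i) ?a = schur_fun1 (c i) (A i) w'" "w' \<in> ?W i"
        by (rule imageE)
      have "inj_on (schur_fun1 (c i) (A i)) (tensor (boxes (shape (c i))) (\<lambda>_. dual (A i)))"
        using box_fun_bij[OF box_distinct A[OF i] ipi, of "c i"] unfolding boxes_shape by (simp add: bij_betw_def)
      from inj_onD[OF this w'(1) a subsetD[OF schur_subset_tensor[OF subspace_dual[OF A[OF i]]] w'(2)]]
      have "?a = w'" .
      then show ?thesis using w' w by simp
    qed
    have F: "vspace (frep c) = sep K (cubes A) (\<lambda>i. fixed (idem (c i)) (tri (A i)))" "act (frep c) g = restrict (pull g) (vspace (frep c))" for g
      by (simp_all add: frep_def)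
    have bij: "bij_betw (schur_fun K A c) (tensor K ?W) (sep K (cubes A) (\<lambda>i. fixed (idem (c i)) (tri (A i))))"
      unfolding schur_fun_def
      by (rule tensor_fun_bij[OF K subspace_schur[OF subspace_dual[OF A]] lin_on_box_fun schur_fun1_bij[OF A ip]
            interp_fixed[OF interp_tri[OF ip] pm_stable_tri conv_idem_idem]])
    show "cvs.subspace (vspace ?R)" unfolding R by (rule subspace_tensor[OF W])
    show "lin_on (vspace ?R) (schur_fun K A c)" unfolding schur_fun_def by (rule lin_on_tensor_fun)
    show "bij_betw (schur_fun K A c) (vspace ?R) (vspace (frep c))" unfolding R F by (rule bij)
    fix g m assume g: "g \<in> carrier G" and m: "m \<in> vspace ?R"
    then have m': "m \<in> tensor K ?W" by (simp only: R)
    show "act ?R g m \<in> vspace ?R"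
      unfolding R restrict_apply' [OF m'] by (rule tensor_map_in_tensor[OF W lf fW[OF g] m'])
    have "schur_fun K A c (tensor_map K ?W (?f g) m) X = pull g (schur_fun K A c m) X" for X
    proof (cases "X \<in> Pi\<^sub>E K (cubes A)")
      case True
      have "schur_fun K A c (tensor_map K ?W (?f g) m) X = schur_fun K A c m (\<lambda>i\<in>K. map3 (ginv g i) (X i))"
        unfolding schur_fun_def
        by (rule tensor_fun_tensor_map[OF W lin_on_box_fun fW[OF g] map3_cube[OF g] _ True]) (simp_all only: restrict_apply' eq[OF g])
      then show ?thesis unfolding pull_def on_set_in[OF True] gact_def .
    qed (simp add: schur_fun_def tensor_fun_def pull_def on_set_def)
    then show "schur_fun K A c (act ?R g m) = act (frep c) g (schur_fun K A c m)"
      using bij_betwE[OF bij] m' unfolding R(2) F restrict_apply'[OF m'] by auto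
  qed
  ultimately show ?thesis by simp
qed

end

section \<open>Fourier components of invariant trilinear functions\<close>

lemma UNIV_label: "(UNIV :: label set) = {Sy, Al, Pl, Mi}"
  by (auto intro: label.exhaust)

lemma finite_label [simp]: "finite (L :: label set)"
  by (rule finite_subset[OF subset_UNIV]) (simp add: UNIV_label)

text \<open>The rotation has eigenvalue \<open>-1 - omega\<close> for \<open>Pl\<close> and the
  square of this, which is omega, for \<open>Mi\<close>; the weight is the exponent.\<close>

fun wt :: "label \<Rightarrow> nat" where
  "wt Sy = 0" | "wt Al = 0" | "wt Pl = 1" | "wt Mi = 2"

definition rot6 :: "nat \<Rightarrow> complex" where "rot6 = vec6 0 1 0 0 0 0"
definition swap6 :: "nat \<Rightarrow> complex" where "swap6 = vec6 0 0 0 1 0 0"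
text \<open>The element 1 + s for the transposition s of the first two arguments; it converts
  vanishing at equal first arguments into an equation in the group algebra.\<close>

definition pol6 :: "nat \<Rightarrow> complex" where "pol6 = vec6 1 0 0 1 0 0"

fun sgl :: "label \<Rightarrow> complex" where
  "sgl Al = - 1" | "sgl Sy = 1" | "sgl Pl = 1" | "sgl Mi = 1"

text \<open>Symmetrising the first two arguments doubles the symmetric part, kills the alternating
  one, and gives each of \<open>Pl\<close> and \<open>Mi\<close> the sum of both components. The
  labels that enter are listed by \<open>cls\<close>.\<close>

fun poll :: "label \<Rightarrow> complex" where
  "poll Al = 0" | "poll Sy = 2" | "poll Pl = 1" | "poll Mi = 1"

fun cls :: "label \<Rightarrow> label set" where
  "cls Sy = {Sy}" | "cls Al = {Al}" | "cls Pl = {Pl, Mi}" | "cls Mi = {Pl, Mi}"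

lemma conv_proj_rot: "conv (proj c) rot6 = (\<lambda>s. (- 1 - omega) ^ wt c * proj c s)"
  by (cases c) (simp_all only: conv_def proj.simps wt.simps rot6_def vec6_scale,
      auto intro!: vec6_cong simp: field_simps power2_eq_square omega_square omega_square')

lemma conv_proj_swap: "conv (proj c) swap6 = (\<lambda>s. sgl c * proj (flip c) s)"
  by (cases c) (simp_all only: conv_def proj.simps flip.simps sgl.simps swap6_def vec6_scale,
      auto intro!: vec6_cong simp: field_simps omega_square omega_square')

lemma conv_proj_pol: "conv (proj c) pol6 = (\<lambda>s. poll c * (\<Sum>d\<in>cls c. proj d s))"
  by (cases c) (simp_all add: vec6_add, simp_all only: conv_def pol6_def vec6_scale,
      auto intro!: vec6_cong simp: field_simps omega_square omega_square' fun_eq_iff vec6_def)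

lemma omega_power: "(- 1 - omega) ^ n = 1 \<longleftrightarrow> 3 dvd n"
proof -
  have r3: "(- 1 - omega) ^ 3 = 1" by (simp add: power3_eq_cube algebra_simps omega_square omega_square')
  have "(- 1 - omega) ^ n = ((- 1 - omega) ^ 3) ^ (n div 3) * (- 1 - omega) ^ (n mod 3)"
    by (simp only: power_mult[symmetric] power_add[symmetric]) simp
  then have e: "(- 1 - omega) ^ n = (- 1 - omega) ^ (n mod 3)" by (simp add: r3)
  have "n mod 3 < 3" by simp
  then consider "n mod 3 = 0" | "n mod 3 = 1" | "n mod 3 = 2" by linarith
  then show ?thesis
  proof cases
    case 1
    then show ?thesis using e by (simp add: dvd_eq_mod_eq_0)
  next
    case 2
    then show ?thesis using e by (simp add: dvd_eq_mod_eq_0 omega_def complex_eq_iff)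
  next
    case 3
    then show ?thesis using e by (simp add: dvd_eq_mod_eq_0 power2_eq_square algebra_simps omega_square) (simp add: omega_def complex_eq_iff)
  qed
qed

lemma tensor_op_zero:
  assumes "finite K" "i \<in> K" "\<And>s. a i s = 0"
  shows "tensor_op K B a T = 0"
proof -
  have "(\<Prod>i\<in>K. a i (s i)) = 0" for s using assms by (intro prod_zero) auto
  then show ?thesis by (simp add: tensor_op_def on_set_def fun_eq_iff)
qed

context vs_family
begin

text \<open>The values lie in the model space \<open>isotypic c\<close> rather than in the
  corresponding part of \<open>T\<close>; \<open>embed c\<close> leads back to that part.\<close>

definition component :: "('i \<Rightarrow> label) \<Rightarrow> (('i \<Rightarrow> 'v \<times> 'v \<times> 'v) \<Rightarrow> complex) \<Rightarrow> ('i \<Rightarrow> 'v \<times> 'v \<times> 'v) \<Rightarrow> complex" where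
  "component c = tensor_op K A (\<lambda>i. proj (c i))"

definition embed :: "('i \<Rightarrow> label) \<Rightarrow> (('i \<Rightarrow> 'v \<times> 'v \<times> 'v) \<Rightarrow> complex) \<Rightarrow> ('i \<Rightarrow> 'v \<times> 'v \<times> 'v) \<Rightarrow> complex" where
  "embed c = tensor_op K A (\<lambda>i. emb (c i))"

abbreviation labelings :: "('i \<Rightarrow> label) set" where
  "labelings \<equiv> \<Pi>\<^sub>E i\<in>K. UNIV"

abbreviation isotypic :: "('i \<Rightarrow> label) \<Rightarrow> (('i \<Rightarrow> 'v \<times> 'v \<times> 'v) \<Rightarrow> complex) set" where
  "isotypic c \<equiv> sep K (cubes A) (\<lambda>i. fixed (idem (c i)) (tri (A i)))"

lemma isotypic_eq: "isotypic c = {T \<in> trilinears. tensor_op K A (\<lambda>i. idem (c i)) T = T}"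
  by (rule sep_fixed[OF K pm_stable_tri conv_idem_idem])

lemma tensor_op_trilinears: "T \<in> trilinears \<Longrightarrow> tensor_op K A a T \<in> trilinears"
  by (rule tensor_op_sep[OF pm_stable_tri])

lemma component_isotypic: "T \<in> trilinears \<Longrightarrow> component c T \<in> isotypic c"
  unfolding isotypic_eq component_def by (simp add: tensor_op_top[OF K] conv_idem_proj tensor_op_trilinears)

lemma finite_labelings: "finite labelings"
  using K by (simp add: finite_PiE)

text \<open>The identity of each factor is split into four projections, and the product over the
  factors is multiplied out.\<close>

lemma embed_component:
  assumes "T \<in> trilinears"
  shows "(\<Sum>c\<in>labelings. embed c (component c T)) = T"
proof -
  have "(\<Sum>c\<in>labelings. embed c (component c T)) = (\<Sum>c\<in>labelings. tensor_op K A (\<lambda>i. conv (emb (c i)) (proj (c i))) T)"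
    by (simp add: embed_def component_def tensor_op_top[OF K])
  also have "\<dots> = tensor_op K A (\<lambda>i s. \<Sum>l\<in>UNIV. conv (emb l) (proj l) s) T"
    by (rule tensor_op_sum[OF K finite_label, where a = "\<lambda>i l. conv (emb l) (proj l)", symmetric])
  also have "\<dots> = tensor_op K A (\<lambda>i. unit6) T"
    by (intro tensor_op_cong) (simp add: fun_eq_iff UNIV_label sum_conv_emb_proj add.assoc[symmetric] del: emb.simps proj.simps)
  also have "\<dots> = T" by (rule tensor_op_unit[OF K sep_outside[OF assms]])
  finally show ?thesis .
qed

lemma component_embed:
  assumes H: "H \<in> isotypic d" and c: "c \<in> labelings" and d: "d \<in> labelings"
  shows "component c (embed d H) = (if c = d then H else 0)"
proof -
  have e: "component c (embed d H) = tensor_op K A (\<lambda>i. if c i = d i then idem (c i) else (\<lambda>s. 0)) H"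
    unfolding component_def embed_def tensor_op_top[OF K] conv_proj_emb ..
  show ?thesis
  proof (cases "c = d")
    case True
    then show ?thesis using H unfolding e isotypic_eq by simp
  next
    case False
    then obtain i where "i \<in> K" "c i \<noteq> d i" using c d by (meson PiE_ext)
    then have "component c (embed d H) = 0" unfolding e by (intro tensor_op_zero[OF K, of i]) auto
    then show ?thesis using False by simp
  qed
qed

lemma component_linear: "component c (T + U) = component c T + component c U" "component c (a *\<^sub>C T) = a *\<^sub>C component c T"
  "component c (\<Sum>n\<in>N'. f n) = (\<Sum>n\<in>N'. component c (f n))" "component c 0 = 0"
proof -
  have l: "lin_on UNIV (component c)" unfolding component_def by (rule lin_on_tensor_op)
  show "component c (T + U) = component c T + component c U" "component c (a *\<^sub>C T) = a *\<^sub>C component c T"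
    using l by (auto simp: lin_on_def)
  show "component c (\<Sum>n\<in>N'. f n) = (\<Sum>n\<in>N'. component c (f n))" by (rule lin_on_sum[OF cvs.subspace_UNIV l]) simp
  show "component c 0 = 0" by (rule lin_on_zero[OF cvs.subspace_UNIV l])
qed

lemma trilinear_eqI:
  assumes "T \<in> trilinears" "U \<in> trilinears" "\<And>c. c \<in> labelings \<Longrightarrow> component c T = component c U"
  shows "T = U"
  using embed_component[OF assms(1)] embed_component[OF assms(2)] assms(3) by (metis (no_types, lifting) sum.cong)

text \<open>The eigenvalues of the rotation in the factors multiply, so the exponents add
  up.\<close>

lemma component_rot: "component c (tensor_op K A (\<lambda>_. rot6) T) = ((- 1 - omega) ^ (\<Sum>i\<in>K. wt (c i))) *\<^sub>C component c T"
  unfolding component_def tensor_op_top[OF K] conv_proj_rot tensor_op_scale[OF K] by (simp only: power_sum)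

lemma component_swap: "component c (tensor_op K A (\<lambda>_. swap6) T) = (\<Prod>i\<in>K. sgl (c i)) *\<^sub>C component (\<lambda>i. flip (c i)) T"
  unfolding component_def tensor_op_top[OF K] conv_proj_swap tensor_op_scale[OF K] ..

lemma component_pol: "component c (tensor_op K A (\<lambda>_. pol6) T) = (\<Prod>i\<in>K. poll (c i)) *\<^sub>C (\<Sum>d\<in>(\<Pi>\<^sub>E i\<in>K. cls (c i)). component d T)"
  unfolding component_def tensor_op_top[OF K] conv_proj_pol tensor_op_scale[OF K] tensor_op_sum[OF K finite_label, where a = "\<lambda>i. proj"] ..

lemma tensor_op_perm_eq_iff:
  assumes T: "T \<in> trilinears" and m: "m < 6" and a: "\<And>s. s < 6 \<Longrightarrow> a s = of_bool (s = m)"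
  shows "tensor_op K A (\<lambda>_. a) T = T \<longleftrightarrow> (\<forall>X\<in>Pi\<^sub>E K (cubes A). T (\<lambda>i\<in>K. pm m (X i)) = T X)"
proof -
  have "tensor_op K A (\<lambda>_. a) T = tensor_op K A (\<lambda>_ s. of_bool (s = m)) T" by (rule tensor_op_cong6) (simp add: a)
  then have "tensor_op K A (\<lambda>_. a) T X = on_set (Pi\<^sub>E K (cubes A)) (\<lambda>X. T (\<lambda>i\<in>K. pm m (X i))) X" for X
    using tensor_op_perm[OF K m, of X A T] by (cases "X \<in> Pi\<^sub>E K (cubes A)") (auto simp: on_set_def tensor_op_def)
  then show ?thesis using sep_outside[OF T] by (auto simp: fun_eq_iff on_set_def)
qed

text \<open>A rotation and a transposition generate S_3; the remaining elements are reached as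
  products of at most two of these generators.\<close>

lemma invariant_iff:
  assumes T: "T \<in> trilinears"
  shows "(\<forall>s<6. \<forall>X\<in>Pi\<^sub>E K (cubes A). T (\<lambda>i\<in>K. pm s (X i)) = T X) \<longleftrightarrow> tensor_op K A (\<lambda>_. rot6) T = T \<and> tensor_op K A (\<lambda>_. swap6) T = T"
proof -
  have r: "tensor_op K A (\<lambda>_. rot6) T = T \<longleftrightarrow> (\<forall>X\<in>Pi\<^sub>E K (cubes A). T (\<lambda>i\<in>K. pm 1 (X i)) = T X)"
    by (rule tensor_op_perm_eq_iff[OF T]) (auto simp: rot6_def vec6_def)
  have s: "tensor_op K A (\<lambda>_. swap6) T = T \<longleftrightarrow> (\<forall>X\<in>Pi\<^sub>E K (cubes A). T (\<lambda>i\<in>K. pm 3 (X i)) = T X)"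
    by (rule tensor_op_perm_eq_iff[OF T]) (auto simp: swap6_def vec6_def)
  show ?thesis
    unfolding r s
  proof (intro iffI conjI allI impI ballI)
    fix s :: nat and X
    assume h: "(\<forall>X\<in>Pi\<^sub>E K (cubes A). T (\<lambda>i\<in>K. pm 1 (X i)) = T X) \<and> (\<forall>X\<in>Pi\<^sub>E K (cubes A). T (\<lambda>i\<in>K. pm 3 (X i)) = T X)"
      and s6: "s < 6" and X: "X \<in> Pi\<^sub>E K (cubes A)"
    have c: "T (\<lambda>i\<in>K. pm (pm_mult t u) (X i)) = T (\<lambda>i\<in>K. pm u (X i))" if "t = 1 \<or> t = 3" "u < 6" for t u
    proof -
      have "T (\<lambda>i\<in>K. pm t ((\<lambda>i\<in>K. pm u (X i)) i)) = T (\<lambda>i\<in>K. pm u (X i))"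
        using h PiE_pm[OF X, of "\<lambda>_. u"] that(1) by blast
      moreover have "(\<lambda>i\<in>K. pm t ((\<lambda>i\<in>K. pm u (X i)) i)) = (\<lambda>i\<in>K. pm (pm_mult t u) (X i))"
        using that by (auto simp: pm_pm)
      ultimately show ?thesis by simp
    qed
    have "T (\<lambda>i\<in>K. pm 0 (X i)) = T X"
    proof -
      have "(\<lambda>i\<in>K. pm 0 (X i)) = X" using X by (auto simp: fun_eq_iff PiE_iff extensional_def)
      then show ?thesis by simp
    qed
    then show "T (\<lambda>i\<in>K. pm s (X i)) = T X"
      using less_6_cases[OF s6] c[of 1 0] c[of 1 1] c[of 3 0] c[of 1 3] c[of 3 1]
      by (elim disjE) (simp_all add: pm_mult_def)
  qed auto
qed

text \<open>In one direction, polarisation in one factor after another removes the restriction that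
  the first two arguments agree. In the other, transposing them changes nothing at (x, x, y), so the
  operator multiplies the value there by a power of 2.\<close>

lemma vanishing_iff:
  assumes T: "T \<in> trilinears"
  shows "(\<forall>x\<in>Pi\<^sub>E K A. \<forall>y\<in>Pi\<^sub>E K A. T (zip3 x x y) = 0) \<longleftrightarrow> tensor_op K A (\<lambda>_. pol6) T = 0"
proof
  assume h: "\<forall>x\<in>Pi\<^sub>E K A. \<forall>y\<in>Pi\<^sub>E K A. T (zip3 x x y) = 0"
  \<comment> \<open>\<open>F\<close> is the set of factors already symmetrised; in the others the
    first two arguments still agree.\<close>
  have "\<forall>X\<in>Pi\<^sub>E K (cubes A). (\<forall>i\<in>K - F. fst (X i) = fst (snd (X i))) \<longrightarrow> tensor_op K A (\<lambda>i. if i \<in> F then pol6 else unit6) T X = 0"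
    if "F \<subseteq> K" for F
    using finite_subset[OF that K] that
  proof (induction F rule: finite_induct)
    case empty
    show ?case
    proof (intro ballI impI)
      fix X assume X: "X \<in> Pi\<^sub>E K (cubes A)" and d: "\<forall>i\<in>K - {}. fst (X i) = fst (snd (X i))"
      let ?x = "\<lambda>i\<in>K. fst (X i)" and ?y = "\<lambda>i\<in>K. snd (snd (X i))"
      have "?x \<in> Pi\<^sub>E K A" "?y \<in> Pi\<^sub>E K A" using X by (auto simp: PiE_iff cube_def)
      moreover have "X = zip3 ?x ?x ?y"
        by (rule trans[OF PiE_zip3[OF X]], unfold zip3_def, rule restrict_ext) (use d in simp)
      ultimately have "T X = 0" using h by metis
      then show "tensor_op K A (\<lambda>i. if i \<in> {} then pol6 else unit6) T X = 0"
        using tensor_op_unit[OF K, of A T, OF sep_outside[OF T]] by simp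
    qed
  next
    case (insert i F)
    let ?U = "tensor_op K A (\<lambda>i. if i \<in> F then pol6 else unit6) T"
    have i: "i \<in> K" using insert.prems by simp
    have U: "?U \<in> trilinears" by (rule tensor_op_trilinears[OF T])
    have e: "tensor_op K A (\<lambda>j. if j \<in> insert i F then pol6 else unit6) T = tensor_op K A ((\<lambda>_. unit6)(i := pol6)) ?U"
      unfolding tensor_op_top[OF K] using insert.hyps by (intro tensor_op_cong6) (auto simp: conv_unit6)
    show ?case
    proof (intro ballI impI)
      fix X assume X: "X \<in> Pi\<^sub>E K (cubes A)" and d: "\<forall>j\<in>K - insert i F. fst (X j) = fst (snd (X j))"
      define g where "g = (\<lambda>t. ?U (X(i := t)))"
      have g: "g \<in> tri (A i)" unfolding g_def by (rule sepD[OF U X i])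
      have g0: "g (u, u, z) = 0" if "u \<in> A i" "z \<in> A i" for u z
      proof -
        have "(u, u, z) \<in> cube (A i)" using that by (simp add: cube_def)
        then have "X(i := (u, u, z)) \<in> Pi\<^sub>E K (cubes A)" by (rule PiE_updD[OF X i])
        moreover have "\<forall>j\<in>K - F. fst ((X(i := (u, u, z))) j) = fst (snd ((X(i := (u, u, z))) j))" using d by auto
        ultimately show ?thesis using insert.IH insert.prems unfolding g_def by blast
      qed
      obtain x y z where Xi: "X i = (x, y, z)" by (cases "X i")
      have m: "x \<in> A i" "y \<in> A i" "z \<in> A i" using PiE_mem[OF X i] by (auto simp: Xi cube_def)
      have xy: "x + y \<in> A i" by (rule cvs.subspace_add[OF A[OF i] m(1,2)])
      \<comment> \<open>A function that is bilinear in two arguments and zero when they agree is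
        alternating in them, hence killed by symmetrising.\<close>
      have "0 = g (x + y, x + y, z)" using g0[OF xy m(3)] by simp
      also have "\<dots> = g (x, x + y, z) + g (y, x + y, z)" by (rule lin_on_add[OF triD(2)[OF g xy m(3)] m(1,2)])
      also have "\<dots> = (g (x, x, z) + g (x, y, z)) + (g (y, x, z) + g (y, y, z))"
        by (intro arg_cong2[where f="(+)"] lin_on_add[OF triD(3)[OF g m(1) m(3)] m(1,2)] lin_on_add[OF triD(3)[OF g m(2) m(3)] m(1,2)])
      finally have "g (x, y, z) + g (y, x, z) = 0" using g0 m by simp
      then have "perm_op pol6 g (X i) = 0" unfolding perm_op_def sum_less_6 Xi by (simp add: pol6_def)
      then show "tensor_op K A (\<lambda>j. if j \<in> insert i F then pol6 else unit6) T X = 0"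
        unfolding e tensor_op_one_hot[OF K i X] g_def .
    qed
  qed
  from this[of K] have "tensor_op K A (\<lambda>i. if i \<in> K then pol6 else unit6) T X = 0" for X
    by (cases "X \<in> Pi\<^sub>E K (cubes A)") (auto simp: tensor_op_def on_set_def)
  moreover have "tensor_op K A (\<lambda>i. if i \<in> K then pol6 else unit6) T = tensor_op K A (\<lambda>_. pol6) T" by (rule tensor_op_cong) simp
  ultimately show "tensor_op K A (\<lambda>_. pol6) T = 0" by (auto simp: fun_eq_iff)
next
  assume h: "tensor_op K A (\<lambda>_. pol6) T = 0"
  show "\<forall>x\<in>Pi\<^sub>E K A. \<forall>y\<in>Pi\<^sub>E K A. T (zip3 x x y) = 0"
  proof (intro ballI)
    fix x y assume x: "x \<in> Pi\<^sub>E K A" and y: "y \<in> Pi\<^sub>E K A"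
    let ?X = "zip3 x x y"
    have X: "?X \<in> Pi\<^sub>E K (cubes A)" using x y by (auto simp: zip3_PiE)
    \<comment> \<open>Only the indices 0 and 3 have a coefficient, and neither of them changes (x,
      x, y).\<close>
    have "(\<Prod>i\<in>K. pol6 (s i)) * T (\<lambda>i\<in>K. pm (s i) (?X i)) = (\<Prod>i\<in>K. pol6 (s i)) * T ?X" for s
    proof (cases "\<forall>i\<in>K. s i = 0 \<or> s i = 3")
      case True
      then have "(\<lambda>i\<in>K. pm (s i) (?X i)) = ?X" by (auto simp: zip3_def fun_eq_iff)
      then show ?thesis by simp
    next
      case False
      then have "(\<Prod>i\<in>K. pol6 (s i)) = 0" using K by (intro prod_zero) (auto simp: pol6_def vec6_def)
      then show ?thesis by simp
    qed
    then have "tensor_op K A (\<lambda>_. pol6) T ?X = (\<Sum>s\<in>(\<Pi>\<^sub>E i\<in>K. {..<6}). \<Prod>i\<in>K. pol6 (s i)) * T ?X"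
      unfolding tensor_op_def on_set_in[OF X] sum_distrib_right by (intro sum.cong refl)
    also have "(\<Sum>s\<in>(\<Pi>\<^sub>E i\<in>K. {..<6}). \<Prod>i\<in>K. pol6 (s i)) = (\<Prod>i\<in>K. \<Sum>s<6. pol6 s)"
      using K by (intro prod_sum_PiE[symmetric]) auto
    also have "\<dots> = (\<Prod>i\<in>K. 2)" unfolding sum_less_6 by (simp add: pol6_def)
    finally show "T ?X = 0" using h by simp
  qed
qed

text \<open>Equations between trilinear functions are tested on components, where the operators
  become scalars and relabellings. The last condition is void as soon as one factor is alternating,
  because its coefficient \<open>poll\<close> is then 0.\<close>

lemma cub_iff:
  assumes T: "T \<in> trilinears"
  shows "T \<in> cub \<longleftrightarrow> (\<forall>c\<in>labelings. (\<not> 3 dvd (\<Sum>i\<in>K. wt (c i)) \<longrightarrow> component c T = 0) \<and>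
     (\<Prod>i\<in>K. sgl (c i)) *\<^sub>C component (\<lambda>i\<in>K. flip (c i)) T = component c T \<and>
     ((\<forall>i\<in>K. c i \<noteq> Al) \<longrightarrow> (\<Sum>d\<in>(\<Pi>\<^sub>E i\<in>K. cls (c i)). component d T) = 0))"
proof -
  have t: "tensor_op K A a T = T \<longleftrightarrow> (\<forall>c\<in>labelings. component c (tensor_op K A a T) = component c T)" for a
    using trilinear_eqI[OF tensor_op_trilinears[OF T] T] by metis
  have z: "0 \<in> trilinears" by (rule cvs.subspace_0[OF subspace_trilinears])
  have v: "tensor_op K A a T = 0 \<longleftrightarrow> (\<forall>c\<in>labelings. component c (tensor_op K A a T) = 0)" for a
    using trilinear_eqI[OF tensor_op_trilinears[OF T] z] by (metis component_linear(4))
  have sc: "a *\<^sub>C x = x \<longleftrightarrow> a = 1 \<or> x = 0" for a and x :: "('i \<Rightarrow> 'v \<times> 'v \<times> 'v) \<Rightarrow> complex"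
    by (auto simp: fun_eq_iff scaleC_fun_apply)
  have sc0: "a *\<^sub>C x = 0 \<longleftrightarrow> a = 0 \<or> x = 0" for a and x :: "('i \<Rightarrow> 'v \<times> 'v \<times> 'v) \<Rightarrow> complex"
    by (auto simp: fun_eq_iff scaleC_fun_apply)
  have p: "(\<Prod>i\<in>K. poll (c i)) = 0 \<longleftrightarrow> \<not> (\<forall>i\<in>K. c i \<noteq> Al)" for c
  proof -
    have "poll l = 0 \<longleftrightarrow> l = Al" for l by (cases l) auto
    then show ?thesis using K by simp
  qed
  have f: "component (\<lambda>i. flip (c i)) T = component (\<lambda>i\<in>K. flip (c i)) T" for c
    unfolding component_def by (rule tensor_op_cong) simp
  have "T \<in> cub \<longleftrightarrow> tensor_op K A (\<lambda>_. rot6) T = T \<and> tensor_op K A (\<lambda>_. swap6) T = T \<and> tensor_op K A (\<lambda>_. pol6) T = 0"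
    unfolding cub_def using T invariant_iff[OF T] vanishing_iff[OF T] by blast
  then show ?thesis
    unfolding t v component_rot component_swap component_pol sc sc0 omega_power p f by blast
qed

end

section \<open>Counting\<close>

text \<open>The values are those of a roots-of-unity filter: the sum of omega^(|S| + |M| + s) over
  all M is omega^s (omega + omega^2)^|S| = omega^s (-1)^|S|. The shift \<open>s\<close> makes the
  induction close, as the recursion passes from s to s + 1 and s + 2.\<close>

lemma count_subsets:
  assumes "finite S"
  shows "3 * int (card {M. M \<subseteq> S \<and> 3 dvd card S + card M + s}) =
    (if 3 dvd s then 2 ^ card S + 2 * (-1) ^ card S else 2 ^ card S - (-1) ^ card S)"
  using assms
proof (induction S arbitrary: s rule: finite_induct)
  case empty
  have e: "{M. M \<subseteq> {} \<and> 3 dvd card {} + card M + s} = (if 3 dvd s then {{}} else {})" by auto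
  show ?case unfolding e by simp
next
  case (insert x S)
  let ?P = "\<lambda>s. {M. M \<subseteq> S \<and> 3 dvd card S + card M + s}"
  have fin: "finite (?P s)" for s using insert.hyps(1) by (auto intro: finite_subset[of _ "Pow S"])
  \<comment> \<open>The new element enlarges \<open>S\<close> by one, and \<open>M\<close> by one
    exactly when it belongs to \<open>M\<close>: hence the shifts 1 and 2.\<close>
  have "{M. M \<subseteq> insert x S \<and> 3 dvd card (insert x S) + card M + s} = ?P (s + 1) \<union> insert x ` ?P (s + 2)" (is "?A = ?B")
  proof (intro equalityI subsetI)
    fix M assume M: "M \<in> ?A"
    show "M \<in> ?B"
    proof (cases "x \<in> M")
      case True
      have "finite M" using M insert.hyps(1) by (auto intro: finite_subset)
      then have "card M = Suc (card (M - {x}))" using True card_Suc_Diff1 by metis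
      then have "M - {x} \<in> ?P (s + 2)" using M insert.hyps by auto
      then show ?thesis using True by (auto intro!: image_eqI[of _ _ "M - {x}"])
    next
      case False
      then show ?thesis using M insert.hyps by auto
    qed
  next
    fix M assume "M \<in> ?B"
    then show "M \<in> ?A"
    proof
      assume "M \<in> ?P (s + 1)"
      then show ?thesis using insert.hyps by auto
    next
      assume "M \<in> insert x ` ?P (s + 2)"
      then obtain N where N: "M = insert x N" "N \<subseteq> S" "3 dvd card S + card N + (s + 2)" by blast
      have "card M = Suc (card N)" using N insert.hyps by (auto simp: card_insert_if finite_subset)
      then show ?thesis using N insert.hyps by auto
    qed
  qed
  moreover have "card (?P (s + 1) \<union> insert x ` ?P (s + 2)) = card (?P (s + 1)) + card (?P (s + 2))"
  proof -
    have d: "?P (s + 1) \<inter> insert x ` ?P (s + 2) = {}" using insert.hyps by auto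
    have i: "inj_on (insert x) (?P (s + 2))" using insert.hyps by (auto intro!: inj_onI)
    show ?thesis unfolding card_Un_disjoint[OF fin finite_imageI[OF fin] d] card_image[OF i] ..
  qed
  ultimately have "3 * int (card ?A) = 3 * int (card (?P (s + 1))) + 3 * int (card (?P (s + 2)))" by simp
  also have "\<dots> = (if 3 dvd s then 2 ^ card (insert x S) + 2 * (-1) ^ card (insert x S) else 2 ^ card (insert x S) - (-1) ^ card (insert x S))"
  proof -
    have "3 dvd s \<and> \<not> 3 dvd s + 1 \<and> \<not> 3 dvd s + 2 \<or> \<not> 3 dvd s \<and> 3 dvd s + 1 \<and> \<not> 3 dvd s + 2
      \<or> \<not> 3 dvd s \<and> \<not> 3 dvd s + 1 \<and> 3 dvd s + 2" by presburger
    then show ?thesis unfolding insert.IH using insert.hyps by (elim disjE) simp_all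
  qed
  finally show ?case .
qed

definition pivot :: "'i set \<Rightarrow> 'i" where
  "pivot J = (SOME i. i \<in> J)"

lemma pivot: "J \<noteq> {} \<Longrightarrow> pivot J \<in> J"
  unfolding pivot_def by (simp add: some_in_eq)

text \<open>Exactly one of \<open>M\<close> and its complement avoids the pivot, so these sets
  represent the surviving subsets up to complement.\<close>

definition reps :: "'i set \<Rightarrow> 'i set set" where
  "reps J = {M. M \<subseteq> J - {pivot J} \<and> 3 dvd card J + card M}"

lemma card_reps:
  assumes "finite J" "J \<noteq> {}"
  shows "int (card (reps J)) = cubic_mult (card J)"
proof -
  have "finite (J - {pivot J})" and c: "card J = card (J - {pivot J}) + 1"
    using assms pivot[OF assms(2)] card_Suc_Diff1[of J "pivot J"] by simp_all
  \<comment> \<open>The shift 1 accounts for the pivot, which counts in |J| but never lies in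
    M.\<close>
  from count_subsets[OF this(1), of 1] have "3 * int (card (reps J)) = 2 ^ (card J - 1) - (-1) ^ (card J - 1)"
    unfolding reps_def c by (simp add: ac_simps)
  then show ?thesis using three_mult_cubic_mult[of "card J"] by simp
qed

lemma finite_reps: "finite J \<Longrightarrow> finite (reps J)"
  unfolding reps_def by (rule finite_subset[of _ "Pow J"]) auto

text \<open>The copies in \<open>multiple_rep\<close> carry numbers; a fixed enumeration decides
  which subset belongs to which copy.\<close>

definition rep_enum :: "'i set \<Rightarrow> nat \<Rightarrow> 'i set" where
  "rep_enum J = (SOME h. bij_betw h {..<card (reps J)} (reps J))"

lemma rep_enum: "finite J \<Longrightarrow> bij_betw (rep_enum J) {..<card (reps J)} (reps J)"
  unfolding rep_enum_def
  using someI_ex[OF ex_bij_betw_nat_finite[OF finite_reps]] by (simp add: atLeast0LessThan)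

text \<open>The two sums add up to 3 |J|.\<close>

lemma dvd_compl: "finite J \<Longrightarrow> M \<subseteq> J \<Longrightarrow> 3 dvd card J + card (J - M) \<longleftrightarrow> 3 dvd card J + card M"
proof -
  assume J: "finite J" and M: "M \<subseteq> J"
  have "card (J - M) = card J - card M" "card M \<le> card J"
    using J M by (auto simp: card_Diff_subset finite_subset card_mono)
  then show ?thesis by presburger
qed

text \<open>The complement in \<open>J\<close> pairs the subsets not containing the pivot with those containing it.\<close>

lemma sum_subsets_reps:
  fixes f :: "'i set \<Rightarrow> 'b::comm_monoid_add"
  assumes J: "finite J" "J \<noteq> {}" and zero: "\<And>M. M \<subseteq> J \<Longrightarrow> \<not> 3 dvd card J + card M \<Longrightarrow> f M = 0"
    and sym: "\<And>M. M \<subseteq> J \<Longrightarrow> f (J - M) = f M"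
  shows "(\<Sum>M\<in>Pow J. f M) = (\<Sum>n<card (reps J). f (rep_enum J n)) + (\<Sum>n<card (reps J). f (rep_enum J n))"
proof -
  let ?C = "(\<lambda>M. J - M) ` reps J"
  have sub: "reps J \<subseteq> Pow J" by (auto simp: reps_def)
  have "(\<Sum>M\<in>Pow J. f M) = (\<Sum>M\<in>reps J \<union> ?C. f M)"
  proof (rule sum.mono_neutral_right)
    show "finite (Pow J)" using J by simp
    show "reps J \<union> ?C \<subseteq> Pow J" using sub by auto
    show "\<forall>M\<in>Pow J - (reps J \<union> ?C). f M = 0"
    proof
      fix M assume M: "M \<in> Pow J - (reps J \<union> ?C)"
      then have MJ: "M \<subseteq> J" by simp
      show "f M = 0"
      proof (rule ccontr)
        assume "f M \<noteq> 0"
        then have d: "3 dvd card J + card M" using zero[OF MJ] by blast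
        show False
        proof (cases "pivot J \<in> M")
          case True
          then have "J - M \<in> reps J" using d dvd_compl[OF J(1) MJ] by (auto simp: reps_def)
          moreover have "M = J - (J - M)" using MJ by auto
          ultimately show False using M by blast
        next
          case False
          then show False using d M by (auto simp: reps_def)
        qed
      qed
    qed
  qed
  also have "\<dots> = (\<Sum>M\<in>reps J. f M) + (\<Sum>M\<in>?C. f M)"
  proof (rule sum.union_disjoint)
    show "reps J \<inter> ?C = {}" using pivot[OF J(2)] by (auto simp: reps_def)
  qed (use finite_reps[OF J(1)] in auto)
  also have "(\<Sum>M\<in>?C. f M) = (\<Sum>M\<in>reps J. f (J - M))"
    using sub by (subst sum.reindex) (auto intro!: inj_onI)
  also have "\<dots> = (\<Sum>M\<in>reps J. f M)" using sub by (intro sum.cong sym) auto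
  also have "(\<Sum>M\<in>reps J. f M) = (\<Sum>n<card (reps J). f (rep_enum J n))"
    using sum.reindex_bij_betw[OF rep_enum[OF J(1)]] by metis
  finally show ?thesis .
qed

section \<open>The decomposition\<close>

context vs_family
begin

definition lab :: "'i set \<Rightarrow> 'i set \<Rightarrow> 'i set \<Rightarrow> 'i \<Rightarrow> label" where
  "lab I J M = (\<lambda>i\<in>K. if i \<in> I then Sy else if i \<in> J then if i \<in> M then Mi else Pl else Al)"

text \<open>Of the factors in \<open>J\<close>, those in \<open>M\<close> carry the eigenvalue \<open>omega\<close> of the rotation and the others its conjugate.\<close>

definition admissible :: "'i set \<Rightarrow> 'i set \<Rightarrow> 'i set \<Rightarrow> bool" where
  "admissible I J M \<longleftrightarrow> I \<subseteq> K \<and> J \<subseteq> K \<and> I \<inter> J = {} \<and> M \<subseteq> J"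

lemma lab_labelings: "lab I J M \<in> labelings"
  by (auto simp: lab_def)

lemma lab_decode:
  assumes "admissible I J M"
  shows "{i \<in> K. lab I J M i = Sy} = I" "{i \<in> K. lab I J M i = Pl \<or> lab I J M i = Mi} = J" "{i \<in> K. lab I J M i = Mi} = M"
  using assms by (auto simp: lab_def admissible_def)

lemma labelings_lab:
  assumes "c \<in> labelings"
  shows "\<exists>I J M. admissible I J M \<and> c = lab I J M"
proof (intro exI conjI)
  let ?I = "{i \<in> K. c i = Sy}" and ?J = "{i \<in> K. c i = Pl \<or> c i = Mi}" and ?M = "{i \<in> K. c i = Mi}"
  show "admissible ?I ?J ?M" by (auto simp: admissible_def)
  show "c = lab ?I ?J ?M"
  proof
    fix i show "c i = lab ?I ?J ?M i"
      using assms by (cases "i \<in> K"; cases "c i") (auto simp: lab_def PiE_iff extensional_def)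
  qed
qed

lemma finite_sub: "I \<subseteq> K \<Longrightarrow> finite I"
  using K finite_subset by blast

text \<open>\<open>Pl\<close> has weight 1 and \<open>Mi\<close> has weight 2, so a factor in
  \<open>J\<close> counts once and a factor in \<open>M\<close> once more.\<close>

lemma sum_wt_lab:
  assumes "admissible I J M"
  shows "(\<Sum>i\<in>K. wt (lab I J M i)) = card J + card M"
proof -
  have c: "(\<Sum>i\<in>K. if i \<in> S then 1 else 0) = card S" if "S \<subseteq> K" for S
    using that sum.inter_restrict[OF K, of "\<lambda>_. 1::nat" S] by (simp add: Int_absorb1)
  have "(\<Sum>i\<in>K. wt (lab I J M i)) = (\<Sum>i\<in>K. (if i \<in> J then 1 else 0) + (if i \<in> M then 1 else 0))"
    using assms by (intro sum.cong refl) (auto simp: lab_def admissible_def)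
  also have "\<dots> = card J + card M"
    using assms c[of J] c[of M] by (simp add: sum.distrib admissible_def subset_trans[of M J K])
  finally show ?thesis .
qed

lemma prod_sgl_lab: "(\<Prod>i\<in>K. sgl (lab I J M i)) = (-1) ^ card (K - I - J)"
proof -
  have "(\<Prod>i\<in>K. sgl (lab I J M i)) = (\<Prod>i\<in>K. if i \<in> K - I - J then - 1 else 1)"
    by (intro prod.cong refl) (auto simp: lab_def)
  also have "\<dots> = (\<Prod>i\<in>K \<inter> (K - I - J). - 1)" by (rule prod.inter_restrict[OF K, symmetric])
  also have "K \<inter> (K - I - J) = K - I - J" by blast
  finally show ?thesis by simp
qed

lemma flip_lab: "admissible I J M \<Longrightarrow> (\<lambda>i\<in>K. flip (lab I J M i)) = lab I J (J - M)"
  by (auto simp: lab_def admissible_def fun_eq_iff)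

text \<open>Symmetric factors leave no choice, and each factor in \<open>J\<close> may carry either
  eigenvalue. Without alternating factors the vanishing condition therefore sums over all subsets of
  \<open>J\<close>.\<close>

lemma cls_lab:
  assumes a: "admissible I J M" and full: "I \<union> J = K"
  shows "(\<Pi>\<^sub>E i\<in>K. cls (lab I J M i)) = lab I J ` Pow J"
proof (intro equalityI subsetI)
  fix c assume c: "c \<in> (\<Pi>\<^sub>E i\<in>K. cls (lab I J M i))"
  let ?M = "{i \<in> J. c i = Mi}"
  have "c = lab I J ?M"
  proof
    fix i
    show "c i = lab I J ?M i"
      using PiE_mem[OF c, of i] c full a
      by (cases "i \<in> K"; cases "i \<in> I"; cases "i \<in> M") (auto simp: lab_def admissible_def PiE_iff extensional_def split: if_splits)
  qed
  then show "c \<in> lab I J ` Pow J" by blast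
next
  fix c assume "c \<in> lab I J ` Pow J"
  then show "c \<in> (\<Pi>\<^sub>E i\<in>K. cls (lab I J M i))"
    using full a by (auto simp: lab_def admissible_def)
qed

lemma inj_on_lab: "I \<subseteq> K \<Longrightarrow> J \<subseteq> K \<Longrightarrow> I \<inter> J = {} \<Longrightarrow> inj_on (lab I J) (Pow J)"
  by (rule inj_onI) (metis PowD admissible_def lab_decode(3))

text \<open>The idempotents for \<open>Pl\<close> and \<open>Mi\<close> have the same image. All
  components with the same \<open>I\<close> and \<open>J\<close> thus lie in one space, where they
  can be added and compared, and count as copies of one module.\<close>

lemma isotypic_lab: "isotypic (lab I J M) = isotypic (lab I J {})"
proof (rule sep_cong)
  fix i assume i: "i \<in> K"
  have "fixed (idem Mi) (tri (A i)) = fixed (idem Pl) (tri (A i))"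
    using conv_idem_flip[of Mi] conv_idem_flip[of Pl] by (intro fixed_eq) (simp_all del: idem.simps)
  then show "fixed (idem (lab I J M i)) (tri (A i)) = fixed (idem (lab I J {} i)) (tri (A i))"
    using i by (auto simp: lab_def simp del: idem.simps)
qed simp

lemma cub_iff_lab:
  assumes T: "T \<in> trilinears"
  shows "T \<in> cub \<longleftrightarrow> (\<forall>I J M. admissible I J M \<longrightarrow>
     (\<not> 3 dvd card J + card M \<longrightarrow> component (lab I J M) T = 0) \<and>
     (-1) ^ card (K - I - J) *\<^sub>C component (lab I J (J - M)) T = component (lab I J M) T \<and>
     (I \<union> J = K \<longrightarrow> (\<Sum>M\<in>Pow J. component (lab I J M) T) = 0))"
proof -
  define P where "P c \<longleftrightarrow> (\<not> 3 dvd (\<Sum>i\<in>K. wt (c i)) \<longrightarrow> component c T = 0) \<and>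
     (\<Prod>i\<in>K. sgl (c i)) *\<^sub>C component (\<lambda>i\<in>K. flip (c i)) T = component c T \<and>
     ((\<forall>i\<in>K. c i \<noteq> Al) \<longrightarrow> (\<Sum>d\<in>(\<Pi>\<^sub>E i\<in>K. cls (c i)). component d T) = 0)" for c
  define Q where "Q I J M \<longleftrightarrow> (\<not> 3 dvd card J + card M \<longrightarrow> component (lab I J M) T = 0) \<and>
     (-1) ^ card (K - I - J) *\<^sub>C component (lab I J (J - M)) T = component (lab I J M) T \<and>
     (I \<union> J = K \<longrightarrow> (\<Sum>M\<in>Pow J. component (lab I J M) T) = 0)" for I J M
  have PQ: "P (lab I J M) \<longleftrightarrow> Q I J M" if a: "admissible I J M" for I J M
  proof -
    have full: "(\<forall>i\<in>K. lab I J M i \<noteq> Al) \<longleftrightarrow> I \<union> J = K" using a by (auto simp: lab_def admissible_def)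
    have s: "(\<Sum>d\<in>(\<Pi>\<^sub>E i\<in>K. cls (lab I J M i)). component d T) = (\<Sum>M\<in>Pow J. component (lab I J M) T)" if "I \<union> J = K"
      unfolding cls_lab[OF a that] using a inj_on_lab[of I J] by (subst sum.reindex) (auto simp: admissible_def)
    show ?thesis unfolding P_def Q_def sum_wt_lab[OF a] prod_sgl_lab flip_lab[OF a] full using s by (simp cong: imp_cong)
  qed
  have "T \<in> cub \<longleftrightarrow> (\<forall>c\<in>labelings. P c)" unfolding P_def by (rule cub_iff[OF T])
  also have "\<dots> \<longleftrightarrow> (\<forall>I J M. admissible I J M \<longrightarrow> Q I J M)"
  proof (intro iffI allI impI ballI)
    fix I J M assume "\<forall>c\<in>labelings. P c" "admissible I J M"
    then show "Q I J M" using lab_labelings PQ by blast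
  next
    fix c assume h: "\<forall>I J M. admissible I J M \<longrightarrow> Q I J M" and c: "c \<in> labelings"
    obtain I J M where "admissible I J M" "c = lab I J M" using labelings_lab[OF c] by blast
    then show "P c" using h PQ by blast
  qed
  finally show ?thesis unfolding Q_def .
qed

section \<open>The three summands and the isomorphism onto their direct sum\<close>

definition X1 :: "('i set \<times> 'i set \<times> 'i set) set" where
  "X1 = {(I, J, L). I \<union> J \<union> L = K \<and> I \<inter> J = {} \<and> I \<inter> L = {} \<and> J \<inter> L = {} \<and> card J > 1 \<and> card L > 0}"

definition X2 :: "('i set \<times> 'i set) set" where
  "X2 = {(I, J). I \<union> J = K \<and> I \<inter> J = {} \<and> card J > 1}"

definition X3 :: "('i set \<times> 'i set) set" where
  "X3 = {(I, L). I \<union> L = K \<and> I \<inter> L = {} \<and> card L > 0 \<and> even (card L)}"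

abbreviation mult1 :: "'i set \<Rightarrow> nat" where
  "mult1 J \<equiv> nat (cubic_mult (card J))"

abbreviation mult2 :: "'i set \<Rightarrow> nat" where
  "mult2 J \<equiv> nat (cubic_mult (card J) - 1)"

definition "summand1 = dsum_rep X1 (\<lambda>(I, J, L). multiple_rep (mult1 J) (frep (lab I J {})))"
definition "summand2 = dsum_rep X2 (\<lambda>(I, J). multiple_rep (mult2 J) (frep (lab I J {})))"
definition "summand3 = dsum_rep X3 (\<lambda>(I, L). frep (lab I {} {}))"

lemma vspace_sums:
  "F \<in> vspace summand1 \<longleftrightarrow> (\<forall>I J L. ((I, J, L) \<in> X1 \<longrightarrow> (\<forall>n. (n < mult1 J \<longrightarrow> F (I, J, L) n \<in> isotypic (lab I J {})) \<and> (\<not> n < mult1 J \<longrightarrow> F (I, J, L) n = 0)))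
     \<and> ((I, J, L) \<notin> X1 \<longrightarrow> F (I, J, L) = 0))"
  "F' \<in> vspace summand2 \<longleftrightarrow> (\<forall>I J. ((I, J) \<in> X2 \<longrightarrow> (\<forall>n. (n < mult2 J \<longrightarrow> F' (I, J) n \<in> isotypic (lab I J {})) \<and> (\<not> n < mult2 J \<longrightarrow> F' (I, J) n = 0)))
     \<and> ((I, J) \<notin> X2 \<longrightarrow> F' (I, J) = 0))"
  "F'' \<in> vspace summand3 \<longleftrightarrow> (\<forall>I L. ((I, L) \<in> X3 \<longrightarrow> F'' (I, L) \<in> isotypic (lab I {} {})) \<and> ((I, L) \<notin> X3 \<longrightarrow> F'' (I, L) = 0))"
proof -
  have m: "F \<in> vspace (multiple_rep m (frep c)) \<longleftrightarrow> (\<forall>n. (n < m \<longrightarrow> F n \<in> isotypic c) \<and> (\<not> n < m \<longrightarrow> F n = 0))" for m c F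
    unfolding multiple_rep_def dsum_rep_simps frep_def by auto
  show "F \<in> vspace summand1 \<longleftrightarrow> (\<forall>I J L. ((I, J, L) \<in> X1 \<longrightarrow> (\<forall>n. (n < mult1 J \<longrightarrow> F (I, J, L) n \<in> isotypic (lab I J {})) \<and> (\<not> n < mult1 J \<longrightarrow> F (I, J, L) n = 0)))
     \<and> ((I, J, L) \<notin> X1 \<longrightarrow> F (I, J, L) = 0))"
    unfolding summand1_def dsum_rep_simps Ball_def split_paired_All mem_Collect_eq prod.case m by blast
  show "F' \<in> vspace summand2 \<longleftrightarrow> (\<forall>I J. ((I, J) \<in> X2 \<longrightarrow> (\<forall>n. (n < mult2 J \<longrightarrow> F' (I, J) n \<in> isotypic (lab I J {})) \<and> (\<not> n < mult2 J \<longrightarrow> F' (I, J) n = 0)))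
     \<and> ((I, J) \<notin> X2 \<longrightarrow> F' (I, J) = 0))"
    unfolding summand2_def dsum_rep_simps Ball_def split_paired_All mem_Collect_eq prod.case m by blast
  show "F'' \<in> vspace summand3 \<longleftrightarrow> (\<forall>I L. ((I, L) \<in> X3 \<longrightarrow> F'' (I, L) \<in> isotypic (lab I {} {})) \<and> ((I, L) \<notin> X3 \<longrightarrow> F'' (I, L) = 0))"
    unfolding summand3_def dsum_rep_simps Ball_def split_paired_All mem_Collect_eq prod.case frep_def linrep.simps by blast
qed

definition Phi1 :: "(('i \<Rightarrow> 'v \<times> 'v \<times> 'v) \<Rightarrow> complex) \<Rightarrow> 'i set \<times> 'i set \<times> 'i set \<Rightarrow> nat \<Rightarrow> ('i \<Rightarrow> 'v \<times> 'v \<times> 'v) \<Rightarrow> complex" where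
  "Phi1 T = (\<lambda>(I, J, L) n. if (I, J, L) \<in> X1 \<and> n < mult1 J then component (lab I J (rep_enum J n)) T else 0)"

text \<open>One representative fewer is read off than in \<open>Phi1\<close>: without alternating
  factors the components sum to zero, so the last representative is determined by the
  others.\<close>

definition Phi2 :: "(('i \<Rightarrow> 'v \<times> 'v \<times> 'v) \<Rightarrow> complex) \<Rightarrow> 'i set \<times> 'i set \<Rightarrow> nat \<Rightarrow> ('i \<Rightarrow> 'v \<times> 'v \<times> 'v) \<Rightarrow> complex" where
  "Phi2 T = (\<lambda>(I, J) n. if (I, J) \<in> X2 \<and> n < mult2 J then component (lab I J (rep_enum J n)) T else 0)"

definition Phi3 :: "(('i \<Rightarrow> 'v \<times> 'v \<times> 'v) \<Rightarrow> complex) \<Rightarrow> 'i set \<times> 'i set \<Rightarrow> ('i \<Rightarrow> 'v \<times> 'v \<times> 'v) \<Rightarrow> complex" where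
  "Phi3 T = (\<lambda>(I, L). if (I, L) \<in> X3 then component (lab I {} {}) T else 0)"

lemma mult1_eq: "finite J \<Longrightarrow> J \<noteq> {} \<Longrightarrow> mult1 J = card (reps J)"
  using card_reps[of J] by (metis nat_int)

text \<open>If there is no representative, both sides are truncated to 0.\<close>

lemma mult2_eq: "finite J \<Longrightarrow> J \<noteq> {} \<Longrightarrow> mult2 J = card (reps J) - 1"
  using card_reps[of J] by (metis nat_diff_distrib' nat_int nat_1 of_nat_1 of_nat_diff nat_minus_as_int One_nat_def zero_le_one of_nat_0_le_iff)

text \<open>Besides the pivot nothing is left, and 1 is not divisible by 3. This is the origin of
  the condition |J| > 1 in the sums.\<close>

lemma card_reps_1: "card J = 1 \<Longrightarrow> card (reps J) = 0"
  using card_reps[of J] by (force simp: cubic_mult_def card_ge_0_finite)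

lemma X1_iff: "(I, J, L) \<in> X1 \<longleftrightarrow> I \<subseteq> K \<and> J \<subseteq> K \<and> I \<inter> J = {} \<and> L = K - I - J \<and> card J > 1 \<and> I \<union> J \<noteq> K"
proof -
  have "I \<union> J \<union> L = K \<Longrightarrow> card L > 0 \<longleftrightarrow> L \<noteq> {}"
    using finite_sub[of L] by (auto simp: card_gt_0_iff)
  then show ?thesis unfolding X1_def mem_Collect_eq prod.case by blast
qed

lemma X2_iff: "(I, J) \<in> X2 \<longleftrightarrow> I \<subseteq> K \<and> J \<subseteq> K \<and> I \<inter> J = {} \<and> card J > 1 \<and> I \<union> J = K"
  unfolding X2_def by auto

lemma X3_iff: "(I, L) \<in> X3 \<longleftrightarrow> I \<subseteq> K \<and> L = K - I \<and> I \<noteq> K \<and> even (card (K - I))"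
proof -
  have "I \<union> L = K \<Longrightarrow> card L > 0 \<longleftrightarrow> L \<noteq> {}"
    using finite_sub[of L] by (auto simp: card_gt_0_iff)
  moreover have "I \<union> L = K \<and> I \<inter> L = {} \<longleftrightarrow> I \<subseteq> K \<and> L = K - I" by blast
  moreover have "I \<subseteq> K \<Longrightarrow> K - I = {} \<longleftrightarrow> I = K" by blast
  ultimately show ?thesis unfolding X3_def mem_Collect_eq prod.case by metis
qed

lemma rep_enum_reps: "finite J \<Longrightarrow> n < card (reps J) \<Longrightarrow> rep_enum J n \<in> reps J"
  using bij_betwE[OF rep_enum] by blast

lemma admissible_reps: "I \<subseteq> K \<Longrightarrow> J \<subseteq> K \<Longrightarrow> I \<inter> J = {} \<Longrightarrow> M \<in> reps J \<Longrightarrow> admissible I J M"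
  by (auto simp: admissible_def reps_def)

lemma Phi_mem:
  assumes T: "T \<in> trilinears"
  shows "Phi1 T \<in> vspace summand1" "Phi2 T \<in> vspace summand2" "Phi3 T \<in> vspace summand3"
proof -
  have "component (lab I J M) T \<in> isotypic (lab I J {})" for I J M
    using component_isotypic[OF T, of "lab I J M"] unfolding isotypic_lab[of I J M] .
  then show "Phi1 T \<in> vspace summand1" "Phi2 T \<in> vspace summand2" "Phi3 T \<in> vspace summand3"
    unfolding vspace_sums Phi1_def Phi2_def Phi3_def by (auto simp: zero_fun_def)
qed

text \<open>Components violating the rotation condition vanish, and those whose \<open>M\<close>
  contains the pivot are determined by their complements, so everything reduces to representatives.
  These are read off by the three maps, apart from the last one for L = {}, which the sum relation
  supplies.\<close>

lemma Phi_kernel: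
  assumes T: "T \<in> cub" and 1: "Phi1 T = 0" and 2: "Phi2 T = 0" and 3: "Phi3 T = 0"
  shows "T = 0"
proof -
  have Tt: "T \<in> trilinears" using T by (simp add: cub_def)
  note C = T[unfolded cub_iff_lab[OF Tt], rule_format]
  have "component (lab I J M) T = 0" if a: "admissible I J M" for I J M
  proof -
    have sub: "I \<subseteq> K" "J \<subseteq> K" "I \<inter> J = {}" "M \<subseteq> J" using a by (auto simp: admissible_def)
    have J: "finite J" using finite_sub sub by blast
    note Ca = C[OF a]
    show ?thesis
    proof (cases "J = {}")
      case True
      then have M: "M = {}" using sub by blast
      consider "I = K" | "I \<noteq> K" "even (card (K - I))" | "odd (card (K - I))" by blast
      then show ?thesis
      proof cases
        case 1
        \<comment> \<open>The only subset of \<open>J\<close> is empty, so the vanishing sum is this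
          component itself.\<close>
        then show ?thesis using Ca True M by simp
      next
        case 2
        then have "(I, K - I) \<in> X3" using sub by (simp add: X3_iff)
        then show ?thesis using fun_cong[OF 3, of "(I, K - I)"] True M by (simp add: Phi3_def)
      next
        case 3
        \<comment> \<open>With an odd number of alternating factors the component equals its own
          negative.\<close>
        then have "- 1 *\<^sub>C component (lab I J M) T = component (lab I J M) T" using Ca True M by simp
        then show ?thesis by (auto simp: fun_eq_iff scaleC_fun_apply)
      qed
    next
      case nonempty: False
      have enum: "component (lab I J (rep_enum J n)) T = 0" if n: "n < card (reps J)" for n
      proof -
        have "card J \<noteq> 1" using n card_reps_1 by force
        moreover have "card J > 0" using J nonempty by (simp add: card_gt_0_iff)
        ultimately have cJ: "card J > 1" by linarith
        show ?thesis
        proof (cases "I \<union> J = K")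
          case False
          have "(I, J, K - I - J) \<in> X1" using sub cJ False by (simp add: X1_iff)
          then show ?thesis
            using fun_cong[OF fun_cong[OF 1], of "(I, J, K - I - J)" n] n mult1_eq[OF J nonempty] by (simp add: Phi1_def)
        next
          case True
          have "(I, J) \<in> X2" using sub cJ True by (simp add: X2_iff)
          then have z: "component (lab I J (rep_enum J m)) T = 0" if "m < card (reps J) - 1" for m
            using fun_cong[OF fun_cong[OF 2], of "(I, J)" m] that mult2_eq[OF J nonempty] by (simp add: Phi2_def)
          show ?thesis
          proof (cases "n < card (reps J) - 1")
            case False
            then have n': "card (reps J) = Suc n" using n by linarith
            have L: "K - I - J = {}" using True by blast
            \<comment> \<open>All earlier representatives vanish and complements double the rest, so
              the relation says that twice the last component is zero.\<close>
            have "0 = (\<Sum>M\<in>Pow J. component (lab I J M) T)" using Ca True by simp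
            also have "\<dots> = (\<Sum>m<card (reps J). component (lab I J (rep_enum J m)) T) + (\<Sum>m<card (reps J). component (lab I J (rep_enum J m)) T)"
            proof (rule sum_subsets_reps[OF J nonempty])
              fix M assume "M \<subseteq> J"
              then have "admissible I J M" using sub by (simp add: admissible_def)
              note C[OF this]
              then show "\<not> 3 dvd card J + card M \<Longrightarrow> component (lab I J M) T = 0" "component (lab I J (J - M)) T = component (lab I J M) T"
                using L by (auto simp: scaleC_one)
            qed
            also have "(\<Sum>m<card (reps J). component (lab I J (rep_enum J m)) T) = component (lab I J (rep_enum J n)) T"
              using z n' by simp
            finally show ?thesis by (auto simp: fun_eq_iff)
          qed (use z in blast)
        qed
      qed
      have rep: "component (lab I J M) T = 0" if "M \<in> reps J" for M
        using bij_betw_imp_surj_on[OF rep_enum[OF J]] that enum by (metis imageE lessThan_iff)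
      show ?thesis
      proof (cases "3 dvd card J + card M")
        case True
        show ?thesis
        proof (cases "pivot J \<in> M")
          case False
          then show ?thesis using rep[of M] sub True by (auto simp: reps_def)
        next
          case p: True
          then have "J - M \<in> reps J" using dvd_compl[OF J sub(4)] True by (auto simp: reps_def)
          then have "component (lab I J (J - M)) T = 0" by (rule rep)
          then show ?thesis using Ca by (metis cvs.scale_zero_right)
        qed
      qed (use Ca in blast)
    qed
  qed
  then have "component c T = 0" if "c \<in> labelings" for c using labelings_lab[OF that] by blast
  then show ?thesis
    using trilinear_eqI[OF Tt cvs.subspace_0[OF subspace_trilinears]] component_linear(4) by simp
qed

text \<open>A preimage is assembled by prescribing its components and adding up their embeddings.
  Values on representatives are given by the data; all others are forced by the conditions on
  \<open>cub\<close>, and the resulting family satisfies them.\<close>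

lemma Phi_surj:
  assumes 1: "F1 \<in> vspace summand1" and 2: "F2 \<in> vspace summand2" and 3: "F3 \<in> vspace summand3"
  shows "\<exists>T\<in>cub. Phi1 T = F1 \<and> Phi2 T = F2 \<and> Phi3 T = F3"
proof -
  note S = 1[unfolded vspace_sums] 2[unfolded vspace_sums] 3[unfolded vspace_sums]
  define q where "q = (\<lambda>I J n. if I \<union> J \<noteq> K then F1 (I, J, K - I - J) n
     else if n < card (reps J) - 1 then F2 (I, J) n else - (\<Sum>m<card (reps J) - 1. F2 (I, J) m))"
  \<comment> \<open>If \<open>I \<union> J = K\<close>, the last component is dictated by the vanishing of the sum over all \<open>M \<subseteq> J\<close>.\<close>
  define r where "r = (\<lambda>I J M. q I J (inv_into {..<card (reps J)} (rep_enum J) M))"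
  \<comment> \<open>Off the representatives the value is forced: 0 if the rotation condition fails,
    and the signed value at the complement if \<open>M\<close> contains the pivot.\<close>
  define H where "H = (\<lambda>I J M. if J = {} then F3 (I, K - I) else if \<not> 3 dvd card J + card M then 0
     else if pivot J \<notin> M then r I J M else (-1) ^ card (K - I - J) *\<^sub>C r I J (J - M))"
  have sub_iso: "cvs.subspace (isotypic c)" for c
    by (intro subspace_sep subspace_fixed pm_stable_tri)
  have cJ: "card J > 1" if "finite J" "J \<noteq> {}" "n < card (reps J)" for J :: "'i set" and n
    using that card_reps_1[of J] card_gt_0_iff[of J] by (cases "card J = 1") auto
  have q: "q I J n \<in> isotypic (lab I J {})" if a: "admissible I J {}" and J: "J \<noteq> {}" and n: "n < card (reps J)" for I J n
  proof -
    have sub: "I \<subseteq> K" "J \<subseteq> K" "I \<inter> J = {}" using a by (auto simp: admissible_def)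
    note fJ = finite_sub[OF sub(2)]
    show ?thesis
    proof (cases "I \<union> J = K")
      case False
      then have "(I, J, K - I - J) \<in> X1" using sub cJ[OF fJ J n] by (simp add: X1_iff)
      then show ?thesis using S(1) n False by (simp add: q_def mult1_eq[OF fJ J])
    next
      case True
      then have "(I, J) \<in> X2" using sub cJ[OF fJ J n] by (simp add: X2_iff)
      then have m: "F2 (I, J) m \<in> isotypic (lab I J {})" if "m < card (reps J) - 1" for m
        using S(2) that by (simp add: mult2_eq[OF fJ J])
      then have "- (\<Sum>m<card (reps J) - 1. F2 (I, J) m) \<in> isotypic (lab I J {})"
        by (intro cvs.subspace_neg[OF sub_iso] cvs.subspace_sum[OF sub_iso]) simp
      moreover have "q I J n = (if n < card (reps J) - 1 then F2 (I, J) n else - (\<Sum>m<card (reps J) - 1. F2 (I, J) m))"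
        using True by (simp add: q_def)
      ultimately show ?thesis using m by presburger
    qed
  qed
  have r_enum: "r I J (rep_enum J n) = q I J n" if "finite J" "n < card (reps J)" for I J n
    unfolding r_def using bij_betw_inv_into_left[OF rep_enum[OF that(1)]] that(2) by simp
  have r: "r I J M \<in> isotypic (lab I J {})" if a: "admissible I J {}" and J: "J \<noteq> {}" and M: "M \<in> reps J" for I J M
  proof -
    have fJ: "finite J" using a finite_sub by (simp add: admissible_def)
    have "M \<in> rep_enum J ` {..<card (reps J)}" using M by (simp only: bij_betw_imp_surj_on[OF rep_enum[OF fJ]])
    then obtain n where "M = rep_enum J n" "n \<in> {..<card (reps J)}" by (rule imageE)
    then show ?thesis using q[OF a J] r_enum[OF fJ] by simp
  qed
  have compl: "J - M \<in> reps J" if "J \<subseteq> K" "M \<subseteq> J" "pivot J \<in> M" "3 dvd card J + card M" for J M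
    using dvd_compl[OF finite_sub[OF that(1)] that(2)] that by (auto simp: reps_def)
  have H: "H I J M \<in> isotypic (lab I J {})" if a: "admissible I J M" for I J M
  proof -
    have sub: "I \<subseteq> K" "J \<subseteq> K" "I \<inter> J = {}" "M \<subseteq> J" and a': "admissible I J {}" using a by (auto simp: admissible_def)
    have "F3 (I, K - I) \<in> isotypic (lab I {} {})"
      using S(3) cvs.subspace_0[OF sub_iso] by (cases "(I, K - I) \<in> X3") auto
    moreover have "r I J M \<in> isotypic (lab I J {})" if "J \<noteq> {}" "3 dvd card J + card M" "pivot J \<notin> M"
      using that sub by (intro r a') (auto simp: reps_def)
    moreover have "r I J (J - M) \<in> isotypic (lab I J {})" if "J \<noteq> {}" "3 dvd card J + card M" "pivot J \<in> M"
      using that sub by (intro r a' compl) auto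
    ultimately show ?thesis
      by (auto simp: H_def intro: cvs.subspace_0[OF sub_iso] cvs.subspace_scale[OF sub_iso])
  qed
  \<comment> \<open>Components are indexed by labellings, from which the three sets can be
    decoded.\<close>
  define H' where "H' = (\<lambda>c. H {i \<in> K. c i = Sy} {i \<in> K. c i = Pl \<or> c i = Mi} {i \<in> K. c i = Mi})"
  have H'_lab: "H' (lab I J M) = H I J M" if "admissible I J M" for I J M
    unfolding H'_def lab_decode[OF that] ..
  have H': "H' c \<in> isotypic c" if c': "c \<in> labelings" for c
  proof -
    obtain I J M where a: "admissible I J M" and c: "c = lab I J M" using labelings_lab[OF c'] by blast
    show ?thesis unfolding c H'_lab[OF a] isotypic_lab[of I J M] by (rule H[OF a])
  qed
  define T where "T = (\<Sum>c\<in>labelings. embed c (H' c))"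
  have T: "T \<in> trilinears"
    unfolding T_def embed_def
    by (intro cvs.subspace_sum[OF subspace_trilinears] tensor_op_trilinears) (use H' in \<open>auto simp: isotypic_eq\<close>)
  have "component c T = H' c" if c: "c \<in> labelings" for c
  proof -
    have "component c T = (\<Sum>d\<in>labelings. if c = d then H' d else 0)"
      unfolding T_def component_linear by (intro sum.cong refl component_embed H' c)
    also have "\<dots> = H' c" using c finite_labelings by simp
    finally show ?thesis .
  qed
  then have component: "component (lab I J M) T = H I J M" if "admissible I J M" for I J M
    using lab_labelings H'_lab[OF that] by simp
  have sq: "(-1) ^ n *\<^sub>C (-1) ^ n *\<^sub>C x = (x :: ('i \<Rightarrow> 'v \<times> 'v \<times> 'v) \<Rightarrow> complex)" for n :: nat and x
    by (simp add: scaleC_scaleC power_add[symmetric] scaleC_one)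
  have swap: "(-1) ^ card (K - I - J) *\<^sub>C H I J (J - M) = H I J M" if a: "admissible I J M" for I J M
  proof (cases "J = {}")
    case True
    show ?thesis
    proof (cases "even (card (K - I))")
      case False
      \<comment> \<open>An odd number of alternating factors is excluded from \<open>X3\<close>,
        where \<open>F3\<close> is 0, and thus the sign does no harm.\<close>
      then have "(I, K - I) \<notin> X3" by (simp add: X3_iff)
      then show ?thesis using S(3) True by (simp add: H_def)
    qed (simp add: H_def True scaleC_one)
  next
    case False
    have sub: "J \<subseteq> K" "M \<subseteq> J" using a by (auto simp: admissible_def)
    have d: "3 dvd card J + card (J - M) \<longleftrightarrow> 3 dvd card J + card M" by (rule dvd_compl[OF finite_sub[OF sub(1)] sub(2)])
    have "J - (J - M) = M" using sub by blast
    then show ?thesis using False d pivot[OF False] by (auto simp: H_def sq)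
  qed
  have total: "(\<Sum>M\<in>Pow J. H I J M) = 0" if a: "admissible I J {}" and full: "I \<union> J = K" for I J
  proof (cases "J = {}")
    case True
    \<comment> \<open>Here \<open>I\<close> is all of \<open>K\<close>, and the pair with empty L is
      excluded from \<open>X3\<close>.\<close>
    then have "(I, K - I) \<notin> X3" using full by (simp add: X3_iff)
    then show ?thesis using S(3) True by (simp add: H_def)
  next
    case False
    have sub: "I \<subseteq> K" "J \<subseteq> K" "I \<inter> J = {}" using a by (auto simp: admissible_def)
    note fJ = finite_sub[OF sub(2)]
    have L: "K - I - J = {}" using full by blast
    have "(\<Sum>M\<in>Pow J. H I J M) = (\<Sum>n<card (reps J). H I J (rep_enum J n)) + (\<Sum>n<card (reps J). H I J (rep_enum J n))"
    proof (rule sum_subsets_reps[OF fJ False])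
      fix M assume M: "M \<subseteq> J"
      show "\<not> 3 dvd card J + card M \<Longrightarrow> H I J M = 0" using False by (simp add: H_def)
      have "admissible I J M" using sub M by (simp add: admissible_def)
      from swap[OF this] show "H I J (J - M) = H I J M" using L by (simp add: scaleC_one)
    qed
    also have "(\<Sum>n<card (reps J). H I J (rep_enum J n)) = (\<Sum>n<card (reps J). q I J n)"
      using rep_enum_reps[OF fJ] False by (intro sum.cong refl) (auto simp: H_def r_enum[OF fJ] reps_def)
    also have "\<dots> = 0"
    proof (cases "card (reps J)")
      case (Suc n)
      \<comment> \<open>The last summand is by definition minus the sum of the preceding
        ones.\<close>
      then show ?thesis using full by (simp add: q_def)
    qed simp
    finally show ?thesis by (simp only: add_0_left)
  qed
  have cub: "T \<in> cub"
    unfolding cub_iff_lab[OF T]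
  proof (intro allI impI conjI)
    fix I J M assume a: "admissible I J M"
    have a': "admissible I J N" if "N \<subseteq> J" for N using a that by (auto simp: admissible_def)
    show "component (lab I J M) T = 0" if "\<not> 3 dvd card J + card M"
    proof -
      have "J \<noteq> {}" using that a by (auto simp: admissible_def)
      then show ?thesis using that by (simp add: component[OF a] H_def)
    qed
    show "(-1) ^ card (K - I - J) *\<^sub>C component (lab I J (J - M)) T = component (lab I J M) T"
      unfolding component[OF a] component[OF a'[OF Diff_subset]] by (rule swap[OF a])
    show "(\<Sum>M\<in>Pow J. component (lab I J M) T) = 0" if "I \<union> J = K"
      using total[OF a'[OF empty_subsetI] that] component[OF a'] by simp
  qed
  have enum: "component (lab I J (rep_enum J n)) T = q I J n" if "admissible I J {}" "J \<noteq> {}" "n < card (reps J)" for I J n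
  proof -
    have sub: "I \<subseteq> K" "J \<subseteq> K" "I \<inter> J = {}" using that by (auto simp: admissible_def)
    have R: "rep_enum J n \<in> reps J" by (rule rep_enum_reps[OF finite_sub[OF sub(2)] that(3)])
    have "component (lab I J (rep_enum J n)) T = H I J (rep_enum J n)"
      by (rule component[OF admissible_reps[OF sub R]])
    also have "\<dots> = r I J (rep_enum J n)" using R that(2) by (auto simp: H_def reps_def)
    finally show ?thesis using r_enum[OF finite_sub[OF sub(2)] that(3)] by simp
  qed
  have "Phi1 T (I, J, L) n = F1 (I, J, L) n" for I J L n
  proof (cases "(I, J, L) \<in> X1 \<and> n < mult1 J")
    case True
    then have x: "I \<subseteq> K" "J \<subseteq> K" "I \<inter> J = {}" "L = K - I - J" "J \<noteq> {}" "I \<union> J \<noteq> K" by (auto simp: X1_iff)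
    have "admissible I J {}" using x by (simp add: admissible_def)
    from enum[OF this x(5), of n] show ?thesis
      using True x mult1_eq[OF finite_sub[OF x(2)] x(5)] by (simp add: Phi1_def q_def)
  next
    case False
    then show ?thesis using S(1) by (cases "(I, J, L) \<in> X1") (simp_all add: Phi1_def)
  qed
  moreover have "Phi2 T (I, J) n = F2 (I, J) n" for I J n
  proof (cases "(I, J) \<in> X2 \<and> n < mult2 J")
    case True
    then have x: "I \<subseteq> K" "J \<subseteq> K" "I \<inter> J = {}" "J \<noteq> {}" "I \<union> J = K" by (auto simp: X2_iff)
    have "admissible I J {}" using x by (simp add: admissible_def)
    moreover have "n < card (reps J) - 1" using True mult2_eq[OF finite_sub[OF x(2)] x(4)] by simp
    ultimately show ?thesis
      using enum[OF _ x(4), of I n] True x(5) by (simp add: Phi2_def q_def)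
  next
    case False
    then show ?thesis using S(2) by (cases "(I, J) \<in> X2") (simp_all add: Phi2_def)
  qed
  moreover have "Phi3 T (I, L) = F3 (I, L)" for I L
  proof (cases "(I, L) \<in> X3")
    case True
    then have x: "I \<subseteq> K" "L = K - I" by (auto simp: X3_iff)
    have "admissible I {} {}" using x by (simp add: admissible_def)
    from component[OF this] show ?thesis using True x by (simp add: Phi3_def H_def)
  next
    case False
    then show ?thesis using S(3) by (auto simp: Phi3_def)
  qed
  ultimately have "Phi1 T = F1" "Phi2 T = F2" "Phi3 T = F3" by (auto simp: fun_eq_iff)
  then show ?thesis using cub by blast
qed

end

section \<open>Equivariance of the isomorphism and the resulting decomposition\<close>

lemma scaleC_apply: "(a *\<^sub>C f) x = a *\<^sub>C f x"
  by (simp add: scaleC_fun_def)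

context vs_family
begin

text \<open>The kernel and surjectivity statements give a linear bijection; it is equivariant
  because \<open>component\<close> commutes with \<open>pull\<close>.\<close>

lemma requiv_cub_sums: "requiv G cub_rep (plus_rep summand1 (plus_rep summand2 summand3))"
proof (rule requivI)
  let ?Phi = "\<lambda>T. (Phi1 T, Phi2 T, Phi3 T)"
  have V: "vspace cub_rep = cub" "act cub_rep g = restrict (pull g) cub" for g by (simp_all add: cub_rep_def)
  have tri: "T \<in> trilinears" if "T \<in> cub" for T using that by (simp add: cub_def)
  show "cvs.subspace (vspace cub_rep)" unfolding V by (rule subspace_cub)
  show "act cub_rep g m \<in> vspace cub_rep" if "g \<in> carrier G" "m \<in> vspace cub_rep" for g m
    using that pull_cub unfolding V by (simp del: carrier_product_group)
  have lin: "Phi1 (T + U) = Phi1 T + Phi1 U" "Phi2 (T + U) = Phi2 T + Phi2 U" "Phi3 (T + U) = Phi3 T + Phi3 U"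
    "Phi1 (a *\<^sub>C T) = a *\<^sub>C Phi1 T" "Phi2 (a *\<^sub>C T) = a *\<^sub>C Phi2 T" "Phi3 (a *\<^sub>C T) = a *\<^sub>C Phi3 T" for T U a
    by (auto simp: Phi1_def Phi2_def Phi3_def component_linear fun_eq_iff scaleC_apply)
  then show "lin_on (vspace cub_rep) ?Phi"
    by (simp add: lin_on_def plus_prod_def scaleC_prod_def)
  show "bij_betw ?Phi (vspace cub_rep) (vspace (plus_rep summand1 (plus_rep summand2 summand3)))"
    unfolding bij_betw_def V plus_rep_simps
  proof (intro conjI inj_onI equalityI subsetI)
    fix T U assume T: "T \<in> cub" and U: "U \<in> cub" and eq: "?Phi T = ?Phi U"
    have D: "T + (-1) *\<^sub>C U \<in> cub"
      by (intro cvs.subspace_add[OF subspace_cub] cvs.subspace_scale[OF subspace_cub] T U)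
    have z: "x + (-1) *\<^sub>C x = 0" for x :: "'x::complex_vector"
      by (simp add: cvs.scale_minus_left scaleC_one)
    have "Phi1 (T + (-1) *\<^sub>C U) = 0" "Phi2 (T + (-1) *\<^sub>C U) = 0" "Phi3 (T + (-1) *\<^sub>C U) = 0"
      using eq by (simp_all only: lin prod.inject z)
    then have "T + (-1) *\<^sub>C U = 0" by (rule Phi_kernel[OF D])
    then show "T = U" by (simp add: cvs.scale_minus_left scaleC_one)
  next
    fix F assume "F \<in> ?Phi ` cub"
    then obtain T where "T \<in> cub" "F = ?Phi T" by blast
    then show "F \<in> vspace summand1 \<times> vspace summand2 \<times> vspace summand3" using Phi_mem[OF tri] by simp
  next
    fix F assume "F \<in> vspace summand1 \<times> vspace summand2 \<times> vspace summand3"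
    then obtain F1 F2 F3 where F: "F = (F1, F2, F3)" and m: "F1 \<in> vspace summand1" "F2 \<in> vspace summand2" "F3 \<in> vspace summand3" by auto
    obtain T where "T \<in> cub" "Phi1 T = F1" "Phi2 T = F2" "Phi3 T = F3" using Phi_surj[OF m] by blast
    then show "F \<in> ?Phi ` cub" unfolding F by (intro image_eqI[of _ _ T]) auto
  qed
  fix g T assume g: "g \<in> carrier G" and m: "T \<in> vspace cub_rep"
  have T: "T \<in> cub" using m by (simp only: V)
  have e: "component c (pull g T) = pull g (component c T)" for c unfolding component_def by (rule tensor_op_pull[OF g])
  have i: "component (lab I J M) T \<in> isotypic (lab I J {})" for I J M
    using component_isotypic[OF tri[OF T], of "lab I J M"] unfolding isotypic_lab[of I J M] .
  note M = Phi_mem[OF tri[OF T]]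
  have fa: "act (frep c) g F = pull g F" if "F \<in> isotypic c" for c F
    using that by (simp add: frep_def)
  \<comment> \<open>The action on a multiple is restricted to its space, so membership has to be
    established before it can be computed entrywise.\<close>
  have ma: "act (multiple_rep k (frep c)) g F n = (if n < k then pull g (F n) else 0)"
    if "\<And>n. n < k \<Longrightarrow> F n \<in> isotypic c" "\<And>n. \<not> n < k \<Longrightarrow> F n = 0" for k c F n
  proof -
    have "F \<in> vspace (multiple_rep k (frep c))"
      using that unfolding multiple_rep_def dsum_rep_simps frep_def by simp
    then show ?thesis using that(1) unfolding multiple_rep_def dsum_rep_simps(2) by (simp add: fa)
  qed
  have "Phi1 (pull g T) (I, J, L) n = act summand1 g (Phi1 T) (I, J, L) n" for I J L n
  proof (cases "(I, J, L) \<in> X1")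
    case True
    have "act summand1 g (Phi1 T) (I, J, L) n = act (multiple_rep (mult1 J) (frep (lab I J {}))) g (Phi1 T (I, J, L)) n"
      using M(1) True unfolding summand1_def dsum_rep_simps(2) by simp
    also have "\<dots> = (if n < mult1 J then pull g (Phi1 T (I, J, L) n) else 0)"
      by (rule ma) (simp_all add: Phi1_def True i)
    finally show ?thesis using True by (simp add: Phi1_def e)
  next
    case False
    then show ?thesis using M(1) unfolding summand1_def dsum_rep_simps(2) by (simp add: Phi1_def)
  qed
  moreover have "Phi2 (pull g T) (I, J) n = act summand2 g (Phi2 T) (I, J) n" for I J n
  proof (cases "(I, J) \<in> X2")
    case True
    have "act summand2 g (Phi2 T) (I, J) n = act (multiple_rep (mult2 J) (frep (lab I J {}))) g (Phi2 T (I, J)) n"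
      using M(2) True unfolding summand2_def dsum_rep_simps(2) by simp
    also have "\<dots> = (if n < mult2 J then pull g (Phi2 T (I, J) n) else 0)"
      by (rule ma) (simp_all add: Phi2_def True i)
    finally show ?thesis using True by (simp add: Phi2_def e)
  next
    case False
    then show ?thesis using M(2) unfolding summand2_def dsum_rep_simps(2) by (simp add: Phi2_def)
  qed
  moreover have "Phi3 (pull g T) (I, L) = act summand3 g (Phi3 T) (I, L)" for I L
  proof (cases "(I, L) \<in> X3")
    case True
    have "act summand3 g (Phi3 T) (I, L) = act (frep (lab I {} {})) g (Phi3 T (I, L))"
      using M(3) True unfolding summand3_def dsum_rep_simps(2) by simp
    also have "\<dots> = pull g (Phi3 T (I, L))"
      by (rule fa) (simp add: Phi3_def True i)
    finally show ?thesis using True by (simp add: Phi3_def e)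
  next
    case False
    then show ?thesis using M(3) unfolding summand3_def dsum_rep_simps(2) by (simp add: Phi3_def)
  qed
  ultimately have a: "Phi1 (pull g T) = act summand1 g (Phi1 T)" "Phi2 (pull g T) = act summand2 g (Phi2 T)" "Phi3 (pull g T) = act summand3 g (Phi3 T)"
    by (auto simp only: fun_eq_iff split_paired_All)
  show "?Phi (act cub_rep g T) = act (plus_rep summand1 (plus_rep summand2 summand3)) g (?Phi T)"
    using M T by (simp add: V(2) plus_rep_simps a)
qed

text \<open>The empty third argument of \<open>lab\<close> selects \<open>Pl\<close> throughout
  \<open>J\<close>; by \<open>isotypic_lab\<close> any other choice gives the same space.\<close>

lemma requiv_schur_term:
  assumes "I \<union> J \<union> L = K" "I \<inter> J = {}" "I \<inter> L = {}" "J \<inter> L = {}"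
  shows "requiv G (schur_term A I J L) (frep (lab I J {}))"
  unfolding schur_term_def assms(1)
  by (rule requiv_tensor_schur) (auto simp: lab_def)

lemma requiv_ideal:
  "requiv G (ideal_rep 3 Vrep secants)
    (plus_rep (dsum_rep X1 (\<lambda>(I, J, L). multiple_rep (mult1 J) (schur_term A I J L)))
      (plus_rep (dsum_rep X2 (\<lambda>(I, J). multiple_rep (mult2 J) (schur_term A I J {})))
        (dsum_rep X3 (\<lambda>(I, L). schur_term A I {} L))))"
proof (rule requiv_trans[OF requiv_ideal_cub requiv_trans[OF requiv_cub_sums requiv_sym]])
  show "requiv G (plus_rep (dsum_rep X1 (\<lambda>(I, J, L). multiple_rep (mult1 J) (schur_term A I J L)))
      (plus_rep (dsum_rep X2 (\<lambda>(I, J). multiple_rep (mult2 J) (schur_term A I J {})))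
        (dsum_rep X3 (\<lambda>(I, L). schur_term A I {} L)))) (plus_rep summand1 (plus_rep summand2 summand3))"
    unfolding summand1_def summand2_def summand3_def
  proof (intro requiv_plus requiv_dsum)
    fix x assume "x \<in> X1"
    then obtain I J L where x: "x = (I, J, L)" and h: "I \<union> J \<union> L = K" "I \<inter> J = {}" "I \<inter> L = {}" "J \<inter> L = {}"
      unfolding X1_def by blast
    show "requiv G (case x of (I, J, L) \<Rightarrow> multiple_rep (mult1 J) (schur_term A I J L))
        (case x of (I, J, L) \<Rightarrow> multiple_rep (mult1 J) (frep (lab I J {})))"
      unfolding x prod.case by (intro requiv_multiple requiv_schur_term h)
  next
    fix x assume "x \<in> X2"
    then obtain I J where x: "x = (I, J)" and h: "I \<union> J \<union> {} = K" "I \<inter> J = {}"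
      unfolding X2_def by blast
    show "requiv G (case x of (I, J) \<Rightarrow> multiple_rep (mult2 J) (schur_term A I J {}))
        (case x of (I, J) \<Rightarrow> multiple_rep (mult2 J) (frep (lab I J {})))"
      unfolding x prod.case by (intro requiv_multiple requiv_schur_term h) simp_all
  next
    fix x assume "x \<in> X3"
    then obtain I L where x: "x = (I, L)" and h: "I \<union> {} \<union> L = K" "I \<inter> L = {}"
      unfolding X3_def by blast
    show "requiv G (case x of (I, L) \<Rightarrow> schur_term A I {} L) (case x of (I, L) \<Rightarrow> frep (lab I {} {}))"
      unfolding x prod.case by (intro requiv_schur_term h) simp_all
  qed
qed

text \<open>The homomorphism law travels along the equivalences, from \<open>cub_rep\<close> to the
  ideal and from there to the direct sum.\<close>

theorem ideal_decomposition:
  "rep_iso G (ideal_rep 3 Vrep secants)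
    (plus_rep (dsum_rep X1 (\<lambda>(I, J, L). multiple_rep (mult1 J) (schur_term A I J L)))
      (plus_rep (dsum_rep X2 (\<lambda>(I, J). multiple_rep (mult2 J) (schur_term A I J {})))
        (dsum_rep X3 (\<lambda>(I, L). schur_term A I {} L))))" (is "rep_iso G ?R ?S")
proof -
  have R: "is_rep G ?R"
    by (rule requiv_is_rep[OF is_rep_cub requiv_sym[OF requiv_ideal_cub]]) (simp add: ideal_rep_def)
  have S: "is_rep G ?S"
    by (rule requiv_is_rep[OF R requiv_ideal]) (simp add: plus_rep_simps)
  show ?thesis
    using R S requiv_ideal unfolding rep_iso_def requiv_def by blast
qed

end

theorem theorem4p7:
  fixes A :: "nat \<Rightarrow> 'v::complex_vector set" and k :: nat
  assumes "k \<ge> 2"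
    and "\<And>i. i \<in> {1..k} \<Longrightarrow> cvs.subspace (A i)"
    and "\<And>i. i \<in> {1..k} \<Longrightarrow> \<exists>B. finite B \<and> cvs.span B = A i"
  shows "rep_iso (product_group {1..k} (\<lambda>i. GL (A i)))
    (ideal_rep 3 (tensor_rep {1..k} (std_rep A))
       (secant_variety (tensor {1..k} A) 2 (segre {1..k} A)))
    (plus_rep
      (dsum_rep {(I, J, L). I \<union> J \<union> L = {1..k} \<and> I \<inter> J = {} \<and> I \<inter> L = {} \<and> J \<inter> L = {} \<and>
                            card J > 1 \<and> card L > 0}
         (\<lambda>(I, J, L). multiple_rep (nat (cubic_mult (card J))) (schur_term A I J L)))
      (plus_rep
        (dsum_rep {(I, J). I \<union> J = {1..k} \<and> I \<inter> J = {} \<and> card J > 1}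
           (\<lambda>(I, J). multiple_rep (nat (cubic_mult (card J) - 1)) (schur_term A I J {})))
        (dsum_rep {(I, L). I \<union> L = {1..k} \<and> I \<inter> L = {} \<and> card L > 0 \<and> even (card L)}
           (\<lambda>(I, L). schur_term A I {} L))))"
proof -
  \<comment> \<open>The finite spanning sets supply the interpolation data of the locale.\<close>
  have "\<forall>i\<in>{1..k}. \<exists>N p b. interp (A i) (dual (A i)) (N :: 'v set) p b"
    using assms(3) exists_interp_dual by metis
  then obtain N p b where ip: "\<And>i. i \<in> {1..k} \<Longrightarrow> interp (A i) (dual (A i)) (N i :: 'v set) (p i) (b i)"
    by metis
  interpret vs_family "{1..k}" A N p b
    by unfold_locales (use assms(2) ip in auto)
  show ?thesis
    using ideal_decomposition unfolding X1_def X2_def X3_def .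
qed

end
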